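(* (i) Let $\beta\in\mathbb{R}$ and $0<h\le h_0$. Provided the penalty parameter $\eta_\beta$ is chosen sufficiently large (larger than a threshold independent of $h$ and of the location of the interface relative to the mesh), there exists a constant $C_s^{(1)}>0$ such that $$B_h^{(1)}(v,v)\ge C_s^{(1)}\|v\|_{B_h^{(1)}}^2\qquad\text{for all } v\in V_h^\Gamma .$$ (ii) If $\eta_1\ge 1$ and $\eta\ge 2$, there exists a constant $C_s^{(2)}>0$ such that $$B_h^{(2)}(v,v)\ge C_s^{(2)}\|v\|_{B_h^{(2)}}^2\qquad\text{for all } v\in V_h^\Gamma .$$ Here $C_s^{(1)}$ depends only on the parameter $\eta_\beta$, and $C_s^{(2)}$ depends only on the parameters $\eta_1$ and $\eta$.
   Context: Domain. $\Omega\subset\mathbb{R}^d$, $d\in\{2,3\}$, is a bounded convex polygonal/polyhedral domain; $\Gamma$ is a $C^2$-smooth internal interface dividing $\Omega$ into two open sets $\Omega_1,\Omega_2$, with $\Gamma=\partial\Omega_1$ and $\Gamma\cap\partial\Omega=\emptyset$. The coefficient $\alpha$ is a fixed function bounded below and above by positive constants (possibly discontinuous across $\Gamma$; its one-sided traces on $\Gamma$ are assumed to be defined and to satisfy the same bounds). Mesh. $\{\mathcal{T}_h\}$ is a family of conforming, quasi-uniform, shape-regular partitions of $\Omega$ into triangles and parallelograms ($d=2$) or tetrahedra and parallelepipeds ($d=3$), not fitted to $\Gamma$. $h_K=\operatorname{diam}K$, $h=\max_K h_K$; $\gamma_0$ is a constant with $h_K^d\le\gamma_0|K|$ for all $K$.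 $\mathcal{T}_h^\Gamma=\{K\in\mathcal{T}_h:|K\cap\Gamma|\ne0\}$ (with $|\cdot|$ the measure of the appropriate dimension), $e_K=K\cap\Gamma$, $\mathcal{E}_h^\Gamma=\{e_K:K\in\mathcal{T}_h^\Gamma\}$, $K_i=K\cap\Omega_i$, $\boldsymbol{n}_i$ is the unit outward normal on $\partial K_i$. Since $\Gamma$ is $C^2$, there are constants $\gamma_1,\gamma_2$ such that each $e_K$ lies in a strip of width $\delta\le\gamma_1h_K^2$ and $|\boldsymbol{n}_i(x)-\boldsymbol{n}_i(y)|\le\gamma_2h_K$ for $x,y\in e_K$. Spaces. $V_h$ is the space of continuous piecewise polynomial functions of degree $p\ge1$ on $\mathcal{T}_h$ vanishing on $\partial\Omega$ (polynomials of total degree $\le p$ on simplices, and affine images of polynomials of degree $\le p$ in each variable on parallelograms/parallelepipeds; this local space is denoted $\mathcal{P}_p$). With $\chi_i$ the characteristic function of $\Omega_i$, $V_h^\Gamma=\chi_1V_h+\chi_2V_h$. Averages and jumps on $\Gamma$. With $v_i,\boldsymbol{q}_i$ the traces from $K_i$: $[v]=v_1\boldsymbol{n}_1+v_2\boldsymbol{n}_2$ for scalars; $\{\boldsymbol{q}\}=\kappa_1\boldsymbol{q}_1+\kappa_2\boldsymbol{q}_2$ for vectors. On each $K\in\mathcal{T}_h^\Gamma$: $\kappa_i=0$ if $|K_i|/|K|<c_0h_K$; $\kappa_i=1$ if $|K_i|/|K|>1-c_0h_K$; $\kappa_i=|K_i|/|K|$ otherwise, where $c_0\ge2\gamma_0\gamma_1$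 is a fixed constant (meshes are fine enough that $c_0h_K\le 1/2$, so this is well defined). Constant $h_0$. $h_0>0$ is a constant such that for all $h\in(0,h_0]$, every $K\in\mathcal{T}_h^\Gamma$ and $i=1,2$, $\|\kappa_i^{1/2}v\|_{L^2(e_K)}\le C h_K^{-1/2}\|v\|_{L^2(K_i)}$ for all polynomials $v$ of any fixed degree, with $C$ independent of $h$ and of the location of $\Gamma$ relative to the mesh (such $h_0$ exists). Lifting. For $K\in\mathcal{T}_h^\Gamma$, $e=K\cap\Gamma$, let $W_K=\{\boldsymbol{w}\in[L^2(\Omega)]^d:\boldsymbol{w}|_{K_i}\in[\mathcal{P}_p(K_i)]^d,\,i=1,2,\ \boldsymbol{w}|_{\Omega\setminus K}=0\}$, and define $r_e:[L^2(e)]^d\to W_K$ by $\int_Kr_e(\boldsymbol{q})\cdot\alpha\boldsymbol{w}_h=-\int_e\boldsymbol{q}\cdot\{\alpha\boldsymbol{w}_h\}$ for all $\boldsymbol{w}_h\in W_K$. Forms. For $\beta\in\mathbb{R}$ and parameter $\eta_\beta>0$, $$B_h^{(1)}(w,v)=\int_{\Omega_1\cup\Omega_2}\alpha\nabla w\cdot\nabla v-\int_\Gamma\{\alpha\nabla w\}\cdot[v]-\beta\int_\Gamma[w]\cdot\{\alpha\nabla v\}+\sum_{K\in\mathcal{T}_h^\Gamma}\frac{\eta_\beta}{h_K}\int_{e_K}[w]\cdot[v].$$ $B_h^{(2)}(w,v)$ is $B_h^{(1)}(w,v)$ with $\beta=1$ (penalty parameter $\eta_1$) plus $\sum_{e\in\mathcal{E}_h^\Gamma}\int_\Omega\eta\,\alpha\,r_e([w])\cdot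 r_e([v])$, where $\eta>0$. Norms. $|v|_{1,\Omega_1\cup\Omega_2}^2=\int_{\Omega_1\cup\Omega_2}\alpha|\nabla v|^2$, $|v|_{0,\mathcal{E}_h^\Gamma}^2=\sum_{K\in\mathcal{T}_h^\Gamma}\eta_\beta h_K^{-1}\|[v]\|_{L^2(e_K)}^2$, $|v|_{0,\mathcal{T}_h^\Gamma}^2=\sum_{K\in\mathcal{T}_h^\Gamma}\eta\|\alpha^{1/2}r_{e_K}([v])\|_{L^2(K)}^2$, $$\|v\|_{B_h^{(1)}}^2=|v|_{1,\Omega_1\cup\Omega_2}^2+|v|_{0,\mathcal{E}_h^\Gamma}^2+\sum_{K\in\mathcal{T}_h^\Gamma}\eta_\beta^{-1}h_K\|\{\alpha\nabla v\}\|_{L^2(e_K)}^2,$$ $$\|v\|_{B_h^{(2)}}^2=|v|_{1,\Omega_1\cup\Omega_2}^2+|v|_{0,\mathcal{E}_h^\Gamma}^2+|v|_{0,\mathcal{T}_h^\Gamma}^2\quad(\text{with }\beta=1).$$ *)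

theory Defs
  imports "HOL-Analysis.Analysis"
begin

section \<open>Surface measure\<close>

text \<open>
  Hausdorff measure of integer dimension $m \ge 1$, with the normalisation that makes it agree with
  the $m$-dimensional area on $C^1$ surfaces. Bounded covering sets are required because
  \<^const>\<open>diameter\<close> carries no information on unbounded sets. By Caratheodory's criterion for
  metric outer measures the outer measure is countably additive on the Borel sets, so the
  \<^const>\<open>measure_of\<close> below does restrict it to them.
\<close>

definition hausdorff_pre :: "nat \<Rightarrow> real \<Rightarrow> 'a::euclidean_space set \<Rightarrow> ennreal" where
  "hausdorff_pre m \<delta> A =
     (INF U \<in> {U :: nat \<Rightarrow> 'a set. A \<subseteq> (\<Union>j. U j) \<and> (\<forall>j. bounded (U j) \<and> diameter (U j) \<le> \<delta>)}.
        \<Sum>j. ennreal (unit_ball_vol (real m) * (diameter (U j) / 2) ^ m))"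

definition hausdorff_outer :: "nat \<Rightarrow> 'a::euclidean_space set \<Rightarrow> ennreal" where
  "hausdorff_outer m A = (SUP \<delta> \<in> {0<..}. hausdorff_pre m \<delta> A)"

definition hausdorff_measure :: "nat \<Rightarrow> 'a::euclidean_space measure" where
  "hausdorff_measure m = measure_of UNIV (sets borel) (hausdorff_outer m)"

definition surf :: "(real^'n::finite) measure" where
  "surf = hausdorff_measure (CARD('n) - 1)"

definition L2norm :: "'a measure \<Rightarrow> 'a set \<Rightarrow> ('a \<Rightarrow> 'b::real_normed_vector) \<Rightarrow> real" where
  "L2norm M S f = sqrt (LINT x:S|M. (norm (f x))\<^sup>2)"


section \<open>Polynomials, gradients, traces\<close>

definition monomial :: "('n::finite \<Rightarrow> nat) \<Rightarrow> real^'n \<Rightarrow> real" where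
  "monomial m x = (\<Prod>i\<in>UNIV. (x $ i) ^ m i)"

definition poly_total :: "nat \<Rightarrow> (real^'n::finite \<Rightarrow> real) set" where
  "poly_total k = {q. \<exists>a. q = (\<lambda>x. \<Sum>m | (\<Sum>i\<in>UNIV. m i) \<le> k. a m * monomial m x)}"

definition poly_each :: "nat \<Rightarrow> (real^'n::finite \<Rightarrow> real) set" where
  "poly_each k = {q. \<exists>a. q = (\<lambda>x. \<Sum>m | (\<forall>i. m i \<le> k). a m * monomial m x)}"

definition grad :: "('a::euclidean_space \<Rightarrow> real) \<Rightarrow> 'a \<Rightarrow> 'a" where
  "grad f x = (THE D. GDERIV f x :> D)"

text \<open>
  The trace at a point of the boundary of \<open>S\<close>, taken as a limit from inside \<open>S\<close>; a set that does not
  reach \<open>x\<close> contributes nothing there.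
\<close>

definition side_trace :: "'a::topological_space set \<Rightarrow> ('a \<Rightarrow> 'b::{t2_space,zero}) \<Rightarrow> 'a \<Rightarrow> 'b" where
  "side_trace S f x = (if x islimpt S then Lim (at x within S) f else 0)"


section \<open>Meshes and interfaces\<close>

text \<open>
  One instance of the discretised interface problem: the domain, the two subdomains (only the
  indices 1 and 2 are used), the coefficient, its one-sided traces on the interface, and the mesh.
  The mesh cells are closed sets.
\<close>

record ('n::finite) problem =
  Dom :: "(real^'n) set"
  Sub :: "nat \<Rightarrow> (real^'n) set"
  coef :: "real^'n \<Rightarrow> real"
  coef_tr :: "nat \<Rightarrow> real^'n \<Rightarrow> real"
  Mesh :: "(real^'n) set set"

definition Gam :: "'n::finite problem \<Rightarrow> (real^'n) set" where
  "Gam c = frontier (Sub c 1)"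

definition polytopal_domain :: "'a::euclidean_space set \<Rightarrow> bool" where
  "polytopal_domain \<Omega> \<longleftrightarrow> \<Omega> \<noteq> {} \<and> open \<Omega> \<and> bounded \<Omega> \<and> convex \<Omega> \<and> polytope (closure \<Omega>)"

text \<open>
  \<open>\<phi>\<close> is a $C^2$ function on \<open>U\<close> with nowhere vanishing gradient \<open>g\<close> that is negative, zero and positive
  exactly on the first subdomain, on the interface and on the second subdomain, respectively.
\<close>

definition C2_level_function ::
  "'n::finite problem \<Rightarrow> (real^'n) set \<Rightarrow> (real^'n \<Rightarrow> real) \<Rightarrow> (real^'n \<Rightarrow> real^'n) \<Rightarrow> bool" where
  "C2_level_function c U \<phi> g \<longleftrightarrow>
     open U \<and>
     (\<forall>x\<in>U. GDERIV \<phi> x :> g x \<and> g x \<noteq> 0) \<and>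
     (\<exists>H :: real^'n \<Rightarrow> (real^'n) \<Rightarrow>\<^sub>L (real^'n).
        (\<forall>x\<in>U. (g has_derivative blinfun_apply (H x)) (at x)) \<and> continuous_on U H) \<and>
     U \<inter> Sub c 1 = {x\<in>U. \<phi> x < 0} \<and>
     U \<inter> Gam c = {x\<in>U. \<phi> x = 0} \<and>
     U \<inter> Sub c 2 = {x\<in>U. \<phi> x > 0}"

definition C2_interface :: "'n::finite problem \<Rightarrow> bool" where
  "C2_interface c \<longleftrightarrow>
     open (Sub c 1) \<and> open (Sub c 2) \<and> Sub c 1 \<noteq> {} \<and> Sub c 2 \<noteq> {} \<and> Sub c 1 \<inter> Sub c 2 = {} \<and>
     Dom c = Sub c 1 \<union> Gam c \<union> Sub c 2 \<and>
     Gam c \<inter> frontier (Dom c) = {} \<and>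
     (\<forall>x\<in>Gam c. \<exists>U \<phi> g. x \<in> U \<and> C2_level_function c U \<phi> g)"

definition normal :: "'n::finite problem \<Rightarrow> nat \<Rightarrow> real^'n \<Rightarrow> real^'n" where
  "normal c i x =
     (let n = (THE n. \<exists>U \<phi> g. x \<in> U \<and> C2_level_function c U \<phi> g \<and> n = g x /\<^sub>R norm (g x))
      in if i = 1 then n else - n)"

definition coefficient :: "'n::finite problem \<Rightarrow> real \<Rightarrow> real \<Rightarrow> bool" where
  "coefficient c \<alpha>min \<alpha>max \<longleftrightarrow>
     coef c \<in> borel_measurable (lebesgue_on (Dom c)) \<and>
     (\<forall>x\<in>Dom c. \<alpha>min \<le> coef c x \<and> coef c x \<le> \<alpha>max) \<and>
     (\<forall>i\<in>{1,2}.
        coef_tr c i \<in> borel_measurable (restrict_space borel (Gam c)) \<and>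
        (\<forall>x\<in>Gam c. \<alpha>min \<le> coef_tr c i x \<and> coef_tr c i x \<le> \<alpha>max) \<and>
        (AE x in surf. x \<in> Gam c \<longrightarrow> (coef c \<longlongrightarrow> coef_tr c i x) (at x within Sub c i)))"

definition is_simplex :: "(real^'n::finite) set \<Rightarrow> bool" where
  "is_simplex K \<longleftrightarrow> int CARD('n) simplex K"

text \<open>\<open>K\<close> is the image of the unit cube under the invertible affine map \<open>x \<mapsto> b + A x\<close>.\<close>

definition cube_image :: "real^'n::finite^'n \<Rightarrow> real^'n \<Rightarrow> (real^'n) set \<Rightarrow> bool" where
  "cube_image A b K \<longleftrightarrow> invertible A \<and> K = (\<lambda>x. b + A *v x) ` cbox 0 1"

definition conforming_mesh :: "(real^'n::finite) set \<Rightarrow> (real^'n) set set \<Rightarrow> bool" where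
  "conforming_mesh \<Omega> T \<longleftrightarrow>
     finite T \<and> \<Union>T = closure \<Omega> \<and>
     (\<forall>K\<in>T. is_simplex K \<or> (\<exists>A b. cube_image A b K)) \<and>
     (\<forall>K\<in>T. \<forall>K'\<in>T. (K \<inter> K') face_of K)"

definition mesh_size :: "'n::finite problem \<Rightarrow> real" where
  "mesh_size c = Max (diameter ` Mesh c)"

definition shape_regular :: "real \<Rightarrow> 'a::euclidean_space set set \<Rightarrow> bool" where
  "shape_regular \<sigma> T \<longleftrightarrow> (\<forall>K\<in>T. \<exists>x r. 0 < r \<and> ball x r \<subseteq> K \<and> diameter K \<le> \<sigma> * r)"

definition quasi_uniform :: "real \<Rightarrow> 'a::euclidean_space set set \<Rightarrow> bool" where
  "quasi_uniform \<tau> T \<longleftrightarrow> (\<forall>K\<in>T. \<forall>K'\<in>T. diameter K' \<le> \<tau> * diameter K)"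

definition cut_cells :: "'n::finite problem \<Rightarrow> (real^'n) set set" where
  "cut_cells c = {K \<in> Mesh c. emeasure surf (K \<inter> Gam c) \<noteq> 0}"

text \<open>
  The part $K_i$ of a cell in the $i$-th subdomain. Dropping the (null) boundary of the cell makes
  piecewise polynomials and their gradients smooth on it.
\<close>

definition piece :: "'n::finite problem \<Rightarrow> (real^'n) set \<Rightarrow> nat \<Rightarrow> (real^'n) set" where
  "piece c K i = interior K \<inter> Sub c i"


section \<open>Finite element spaces\<close>

definition local_space :: "nat \<Rightarrow> (real^'n::finite) set \<Rightarrow> (real^'n \<Rightarrow> real) set" where
  "local_space p K =
     {q. (is_simplex K \<and> q \<in> poly_total p) \<or>
         (\<exists>A b. cube_image A b K \<and> (\<lambda>x. q (b + A *v x)) \<in> poly_each p)}"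

text \<open>Functions on the domain are extended by zero, which also encodes the boundary condition.\<close>

definition Vh :: "nat \<Rightarrow> 'n::finite problem \<Rightarrow> (real^'n \<Rightarrow> real) set" where
  "Vh p c = {v. continuous_on (closure (Dom c)) v \<and> (\<forall>x. x \<notin> Dom c \<longrightarrow> v x = 0) \<and>
               (\<forall>K\<in>Mesh c. \<exists>q\<in>local_space p K. \<forall>x\<in>K. v x = q x)}"

definition VhGam :: "nat \<Rightarrow> 'n::finite problem \<Rightarrow> (real^'n \<Rightarrow> real) set" where
  "VhGam p c =
     {v. \<exists>v1\<in>Vh p c. \<exists>v2\<in>Vh p c. v = (\<lambda>x. indicator (Sub c 1) x * v1 x + indicator (Sub c 2) x * v2 x)}"


section \<open>Averages, jumps and lifting\<close>

definition kappa :: "real \<Rightarrow> 'n::finite problem \<Rightarrow> (real^'n) set \<Rightarrow> nat \<Rightarrow> real" where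
  "kappa c0 c K i =
     (let r = measure lebesgue (piece c K i) / measure lebesgue K
      in if r < c0 * diameter K then 0 else if r > 1 - c0 * diameter K then 1 else r)"

text \<open>
  The jump uses traces from the whole subdomains: on $V_h^\Gamma$ these coincide with the traces from
  the pieces of a cell wherever the latter exist.
\<close>

definition jump :: "'n::finite problem \<Rightarrow> (real^'n \<Rightarrow> real) \<Rightarrow> real^'n \<Rightarrow> real^'n" where
  "jump c v x = (\<Sum>i\<in>{1,2}. side_trace (Sub c i) v x *\<^sub>R normal c i x)"

text \<open>The average $\{\alpha w\}$ of a vector field \<open>w\<close> times the coefficient, on the cell \<open>K\<close>.\<close>

definition avg :: "real \<Rightarrow> 'n::finite problem \<Rightarrow> (real^'n) set \<Rightarrow> (real^'n \<Rightarrow> real^'n) \<Rightarrow> real^'n \<Rightarrow> real^'n" where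
  "avg c0 c K w x = (\<Sum>i\<in>{1,2}. (kappa c0 c K i * coef_tr c i x) *\<^sub>R side_trace (piece c K i) w x)"

text \<open>
  Elements of $W_K$ are classes in $L^2$; the representatives vanishing off the two (open) pieces are used,
  which makes the lifting unique as a function.
\<close>

definition WK :: "nat \<Rightarrow> 'n::finite problem \<Rightarrow> (real^'n) set \<Rightarrow> (real^'n \<Rightarrow> real^'n) set" where
  "WK p c K =
     {w. (\<forall>i\<in>{1,2}. \<forall>j. \<exists>q\<in>local_space p K. \<forall>x\<in>piece c K i. w x $ j = q x) \<and>
         (\<forall>x. x \<notin> piece c K 1 \<union> piece c K 2 \<longrightarrow> w x = 0)}"

definition lifting ::
  "real \<Rightarrow> nat \<Rightarrow> 'n::finite problem \<Rightarrow> (real^'n) set \<Rightarrow> (real^'n \<Rightarrow> real^'n) \<Rightarrow> real^'n \<Rightarrow> real^'n" where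
  "lifting c0 p c K q =
     (THE r. r \<in> WK p c K \<and>
        (\<forall>w\<in>WK p c K.
           (LINT x:K|lebesgue. r x \<bullet> (coef c x *\<^sub>R w x)) =
           - (LINT x:(K \<inter> Gam c)|surf. q x \<bullet> avg c0 c K w x)))"


section \<open>Bilinear forms and norms\<close>

text \<open>
  The average is defined cell by cell, so integrals over the interface are sums over the
  cut cells.
\<close>

definition B1 ::
  "real \<Rightarrow> 'n::finite problem \<Rightarrow> real \<Rightarrow> real \<Rightarrow> (real^'n \<Rightarrow> real) \<Rightarrow> (real^'n \<Rightarrow> real) \<Rightarrow> real" where
  "B1 c0 c \<beta> \<eta>\<beta> w v =
     (LINT x:(Sub c 1 \<union> Sub c 2)|lebesgue. coef c x * (grad w x \<bullet> grad v x))
     - (\<Sum>K\<in>cut_cells c. LINT x:(K \<inter> Gam c)|surf. avg c0 c K (grad w) x \<bullet> jump c v x)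
     - \<beta> * (\<Sum>K\<in>cut_cells c. LINT x:(K \<inter> Gam c)|surf. jump c w x \<bullet> avg c0 c K (grad v) x)
     + (\<Sum>K\<in>cut_cells c. \<eta>\<beta> / diameter K * (LINT x:(K \<inter> Gam c)|surf. jump c w x \<bullet> jump c v x))"

definition B2 ::
  "real \<Rightarrow> nat \<Rightarrow> 'n::finite problem \<Rightarrow> real \<Rightarrow> real \<Rightarrow> (real^'n \<Rightarrow> real) \<Rightarrow> (real^'n \<Rightarrow> real) \<Rightarrow> real" where
  "B2 c0 p c \<eta>1 \<eta> w v =
     B1 c0 c 1 \<eta>1 w v
     + (\<Sum>K\<in>cut_cells c. LINT x:Dom c|lebesgue.
          \<eta> * coef c x * (lifting c0 p c K (jump c w) x \<bullet> lifting c0 p c K (jump c v) x))"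

definition energy_sq :: "'n::finite problem \<Rightarrow> (real^'n \<Rightarrow> real) \<Rightarrow> real" where
  "energy_sq c v = (LINT x:(Sub c 1 \<union> Sub c 2)|lebesgue. coef c x * (norm (grad v x))\<^sup>2)"

definition jump_sq :: "'n::finite problem \<Rightarrow> real \<Rightarrow> (real^'n \<Rightarrow> real) \<Rightarrow> real" where
  "jump_sq c \<eta>\<beta> v =
     (\<Sum>K\<in>cut_cells c. \<eta>\<beta> / diameter K * (L2norm surf (K \<inter> Gam c) (jump c v))\<^sup>2)"

definition lift_sq :: "real \<Rightarrow> nat \<Rightarrow> 'n::finite problem \<Rightarrow> real \<Rightarrow> (real^'n \<Rightarrow> real) \<Rightarrow> real" where
  "lift_sq c0 p c \<eta> v =
     (\<Sum>K\<in>cut_cells c.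
        \<eta> * (L2norm lebesgue K (\<lambda>x. sqrt (coef c x) *\<^sub>R lifting c0 p c K (jump c v) x))\<^sup>2)"

definition norm_B1 :: "real \<Rightarrow> 'n::finite problem \<Rightarrow> real \<Rightarrow> (real^'n \<Rightarrow> real) \<Rightarrow> real" where
  "norm_B1 c0 c \<eta>\<beta> v =
     sqrt (energy_sq c v + jump_sq c \<eta>\<beta> v +
       (\<Sum>K\<in>cut_cells c. diameter K / \<eta>\<beta> * (L2norm surf (K \<inter> Gam c) (avg c0 c K (grad v)))\<^sup>2))"

definition norm_B2 :: "real \<Rightarrow> nat \<Rightarrow> 'n::finite problem \<Rightarrow> real \<Rightarrow> real \<Rightarrow> (real^'n \<Rightarrow> real) \<Rightarrow> real" where
  "norm_B2 c0 p c \<eta>1 \<eta> v = sqrt (energy_sq c v + jump_sq c \<eta>1 v + lift_sq c0 p c \<eta> v)"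


section \<open>Families of problems with uniform constants\<close>

text \<open>
  A family collects all meshes (all values of $h$) and all positions of the interface under
  consideration; the constants below are common to the whole family.
\<close>

record family_consts =
  alpha_min :: real
  alpha_max :: real
  reg_const :: real
  unif_const :: real
  gamma0 :: real
  gamma1 :: real
  gamma2 :: real
  kappa_const :: real

definition admissible :: "(real^'n::finite) set \<Rightarrow> family_consts \<Rightarrow> 'n problem \<Rightarrow> bool" where
  "admissible \<Omega> k c \<longleftrightarrow>
     Dom c = \<Omega> \<and> C2_interface c \<and> coefficient c (alpha_min k) (alpha_max k) \<and>
     conforming_mesh \<Omega> (Mesh c) \<and>
     shape_regular (reg_const k) (Mesh c) \<and> quasi_uniform (unif_const k) (Mesh c) \<and>
     (\<forall>K\<in>Mesh c. diameter K ^ CARD('n) \<le> gamma0 k * measure lebesgue K) \<and>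
     (\<forall>K\<in>Mesh c. kappa_const k * diameter K \<le> 1/2) \<and>
     (\<forall>K\<in>cut_cells c.
        (\<exists>a b. norm a = 1 \<and>
           (\<forall>x\<in>K \<inter> Gam c. b \<le> a \<bullet> x \<and> a \<bullet> x \<le> b + gamma1 k * (diameter K)\<^sup>2)) \<and>
        (\<forall>x\<in>K \<inter> Gam c. \<forall>y\<in>K \<inter> Gam c. \<forall>i\<in>{1,2}.
           norm (normal c i x - normal c i y) \<le> gamma2 k * diameter K))"

definition admissible_family ::
  "(real^'n::finite) set \<Rightarrow> family_consts \<Rightarrow> 'n problem set \<Rightarrow> bool" where
  "admissible_family \<Omega> k F \<longleftrightarrow>
     polytopal_domain \<Omega> \<and>
     0 < alpha_min k \<and> 2 * gamma0 k * gamma1 k \<le> kappa_const k \<and>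
     (\<forall>c\<in>F. admissible \<Omega> k c)"

text \<open>
  \<open>h0\<close> is a mesh size below which the weighted inverse trace inequality holds, for polynomials of every
  degree \<open>k\<close>, with a constant depending on \<open>k\<close> but not on the member of the family.
\<close>

definition trace_threshold :: "real \<Rightarrow> 'n::finite problem set \<Rightarrow> real \<Rightarrow> bool" where
  "trace_threshold c0 F h0 \<longleftrightarrow>
     0 < h0 \<and>
     (\<exists>C :: nat \<Rightarrow> real. \<forall>c\<in>F. mesh_size c \<le> h0 \<longrightarrow>
        (\<forall>K\<in>cut_cells c. \<forall>i\<in>{1,2}. \<forall>k. \<forall>v\<in>poly_total k.
           L2norm surf (K \<inter> Gam c) (\<lambda>x. sqrt (kappa c0 c K i) * v x)
             \<le> C k / sqrt (diameter K) * L2norm lebesgue (piece c K i) v))"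

end

theory Submission
  imports Defs
begin

text \<open>
  On the diagonal both forms equal energy plus penalty minus a multiple of the consistency term
  $S = \sum_K \int_{e_K} \{\alpha\nabla v\}\cdot[v]$ (plus, for the second form, the lifting term), and
  coercivity means that $S$ can be absorbed by Young's inequality. The two parts differ in what $S$ is
  absorbed into.

  For the first form, $\kappa_i^2 \le \kappa_i$ makes the weighted inverse trace inequality applicable to the
  components of $\nabla v$, which are polynomials on each piece of a cut cell. Hence
  $h_K\|\{\alpha\nabla v\}\|^2_{e_K}$ is at most a constant $M$ times the energy of $v$ in $K$
  (\<open>avg_gradient_trace_bound\<close>). The third term of the norm is therefore at most $M/\eta_\beta$ times
  the energy, and Young's inequality bounds the multiple of $S$ by half of the penalty and a multiple of that third
  term; once $\eta_\beta$ exceeds a multiple of $M$, one quarter of the norm survives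
  (\<open>B1_coercive\<close>). The threshold depends on $\beta$, $p$, the bounds on the coefficient and the constant of the
  trace inequality only.

  For the second form, $\nabla v$, cut off outside $K$, is itself a test function in $W_K$. So the definition of the
  lifting turns the surface integral exactly into $-\int_K \alpha\, r_e([v])\cdot\nabla v$
  (\<open>lifting_properties\<close>, \<open>gradient_in_WK\<close>), with both factors measured by the norm. Young's inequality with
  parameter $2/3$ leaves one third of the energy and $\eta - 3/2$ times the lifting term, which is at least
  $\eta/4$ times that term as soon as $\eta\ge 2$ (\<open>B2_coercive\<close>).

  These computations are legitimate only if every integrand is integrable (the integral of a non-integrable function
  is $0$, which would destroy the estimates) and if the lifting exists. Three facts provide this. The interface
  has finite surface measure, because locally it is a Lipschitz graph over a coordinate hyperplane
  (\<open>emeasure_interface_finite\<close>), and its normal is well defined and continuous, so that jumps and averages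
  are bounded and measurable. The local polynomial spaces do not depend on how a cell is parametrised; hence they
  are finite-dimensional vector spaces that contain the components of gradients of their elements
  (\<open>local_space_normal_form\<close>). Finally, the weighted $L^2$ product is an inner product on $W_K$, so that a
  Riesz argument (\<open>riesz_finite_span\<close>) yields the lifting.
\<close>

section \<open>Polynomials spanned by a set of monomials\<close>

definition mpoly :: "('n::finite \<Rightarrow> nat) set \<Rightarrow> (real^'n \<Rightarrow> real) set" where
  "mpoly S = {q. \<exists>a. q = (\<lambda>x. \<Sum>m\<in>S. a m * monomial m x)}"

abbreviation total_exps :: "nat \<Rightarrow> ('n::finite \<Rightarrow> nat) set" where
  "total_exps k \<equiv> {m. (\<Sum>i\<in>UNIV. m i) \<le> k}"

abbreviation each_exps :: "nat \<Rightarrow> ('n::finite \<Rightarrow> nat) set" where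
  "each_exps k \<equiv> {m. \<forall>i. m i \<le> k}"

lemma poly_total_eq_mpoly: "poly_total k = mpoly (total_exps k)"
  by (simp add: poly_total_def mpoly_def)

lemma poly_each_eq_mpoly: "poly_each k = mpoly (each_exps k)"
  by (simp add: poly_each_def mpoly_def)

lemma each_exps_eq_PiE: "each_exps k = PiE UNIV (\<lambda>_. {..k})"
  by (auto simp: PiE_UNIV_domain)

lemma finite_each_exps: "finite (each_exps k)"
  unfolding each_exps_eq_PiE by (rule finite_PiE) auto

lemma total_exps_subset_each_exps: "total_exps k \<subseteq> each_exps k"
proof safe
  fix m :: "'a \<Rightarrow> nat" and i assume "(\<Sum>i\<in>UNIV. m i) \<le> k"
  then show "m i \<le> k"
    using member_le_sum[of i UNIV m] by simp
qed

lemma finite_total_exps: "finite (total_exps k)"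
  using finite_subset[OF total_exps_subset_each_exps finite_each_exps] .

lemma each_exps_subset_total_exps:
  "each_exps k \<subseteq> (total_exps (CARD('n) * k) :: ('n::finite \<Rightarrow> nat) set)"
proof safe
  fix m :: "'n \<Rightarrow> nat" assume "\<forall>i. m i \<le> k"
  then show "(\<Sum>i\<in>UNIV. m i) \<le> CARD('n) * k"
    using sum_bounded_above[of UNIV m k] by simp
qed

lemma mpolyI:
  assumes "\<And>x. q x = (\<Sum>m\<in>S. a m * monomial m x)"
  shows "q \<in> mpoly S"
  using assms by (auto simp: mpoly_def)

lemma mpoly_lincomb:
  assumes "f \<in> mpoly S" "g \<in> mpoly S"
  shows "(\<lambda>x. s * f x + t * g x) \<in> mpoly S"
proof -
  obtain a b where "f = (\<lambda>x. \<Sum>m\<in>S. a m * monomial m x)" "g = (\<lambda>x. \<Sum>m\<in>S. b m * monomial m x)"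
    using assms by (auto simp: mpoly_def)
  then have "s * f x + t * g x = (\<Sum>m\<in>S. (s * a m + t * b m) * monomial m x)" for x
    by (simp add: sum_distrib_left sum.distrib distrib_right mult.assoc)
  then show ?thesis by (rule mpolyI)
qed

lemma mpoly_sum:
  assumes "\<And>i. i \<in> I \<Longrightarrow> f i \<in> mpoly S"
  shows "(\<lambda>x. \<Sum>i\<in>I. a i * f i x) \<in> mpoly S"
proof -
  have "\<forall>i\<in>I. \<exists>c. f i = (\<lambda>x. \<Sum>m\<in>S. c m * monomial m x)"
    using assms by (auto simp: mpoly_def)
  then obtain c where c: "\<And>i. i \<in> I \<Longrightarrow> f i = (\<lambda>x. \<Sum>m\<in>S. c i m * monomial m x)"
    by metis
  have "(\<Sum>i\<in>I. a i * f i x) = (\<Sum>m\<in>S. (\<Sum>i\<in>I. a i * c i m) * monomial m x)" for x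
  proof -
    have "(\<Sum>i\<in>I. a i * f i x) = (\<Sum>i\<in>I. \<Sum>m\<in>S. a i * c i m * monomial m x)"
      by (simp add: c sum_distrib_left mult.assoc)
    also have "\<dots> = (\<Sum>m\<in>S. \<Sum>i\<in>I. a i * c i m * monomial m x)"
      by (rule sum.swap)
    finally show ?thesis
      by (simp add: sum_distrib_right)
  qed
  then show ?thesis by (rule mpolyI)
qed

lemma monomial_in_mpoly:
  assumes "finite S" "m \<in> S"
  shows "monomial m \<in> mpoly S"
proof -
  have "monomial m x = (\<Sum>m'\<in>S. (if m' = m then 1 else 0) * monomial m' x)" for x
    using assms by (auto simp: if_distrib[of "\<lambda>z. z * _"] sum.delta cong: if_cong)
  then show ?thesis by (rule mpolyI)
qed

lemma mpoly_mono:
  assumes "S \<subseteq> T" "finite T" "f \<in> mpoly S"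
  shows "f \<in> mpoly T"
proof -
  obtain a where "f = (\<lambda>x. \<Sum>m\<in>S. a m * monomial m x)"
    using assms by (auto simp: mpoly_def)
  then show ?thesis
    using mpoly_sum[of S monomial T a] monomial_in_mpoly assms by (metis subsetD)
qed

lemma mpoly_compose:
  assumes "P \<in> mpoly S" "\<And>m. m \<in> S \<Longrightarrow> (\<lambda>x. monomial m (T x)) \<in> mpoly R"
  shows "(\<lambda>x. P (T x)) \<in> mpoly R"
proof -
  obtain a where "P = (\<lambda>x. \<Sum>m\<in>S. a m * monomial m x)"
    using assms by (auto simp: mpoly_def)
  then show ?thesis
    using mpoly_sum[of S "\<lambda>m x. monomial m (T x)" R a] assms(2) by simp
qed

lemma monomial_add: "monomial m x * monomial m' x = monomial (\<lambda>i. m i + m' i) x"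
  by (simp add: monomial_def power_add prod.distrib)

lemma poly_total_mult:
  assumes f: "f \<in> poly_total k" and g: "g \<in> poly_total l"
  shows "(\<lambda>x. f x * g x) \<in> poly_total (k + l)"
proof -
  obtain a where a: "f = (\<lambda>x. \<Sum>m\<in>total_exps k. a m * monomial m x)"
    using f by (auto simp: poly_total_def)
  obtain b where b: "g = (\<lambda>x. \<Sum>m\<in>total_exps l. b m * monomial m x)"
    using g by (auto simp: poly_total_def)
  have mono_g: "monomial m x * g x = (\<Sum>m'\<in>total_exps l. b m' * monomial (\<lambda>i. m i + m' i) x)" for m x
    by (simp add: b sum_distrib_left monomial_add[symmetric] mult_ac)
  have "(\<lambda>x. f x * g x) =
      (\<lambda>x. \<Sum>m\<in>total_exps k. a m * (\<Sum>m'\<in>total_exps l. b m' * monomial (\<lambda>i. m i + m' i) x))"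
    by (simp add: a sum_distrib_right mult.assoc mono_g)
  also have "\<dots> \<in> mpoly (total_exps (k + l))"
    by (intro mpoly_sum monomial_in_mpoly finite_total_exps) (auto simp: sum.distrib)
  finally show ?thesis by (simp add: poly_total_eq_mpoly)
qed

lemma poly_total_const: "(\<lambda>x. c) \<in> poly_total k"
proof -
  have "(\<lambda>x. \<Sum>i\<in>{()}. c * monomial (\<lambda>_. 0) x) \<in> mpoly (total_exps k)"
    by (intro mpoly_sum monomial_in_mpoly finite_total_exps) auto
  then show ?thesis by (simp add: poly_total_eq_mpoly monomial_def)
qed

lemma poly_total_power:
  assumes "f \<in> poly_total 1"
  shows "(\<lambda>x. f x ^ l) \<in> poly_total l"
proof (induction l)
  case 0
  then show ?case by (simp add: poly_total_const)
next
  case (Suc l)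
  then show ?case using poly_total_mult[OF assms Suc] by simp
qed

lemma poly_total_prod:
  assumes "finite I" "\<And>i. i \<in> I \<Longrightarrow> f i \<in> poly_total (d i)"
  shows "(\<lambda>x. \<Prod>i\<in>I. f i x) \<in> poly_total (\<Sum>i\<in>I. d i)"
  using assms
proof (induction I)
  case empty
  then show ?case by (simp add: poly_total_const)
next
  case (insert i I)
  then show ?case using poly_total_mult[of "f i" "d i" "\<lambda>x. \<Prod>i\<in>I. f i x"] by simp
qed

lemma poly_total_affine_coordinate:
  fixes A :: "real^'n::finite^'n"
  shows "(\<lambda>y. (b + A *v y) $ i) \<in> poly_total 1"
proof -
  have coord: "(\<lambda>y::real^'n. y $ j) \<in> mpoly (total_exps 1)" for j
  proof -
    have "monomial (\<lambda>l. if l = j then 1 else 0) = (\<lambda>y::real^'n. y $ j)"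
      by (auto simp: monomial_def if_distrib[of "\<lambda>e. _ ^ e"] prod.delta cong: if_cong)
    then show ?thesis
      using monomial_in_mpoly[OF finite_total_exps, of "\<lambda>l. if l = j then 1 else 0" 1]
      by (simp add: sum.delta)
  qed
  have "(\<lambda>y. \<Sum>j\<in>UNIV. A $ i $ j * y $ j) \<in> mpoly (total_exps 1)"
    by (intro mpoly_sum coord)
  from mpoly_lincomb[OF poly_total_const[unfolded poly_total_eq_mpoly] this, of "b $ i" 1 1]
  show ?thesis by (simp add: poly_total_eq_mpoly matrix_vector_mult_def)
qed

text \<open>
  Total degree is an affine invariant: after substitution every variable becomes a polynomial of degree at
  most one, and degrees add under multiplication.
\<close>

lemma poly_total_affine:
  fixes A :: "real^'n::finite^'n"
  assumes "q \<in> poly_total k"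
  shows "(\<lambda>y. q (b + A *v y)) \<in> poly_total k"
proof -
  have "(\<lambda>y. monomial m (b + A *v y)) \<in> mpoly (total_exps k)" if "m \<in> total_exps k" for m
  proof -
    have "(\<lambda>y. \<Prod>i\<in>UNIV. ((b + A *v y) $ i) ^ m i) \<in> poly_total (\<Sum>i\<in>UNIV. m i)"
      by (intro poly_total_prod poly_total_power poly_total_affine_coordinate) auto
    then have "(\<lambda>y. monomial m (b + A *v y)) \<in> mpoly (total_exps (\<Sum>i\<in>UNIV. m i))"
      by (simp add: monomial_def poly_total_eq_mpoly)
    then show ?thesis
      by (rule mpoly_mono[rotated 2]) (use that finite_total_exps in auto)
  qed
  with assms show ?thesis
    unfolding poly_total_eq_mpoly by (rule mpoly_compose)
qed

text \<open>
  Unlike the total degree, the degree in each separate variable is not an affine invariant. It is preserved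
  when no two new coordinates involve the same old one, since expanding the powers then never collects two
  exponents on one variable.
\<close>

lemma poly_each_signed_permutation:
  fixes T :: "real^'n::finite \<Rightarrow> real^'n" and \<sigma> :: "'n \<Rightarrow> 'n"
  assumes \<sigma>: "inj \<sigma>" and T: "\<And>y i. T y $ i = u i + s i * y $ \<sigma> i" and q: "q \<in> poly_each k"
  shows "(\<lambda>y. q (T y)) \<in> poly_each k"
proof -
  have bij: "bij \<sigma>" using \<sigma> by (simp add: bij_def finite_UNIV_inj_surj)
  have mono: "(\<lambda>y. monomial m (T y)) \<in> mpoly (each_exps k)" if m: "m \<in> each_exps k" for m
  proof -
    define c where
      "c i l = (if l \<le> m i then real (m i choose l) * s i ^ l * u i ^ (m i - l) else 0)" for i l
    have expand: "(u i + s i * z) ^ m i = (\<Sum>l\<le>k. c i l * z ^ l)" for i z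
    proof -
      have "(u i + s i * z) ^ m i = (s i * z + u i) ^ m i" by (simp add: add.commute)
      also have "\<dots> = (\<Sum>l\<le>m i. c i l * z ^ l)"
        unfolding binomial_ring by (rule sum.cong) (auto simp: c_def power_mult_distrib)
      also have "\<dots> = (\<Sum>l\<le>k. c i l * z ^ l)"
        using m by (intro sum.mono_neutral_left) (auto simp: c_def)
      finally show ?thesis .
    qed
    have "monomial m (T y) = (\<Sum>f\<in>each_exps k. (\<Prod>i\<in>UNIV. c i (f i)) * monomial (\<lambda>j. f (inv \<sigma> j)) y)"
      for y
    proof -
      have "monomial m (T y) = (\<Prod>i\<in>UNIV. \<Sum>l\<le>k. c i l * y $ \<sigma> i ^ l)"
        by (simp add: monomial_def T expand)
      also have "\<dots> = (\<Sum>f\<in>each_exps k. \<Prod>i\<in>UNIV. c i (f i) * y $ \<sigma> i ^ f i)"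
        unfolding each_exps_eq_PiE by (rule prod_sum_PiE) auto
      also have "\<dots> = (\<Sum>f\<in>each_exps k. (\<Prod>i\<in>UNIV. c i (f i)) * monomial (\<lambda>j. f (inv \<sigma> j)) y)"
      proof (rule sum.cong)
        fix f
        have "monomial (\<lambda>j. f (inv \<sigma> j)) y = (\<Prod>i\<in>UNIV. y $ \<sigma> i ^ f (inv \<sigma> (\<sigma> i)))"
          unfolding monomial_def by (rule prod.reindex_bij_betw[OF bij, symmetric])
        then show "(\<Prod>i\<in>UNIV. c i (f i) * y $ \<sigma> i ^ f i) = (\<Prod>i\<in>UNIV. c i (f i)) * monomial (\<lambda>j. f (inv \<sigma> j)) y"
          using \<sigma> by (simp add: prod.distrib)
      qed simp
      finally show ?thesis .
    qed
    then have "(\<lambda>y. monomial m (T y)) =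
        (\<lambda>y. \<Sum>f\<in>each_exps k. (\<Prod>i\<in>UNIV. c i (f i)) * monomial (\<lambda>j. f (inv \<sigma> j)) y)" by blast
    also have "\<dots> \<in> mpoly (each_exps k)"
      by (intro mpoly_sum monomial_in_mpoly finite_each_exps) auto
    finally show ?thesis .
  qed
  from q show ?thesis
    unfolding poly_each_eq_mpoly by (rule mpoly_compose) (rule mono)
qed

text \<open>
  Lowering one exponent by one is what differentiating a monomial does, so this is exactly the closure
  property under which a span of monomials contains its partial derivatives.
\<close>

definition down_closed :: "('n \<Rightarrow> nat) set \<Rightarrow> bool" where
  "down_closed S \<longleftrightarrow> (\<forall>m\<in>S. \<forall>j. m(j := m j - 1) \<in> S)"

lemma down_closed_total_exps: "down_closed (total_exps k)"
  unfolding down_closed_def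
proof (intro ballI allI)
  fix m :: "'a \<Rightarrow> nat" and j assume "m \<in> total_exps k"
  moreover have "sum (m(j := m j - 1)) UNIV \<le> sum m UNIV"
    by (rule sum_mono) auto
  ultimately show "m(j := m j - 1) \<in> total_exps k" by simp
qed

lemma down_closed_each_exps: "down_closed (each_exps k)"
  by (fastforce simp: down_closed_def intro: le_trans[OF diff_le_self])

lemma GDERIV_monomial:
  "GDERIV (monomial m) x :> (\<chi> j. real (m j) * monomial (m(j := m j - 1)) x)"
proof -
  have "((\<lambda>x. \<Prod>i\<in>UNIV. (x $ i) ^ m i) has_derivative
      (\<lambda>h. \<Sum>i\<in>UNIV. (real (m i) * h $ i * x $ i ^ (m i - 1)) * (\<Prod>j\<in>UNIV - {i}. x $ j ^ m j))) (at x)"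
    by (intro has_derivative_prod) (auto intro!: derivative_eq_intros bounded_linear_imp_has_derivative[OF bounded_linear_vec_nth])
  moreover have "monomial (m(i := m i - 1)) x = x $ i ^ (m i - 1) * (\<Prod>j\<in>UNIV - {i}. x $ j ^ m j)" for i
    unfolding monomial_def by (subst prod.remove[of _ i]) auto
  ultimately show ?thesis
    unfolding gderiv_def by (simp add: monomial_def[abs_def] inner_vec_def mult_ac)
qed

lemma mpoly_gradient:
  assumes S: "down_closed S" "finite S" and P: "P \<in> mpoly S"
  shows "\<exists>G. (\<forall>x. GDERIV P x :> G x) \<and> (\<forall>j. (\<lambda>x. G x $ j) \<in> mpoly S)"
proof -
  obtain a where a: "P = (\<lambda>x. \<Sum>m\<in>S. a m * monomial m x)"
    using P by (auto simp: mpoly_def)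
  define G where "G x = (\<Sum>m\<in>S. a m *\<^sub>R (\<chi> j. real (m j) * monomial (m(j := m j - 1)) x))" for x
  have "GDERIV P x :> G x" for x
  proof -
    have "(P has_derivative (\<lambda>h. \<Sum>m\<in>S. a m * (h \<bullet> (\<chi> j. real (m j) * monomial (m(j := m j - 1)) x)))) (at x)"
      unfolding a
      by (intro has_derivative_sum has_derivative_mult_right GDERIV_monomial[unfolded gderiv_def])
    then show ?thesis by (simp add: gderiv_def G_def inner_sum_right)
  qed
  moreover have "(\<lambda>x. G x $ j) \<in> mpoly S" for j
  proof -
    have "(\<lambda>x. \<Sum>m\<in>S. (a m * real (m j)) * monomial (m(j := m j - 1)) x) \<in> mpoly S"
      using S by (intro mpoly_sum monomial_in_mpoly) (auto simp: down_closed_def)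
    then show ?thesis by (simp add: G_def mult.assoc)
  qed
  ultimately show ?thesis by blast
qed

section \<open>The local space does not depend on the parametrisation of the cell\<close>

text \<open>
  The maximum and the minimum of the $i$-th coordinate of $y \mapsto u + My$ over the unit cube, attained at
  the vertices used in the proof, differ by the absolute sum of the $i$-th row of $M$, and both lie in $[0,1]$.
\<close>

lemma cube_map_row_sum:
  fixes M :: "real^'n::finite^'n"
  assumes "\<And>y. y \<in> cbox 0 1 \<Longrightarrow> u + M *v y \<in> cbox 0 1"
  shows "(\<Sum>j\<in>UNIV. \<bar>M $ i $ j\<bar>) \<le> 1"
proof -
  \<comment> \<open>The vertices of the cube at which the coordinate is largest and smallest.\<close>
  define y z :: "real^'n" where
    "y = (\<chi> j. if M $ i $ j > 0 then 1 else 0)" and "z = (\<chi> j. if M $ i $ j > 0 then 0 else 1)"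
  have "y \<in> cbox 0 1" "z \<in> cbox 0 1"
    by (auto simp: y_def z_def mem_box_cart)
  then have "(u + M *v y) $ i \<le> 1" "0 \<le> (u + M *v z) $ i"
    using assms by (fastforce simp: mem_box_cart)+
  then have "(M *v y) $ i - (M *v z) $ i \<le> 1" by simp
  also have "(M *v y) $ i - (M *v z) $ i = (\<Sum>j\<in>UNIV. \<bar>M $ i $ j\<bar>)"
    unfolding matrix_vector_mult_def y_def z_def
    by (simp add: sum_subtractf[symmetric]) (rule sum.cong, auto)
  finally show ?thesis .
qed

text \<open>
  All absolute row sums of both matrices are at most $1$, so equality must hold in
  $1 = (MN)_{ii} = \sum_j M_{ij}N_{ji} \le \sum_j |M_{ij}| \max_j |N_{ji}|$; this leaves room for only
  one nonzero entry per row.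
\<close>

lemma inverse_pair_row_sums_signed_permutation:
  fixes M N :: "real^'n::finite^'n"
  assumes MN: "M ** N = mat 1" "N ** M = mat 1"
    and M: "\<And>i. (\<Sum>j\<in>UNIV. \<bar>M $ i $ j\<bar>) \<le> 1" and N: "\<And>i. (\<Sum>j\<in>UNIV. \<bar>N $ i $ j\<bar>) \<le> 1"
  shows "\<exists>\<sigma>. inj \<sigma> \<and> (\<forall>i j. j \<noteq> \<sigma> i \<longrightarrow> M $ i $ j = 0)"
proof -
  have Ni: "\<bar>N $ j $ i\<bar> \<le> 1" for i j
    using N[of j] member_le_sum[of i UNIV "\<lambda>l. \<bar>N $ j $ l\<bar>"] by simp
  have full: "\<bar>N $ j $ i\<bar> = 1" if nz: "M $ i $ j \<noteq> 0" for i j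
  proof -
    have "1 = (M ** N) $ i $ i" by (simp add: MN mat_def)
    also have "\<dots> = (\<Sum>j\<in>UNIV. M $ i $ j * N $ j $ i)" by (simp add: matrix_matrix_mult_def)
    also have "\<dots> \<le> (\<Sum>j\<in>UNIV. \<bar>M $ i $ j\<bar> * \<bar>N $ j $ i\<bar>)"
      by (intro sum_mono) (simp flip: abs_mult)
    finally have "(\<Sum>j\<in>UNIV. \<bar>M $ i $ j\<bar> * (1 - \<bar>N $ j $ i\<bar>)) \<le> 0"
      using M[of i] by (simp add: right_diff_distrib sum_subtractf)
    moreover have "\<bar>M $ i $ j\<bar> * (1 - \<bar>N $ j $ i\<bar>) \<le> (\<Sum>j\<in>UNIV. \<bar>M $ i $ j\<bar> * (1 - \<bar>N $ j $ i\<bar>))"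
      by (rule member_le_sum) (auto simp: Ni)
    ultimately have "\<bar>M $ i $ j\<bar> * (1 - \<bar>N $ j $ i\<bar>) \<le> 0" by linarith
    then show ?thesis using nz Ni[of j i] by (simp add: mult_le_0_iff)
  qed
  have alone: "N $ j $ k = 0" if "M $ i $ j \<noteq> 0" "k \<noteq> i" for i j k
  proof -
    have "(\<Sum>l\<in>{i,k}. \<bar>N $ j $ l\<bar>) \<le> (\<Sum>l\<in>UNIV. \<bar>N $ j $ l\<bar>)"
      by (rule sum_mono2) auto
    then show ?thesis using N[of j] full[OF that(1)] that(2) by simp
  qed
  have NM: "N $ j $ i * M $ i $ j' = (if j = j' then 1 else 0)" if "M $ i $ j \<noteq> 0" for i j j'
  proof -
    have "(N ** M) $ j $ j' = (\<Sum>k\<in>UNIV. N $ j $ k * M $ k $ j')"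
      by (simp add: matrix_matrix_mult_def)
    also have "\<dots> = (\<Sum>k\<in>{i}. N $ j $ k * M $ k $ j')"
      by (rule sum.mono_neutral_right) (auto simp: alone[OF that])
    finally show ?thesis by (simp add: MN mat_def)
  qed
  have "\<exists>j. M $ i $ j \<noteq> 0" for i
  proof (rule ccontr)
    assume "\<nexists>j. M $ i $ j \<noteq> 0"
    then have "(M ** N) $ i $ i = 0" by (simp add: matrix_matrix_mult_def)
    then show False by (simp add: MN mat_def)
  qed
  then obtain \<sigma> where \<sigma>: "\<And>i. M $ i $ \<sigma> i \<noteq> 0" by metis
  have "M $ i $ j = 0" if "j \<noteq> \<sigma> i" for i j
    using NM[OF \<sigma>[of i], of j] full[OF \<sigma>[of i]] that by auto
  moreover have "inj \<sigma>"
  proof (rule injI)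
    fix i i' assume "\<sigma> i = \<sigma> i'"
    then show "i = i'" using full[OF \<sigma>[of i]] alone[OF \<sigma>[of i'], of i] by (metis abs_zero zero_neq_one)
  qed
  ultimately show ?thesis by blast
qed

lemma matrix_inv_cancel:
  fixes A :: "real^'n::finite^'n"
  assumes "invertible A"
  shows "A ** matrix_inv A = mat 1" "matrix_inv A ** A = mat 1"
    "A *v (matrix_inv A *v x) = x" "matrix_inv A *v (A *v x) = x"
proof -
  show 1: "A ** matrix_inv A = mat 1" "matrix_inv A ** A = mat 1"
    using someI_ex[OF assms[unfolded invertible_def]] by (simp_all add: matrix_inv_def)
  show "A *v (matrix_inv A *v x) = x" "matrix_inv A *v (A *v x) = x"
    by (simp_all add: matrix_vector_mul_assoc 1)
qed

text \<open>
  Two parametrisations of the same parallelepiped differ by an affine automorphism of the unit cube, and such an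
  automorphism permutes and flips the coordinates.
\<close>

lemma poly_each_change_of_cube:
  fixes A A' :: "real^'n::finite^'n"
  assumes K: "cube_image A b K" and K': "cube_image A' b' K"
    and q: "(\<lambda>x. q (b' + A' *v x)) \<in> poly_each p"
  shows "(\<lambda>x. q (b + A *v x)) \<in> poly_each p"
proof -
  have inv: "invertible A" "invertible A'" using K K' by (auto simp: cube_image_def)
  define M where "M = matrix_inv A' ** A"
  define u where "u = matrix_inv A' *v (b - b')"
  define N where "N = matrix_inv A ** A'"
  define w where "w = matrix_inv A *v (b' - b)"
  have assoc: "(X ** Y) ** (Z ** W) = X ** ((Y ** Z) ** W)" for X Y Z W :: "real^'n^'n"
    by (simp add: matrix_mul_assoc)
  have MN: "M ** N = mat 1" "N ** M = mat 1"
    unfolding M_def N_def assoc by (simp_all add: matrix_inv_cancel inv)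
  have AM: "b' + A' *v (u + M *v y) = b + A *v y" for y
    by (simp add: M_def u_def matrix_vector_right_distrib matrix_inv_cancel inv flip: matrix_vector_mul_assoc)
  have AN: "b + A *v (w + N *v y) = b' + A' *v y" for y
    by (simp add: N_def w_def matrix_vector_right_distrib matrix_inv_cancel inv flip: matrix_vector_mul_assoc)
  have inj: "x = y" if "b + A *v x = b + A *v y" for x y
    using that matrix_inv_cancel(4)[OF inv(1)] by (metis add_left_cancel)
  have inj': "x = y" if "b' + A' *v x = b' + A' *v y" for x y
    using that matrix_inv_cancel(4)[OF inv(2)] by (metis add_left_cancel)
  have mapM: "u + M *v y \<in> cbox 0 1" if "y \<in> cbox 0 1" for y
  proof -
    have "b + A *v y \<in> K" using that K by (auto simp: cube_image_def)
    then obtain z where "z \<in> cbox 0 1" "b + A *v y = b' + A' *v z"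
      using K' by (auto simp: cube_image_def)
    then show ?thesis using AM[of y] inj' by metis
  qed
  have mapN: "w + N *v y \<in> cbox 0 1" if "y \<in> cbox 0 1" for y
  proof -
    have "b' + A' *v y \<in> K" using that K' by (auto simp: cube_image_def)
    then obtain z where "z \<in> cbox 0 1" "b' + A' *v y = b + A *v z"
      using K by (auto simp: cube_image_def)
    then show ?thesis using AN[of y] inj by metis
  qed
  obtain \<sigma> where \<sigma>: "inj \<sigma>" "\<And>i j. j \<noteq> \<sigma> i \<Longrightarrow> M $ i $ j = 0"
    using inverse_pair_row_sums_signed_permutation[OF MN cube_map_row_sum[OF mapM] cube_map_row_sum[OF mapN]]
    by blast
  have "(u + M *v y) $ i = u $ i + M $ i $ \<sigma> i * y $ \<sigma> i" for y i
  proof -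
    have "(M *v y) $ i = (\<Sum>j\<in>UNIV. M $ i $ j * y $ j)" by (simp add: matrix_vector_mult_def)
    also have "\<dots> = (\<Sum>j\<in>{\<sigma> i}. M $ i $ j * y $ j)"
      by (rule sum.mono_neutral_right) (auto simp: \<sigma>)
    finally show ?thesis by simp
  qed
  from poly_each_signed_permutation[of \<sigma> "\<lambda>y. u + M *v y", OF \<sigma>(1) this q]
  show ?thesis by (simp add: AM)
qed

definition mesh_cell :: "(real^'n::finite) set \<Rightarrow> bool" where
  "mesh_cell K \<longleftrightarrow> is_simplex K \<or> (\<exists>A b. cube_image A b K)"

text \<open>
  The local space of a cell is a union over all descriptions of the cell, so it is not evidently closed under
  addition. All descriptions give the same polynomials: two cube parametrisations by
  \<open>poly_each_change_of_cube\<close>, and a simplex that is also a cube image would contribute only polynomials of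
  total degree at most $p$, which are contained in the other space. Hence a single reference map and a single
  set of exponents describe the space.
\<close>

lemma local_space_normal_form:
  fixes K :: "(real^'n::finite) set"
  assumes K: "mesh_cell K"
  obtains A :: "real^'n^'n" and b S where "invertible A" "finite S" "down_closed S"
    "S \<subseteq> total_exps (CARD('n) * p)" "local_space p K = {q. (\<lambda>y. q (b + A *v y)) \<in> mpoly S}"
proof (cases "\<exists>A b. cube_image A b K")
  case True
  then obtain A b where Ab: "cube_image A b K" by blast
  have "(\<lambda>y. q (b + A *v y)) \<in> poly_each p" if q: "q \<in> local_space p K" for q
  proof -
    consider "q \<in> poly_total p" | A' b' where "cube_image A' b' K" "(\<lambda>x. q (b' + A' *v x)) \<in> poly_each p"
      using q unfolding local_space_def by blast
    then show ?thesis
    proof cases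
      case 1
      then show ?thesis
        unfolding poly_total_eq_mpoly poly_each_eq_mpoly
        by (intro mpoly_mono[OF total_exps_subset_each_exps finite_each_exps]
            poly_total_affine[unfolded poly_total_eq_mpoly])
    next
      case 2
      then show ?thesis using poly_each_change_of_cube[OF Ab] by blast
    qed
  qed
  then have "local_space p K = {q. (\<lambda>y. q (b + A *v y)) \<in> mpoly (each_exps p)}"
    using Ab by (auto simp: local_space_def poly_each_eq_mpoly)
  with Ab show ?thesis
    by (intro that[OF _ finite_each_exps down_closed_each_exps each_exps_subset_total_exps])
      (auto simp: cube_image_def)
next
  case False
  then have "local_space p K = {q. (\<lambda>y. q (0 + mat 1 *v y)) \<in> mpoly (total_exps p)}"
    using K by (auto simp: local_space_def mesh_cell_def poly_total_eq_mpoly)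
  moreover have "total_exps p \<subseteq> (total_exps (CARD('n) * p) :: ('n \<Rightarrow> nat) set)"
    using each_exps_subset_total_exps total_exps_subset_each_exps by blast
  moreover have "invertible (mat 1 :: real^'n^'n)"
    using invertible_def matrix_mul_lid by blast
  ultimately show ?thesis
    using that finite_total_exps down_closed_total_exps by metis
qed

context
  fixes K :: "(real^'n::finite) set"
  assumes K: "mesh_cell K"
begin

lemma local_space_lincomb:
  assumes "f \<in> local_space p K" "g \<in> local_space p K"
  shows "(\<lambda>x. s * f x + t * g x) \<in> local_space p K"
proof -
  obtain A :: "real^'n^'n" and b S where *: "invertible A" "finite S" "down_closed S" "S \<subseteq> total_exps (CARD('n) * p)"
    "local_space p K = {q. (\<lambda>y. q (b + A *v y)) \<in> mpoly S}"
    by (rule local_space_normal_form[OF K, where p = p])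
  show ?thesis using assms mpoly_lincomb[of "\<lambda>y. f (b + A *v y)"] by (simp add: *)
qed

lemma local_space_zero: "(\<lambda>x. 0) \<in> local_space p K"
proof -
  obtain A :: "real^'n^'n" and b S where *: "invertible A" "finite S" "down_closed S" "S \<subseteq> total_exps (CARD('n) * p)"
    "local_space p K = {q. (\<lambda>y. q (b + A *v y)) \<in> mpoly S}"
    by (rule local_space_normal_form[OF K, where p = p])
  have "(\<lambda>y. \<Sum>i\<in>{}. 0 * monomial (\<lambda>_. 0) y) \<in> mpoly S" by (rule mpoly_sum) simp
  then show ?thesis by (simp add: *)
qed

lemma local_space_subset_poly_total: "local_space p K \<subseteq> poly_total (CARD('n) * p)"
proof
  fix q assume q: "q \<in> local_space p K"
  obtain A :: "real^'n^'n" and b S where *: "invertible A" "finite S" "down_closed S" "S \<subseteq> total_exps (CARD('n) * p)"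
    "local_space p K = {q. (\<lambda>y. q (b + A *v y)) \<in> mpoly S}"
    by (rule local_space_normal_form[OF K, where p = p])
  have "(\<lambda>y. q (b + A *v y)) \<in> poly_total (CARD('n) * p)"
    unfolding poly_total_eq_mpoly
    by (rule mpoly_mono[OF *(4) finite_total_exps]) (use q * in simp)
  from poly_total_affine[OF this, of "- (matrix_inv A *v b)" "matrix_inv A"]
  show "q \<in> poly_total (CARD('n) * p)"
    by (simp add: matrix_vector_right_distrib matrix_inv_cancel * linear_neg matrix_vector_mult_diff_distrib)
qed

text \<open>
  By the chain rule the partial derivatives are linear combinations of the partial derivatives in reference
  coordinates, and these stay in the span of the monomials.
\<close>

lemma local_space_gradient:
  assumes q: "q \<in> local_space p K"
  shows "\<exists>G. (\<forall>x. GDERIV q x :> G x) \<and> (\<forall>j. (\<lambda>x. G x $ j) \<in> local_space p K)"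
proof -
  obtain A :: "real^'n^'n" and b S where *: "invertible A" "finite S" "down_closed S" "S \<subseteq> total_exps (CARD('n) * p)"
    "local_space p K = {q. (\<lambda>y. q (b + A *v y)) \<in> mpoly S}"
    by (rule local_space_normal_form[OF K, where p = p])
  define B where "B = matrix_inv A"
  define P where "P y = q (b + A *v y)" for y
  obtain G where G: "\<And>y. GDERIV P y :> G y" "\<And>j. (\<lambda>y. G y $ j) \<in> mpoly S"
    using mpoly_gradient[of S P] * q by (auto simp: P_def[abs_def])
  have qP: "q = (\<lambda>x. P (B *v (x - b)))"
    by (rule ext) (simp add: P_def B_def matrix_inv_cancel *)
  define G' where "G' x = transpose B *v G (B *v (x - b))" for x
  have adj: "h \<bullet> (transpose B *v g) = (B *v h) \<bullet> g" for h g
    by (metis dot_lmul_matrix inner_commute transpose_matrix_vector)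
  have "GDERIV q x :> G' x" for x
  proof -
    have "((\<lambda>x. B *v (x - b)) has_derivative (\<lambda>h. B *v h)) (at x)"
      by (auto intro!: derivative_eq_intros bounded_linear.has_derivative[OF matrix_vector_mul_bounded_linear])
    from has_derivative_compose[OF this G(1)[unfolded gderiv_def]]
    show ?thesis
      unfolding gderiv_def qP G'_def adj .
  qed
  moreover have "(\<lambda>x. G' x $ j) \<in> local_space p K" for j
  proof -
    have "(\<lambda>y. \<Sum>i\<in>UNIV. B $ i $ j * G y $ i) \<in> mpoly S"
      by (intro mpoly_sum G)
    moreover have "G' (b + A *v y) = transpose B *v G y" for y
      by (simp add: G'_def B_def matrix_inv_cancel *)
    then have "G' (b + A *v y) $ j = (\<Sum>i\<in>UNIV. B $ i $ j * G y $ i)" for y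
      by (simp only:) (simp add: matrix_vector_mult_def transpose_def)
    ultimately show ?thesis by (simp add: *(5))
  qed
  ultimately show ?thesis by blast
qed

lemma continuous_on_local_space:
  assumes "q \<in> local_space p K"
  shows "continuous_on X q"
proof -
  obtain G where "\<And>x. GDERIV q x :> G x" using local_space_gradient[OF assms] by blast
  then show ?thesis
    by (auto simp: gderiv_def intro!: continuous_at_imp_continuous_on has_derivative_continuous)
qed

lemma local_space_finite_span:
  "\<exists>(S :: ('n \<Rightarrow> nat) set) e. finite S \<and> local_space p K = {q. \<exists>a. q = (\<lambda>x. \<Sum>m\<in>S. a m * e m x)}"
proof -
  obtain A :: "real^'n^'n" and b S where *: "invertible A" "finite S" "down_closed S" "S \<subseteq> total_exps (CARD('n) * p)"
    "local_space p K = {q. (\<lambda>y. q (b + A *v y)) \<in> mpoly S}"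
    by (rule local_space_normal_form[OF K, where p = p])
  define e where "e m x = monomial m (matrix_inv A *v (x - b))" for m x
  have "(\<lambda>y. q (b + A *v y)) \<in> mpoly S \<longleftrightarrow> (\<exists>a. q = (\<lambda>x. \<Sum>m\<in>S. a m * e m x))" for q
  proof
    assume "(\<lambda>y. q (b + A *v y)) \<in> mpoly S"
    then obtain a where a: "(\<lambda>y. q (b + A *v y)) = (\<lambda>y. \<Sum>m\<in>S. a m * monomial m y)"
      by (auto simp: mpoly_def)
    have "q x = (\<Sum>m\<in>S. a m * e m x)" for x
      using fun_cong[OF a, of "matrix_inv A *v (x - b)"] by (simp add: e_def matrix_inv_cancel *)
    then show "\<exists>a. q = (\<lambda>x. \<Sum>m\<in>S. a m * e m x)" by (intro exI[of _ a] ext)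
  next
    assume "\<exists>a. q = (\<lambda>x. \<Sum>m\<in>S. a m * e m x)"
    then show "(\<lambda>y. q (b + A *v y)) \<in> mpoly S"
      by (auto simp: mpoly_def e_def matrix_inv_cancel *)
  qed
  then have "local_space p K = {q. \<exists>a. q = (\<lambda>x. \<Sum>m\<in>S. a m * e m x)}"
    by (simp add: *(5))
  then show ?thesis using *(2) by (intro exI[of _ S] exI[of _ e] conjI)
qed

end

section \<open>The interface has finite surface measure\<close>

lemma sets_surf [measurable_cong]: "sets (surf :: (real^'n::finite) measure) = sets borel"
  by (simp add: surf_def hausdorff_measure_def sets_measure_of_conv sets.sigma_sets_eq[of borel, simplified])

lemma space_surf: "space (surf :: (real^'n::finite) measure) = UNIV"
  by (simp add: surf_def hausdorff_measure_def space_measure_of_conv)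

text \<open>
  An upper bound on the outer measure is enough for finiteness. It holds whether or not the outer measure is
  countably additive: if it were not, the measure generated by it would be zero.
\<close>

lemma emeasure_surf_le:
  "emeasure (surf :: (real^'n::finite) measure) A \<le> hausdorff_outer (CARD('n) - 1) A"
  by (simp add: surf_def hausdorff_measure_def emeasure_measure_of_conv)

text \<open>
  It suffices to have, at every scale, a finite cover by sets of diameter at most $D$ whose number is at most
  $C / D^m$; the sequence of covering sets is filled up with empty sets, which cost nothing because $m \ge 1$.
\<close>

lemma hausdorff_outer_le_covers:
  fixes A :: "'a::euclidean_space set"
  assumes m: "m \<ge> 1" and cover: "\<And>\<delta>. \<delta> > 0 \<Longrightarrow> \<exists>(I :: 'i set) V D. finite I \<and> A \<subseteq> (\<Union>i\<in>I. V i) \<and>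
      0 \<le> D \<and> D \<le> \<delta> \<and> (\<forall>i\<in>I. bounded (V i) \<and> diameter (V i) \<le> D) \<and> real (card I) * D ^ m \<le> C"
  shows "hausdorff_outer m A \<le> ennreal (unit_ball_vol (real m) * C)"
  unfolding hausdorff_outer_def
proof (rule SUP_least)
  fix \<delta> :: real assume "\<delta> \<in> {0<..}"
  then obtain I :: "'i set" and V D where I: "finite I" "A \<subseteq> (\<Union>i\<in>I. V i)" "0 \<le> D" "D \<le> \<delta>"
    "\<And>i. i \<in> I \<Longrightarrow> bounded (V i)" "\<And>i. i \<in> I \<Longrightarrow> diameter (V i) \<le> D" "real (card I) * D ^ m \<le> C"
    using cover[of \<delta>] by auto
  obtain h where h: "bij_betw h {0..<card I} I"
    using ex_bij_betw_nat_finite[OF I(1)] by blast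
  define U where "U j = (if j < card I then V (h j) else {})" for j
  have hI: "h j \<in> I" if "j < card I" for j
    using h that by (auto simp: bij_betw_def)
  have "A \<subseteq> (\<Union>j. U j)"
  proof
    fix x assume "x \<in> A"
    then obtain i where "i \<in> I" "x \<in> V i" using I by auto
    moreover obtain j where "j < card I" "i = h j"
      using h \<open>i \<in> I\<close> by (metis atLeastLessThan_iff bij_betw_def imageE)
    ultimately show "x \<in> (\<Union>j. U j)" by (auto simp: U_def)
  qed
  moreover have "bounded (U j) \<and> diameter (U j) \<le> \<delta>" for j
    using I hI[of j] \<open>\<delta> \<in> {0<..}\<close> by (auto simp: U_def intro: order_trans)
  ultimately have "hausdorff_pre m \<delta> A
      \<le> (\<Sum>j. ennreal (unit_ball_vol (real m) * (diameter (U j) / 2) ^ m))"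
    unfolding hausdorff_pre_def by (intro INF_lower) auto
  also have "\<dots> = (\<Sum>j<card I. ennreal (unit_ball_vol (real m) * (diameter (U j) / 2) ^ m))"
    using m by (intro suminf_finite) (auto simp: U_def)
  also have "\<dots> \<le> (\<Sum>j<card I. ennreal (unit_ball_vol (real m) * D ^ m))"
  proof (intro sum_mono ennreal_leI mult_left_mono power_mono)
    fix j assume "j \<in> {..<card I}"
    then show "diameter (U j) / 2 \<le> D"
      using I(6)[OF hI[of j]] I(3) by (simp add: U_def)
    show "0 \<le> diameter (U j) / 2"
      using I(5)[OF hI[of j]] \<open>j \<in> _\<close> by (simp add: U_def diameter_ge_0)
  qed auto
  also have "\<dots> = ennreal (unit_ball_vol (real m) * (real (card I) * D ^ m))"
    using I(3) by (simp add: ennreal_of_nat_eq_real_of_nat ennreal_mult[symmetric] mult_ac)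
  also have "\<dots> \<le> ennreal (unit_ball_vol (real m) * C)"
    by (intro ennreal_leI mult_left_mono I) auto
  finally show "hausdorff_pre m \<delta> A \<le> ennreal (unit_ball_vol (real m) * C)" .
qed

text \<open>
  If one coordinate is a Lipschitz function of the others on \<open>A\<close>, a grid of $N^{n-1}$ cells in the other
  coordinates cuts \<open>A\<close> into parts of diameter $O(1/N)$, so the $(n-1)$-dimensional sums stay bounded as
  $N \to \infty$.
\<close>

lemma hausdorff_outer_coordinate_graph_finite:
  fixes A :: "(real^'n::finite) set"
  assumes n: "CARD('n) \<ge> 2" and r: "r > 0" and L: "L \<ge> 0"
    and bd: "\<And>x j. x \<in> A \<Longrightarrow> \<bar>x $ j - z $ j\<bar> < r"
    and Lip: "\<And>x y. x \<in> A \<Longrightarrow> y \<in> A \<Longrightarrow> \<bar>x $ k - y $ k\<bar> \<le> L * (\<Sum>j\<in>UNIV - {k}. \<bar>x $ j - y $ j\<bar>)"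
  shows "hausdorff_outer (CARD('n) - 1) A < \<infinity>"
proof -
  define m where "m = CARD('n) - 1"
  have m: "m \<ge> 1" "card (UNIV - {k}) = m" using n by (auto simp: m_def card_Diff_subset)
  \<comment> \<open>A grid cell of side $2r/N$ in the other coordinates cuts out a part of diameter at most $c/N$.\<close>
  define c where "c = (L + 1) * real m * (2 * r)"
  have c: "c \<ge> 0" using L r by (simp add: c_def)
  have "\<exists>(I :: ('n \<Rightarrow> nat) set) V D. finite I \<and> A \<subseteq> (\<Union>i\<in>I. V i) \<and>
      0 \<le> D \<and> D \<le> \<delta> \<and> (\<forall>i\<in>I. bounded (V i) \<and> diameter (V i) \<le> D) \<and> real (card I) * D ^ m \<le> c ^ m"
    if \<delta>: "\<delta> > 0" for \<delta>
  proof -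
    obtain N :: nat where N: "N > c / \<delta>" "N > 0"
      using reals_Archimedean2[of "max 0 (c / \<delta>)"] by (auto simp: less_eq_real_def)
    define cell where "cell x j = nat \<lfloor>(x $ j - z $ j + r) * N / (2 * r)\<rfloor>" for x j
    define I where "I = PiE (UNIV - {k}) (\<lambda>_. {..<N})"
    define V where "V f = {x \<in> A. \<forall>j\<in>UNIV - {k}. cell x j = f j}" for f
    have range: "0 \<le> (x $ j - z $ j + r) * N / (2 * r)" "(x $ j - z $ j + r) * N / (2 * r) < N"
      if "x \<in> A" for x j
    proof -
      have *: "0 \<le> x $ j - z $ j + r" "x $ j - z $ j + r < 2 * r"
        using bd[OF that, of j] by linarith+
      show "0 \<le> (x $ j - z $ j + r) * N / (2 * r)"
        using * r by simp
      have "(x $ j - z $ j + r) * N < 2 * r * N"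
        using * N(2) by (intro mult_strict_right_mono) auto
      then show "(x $ j - z $ j + r) * N / (2 * r) < N"
        using r by (simp add: pos_divide_less_eq mult.commute)
    qed
    have "restrict (cell x) (UNIV - {k}) \<in> I" if "x \<in> A" for x
      using range[OF that] by (auto simp: I_def cell_def nat_less_iff floor_less_iff)
    then have "A \<subseteq> (\<Union>f\<in>I. V f)"
      by (fastforce simp: V_def)
    moreover have close: "norm (x - y) \<le> c / N" if "x \<in> V f" "y \<in> V f" for f x y
    proof -
      have xy: "x \<in> A" "y \<in> A" using that by (auto simp: V_def)
      have coord: "\<bar>x $ j - y $ j\<bar> \<le> 2 * r / N" if "j \<noteq> k" for j
      proof -
        let ?s = "(x $ j - z $ j + r) * N / (2 * r)" and ?t = "(y $ j - z $ j + r) * N / (2 * r)"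
        have "nat \<lfloor>?s\<rfloor> = nat \<lfloor>?t\<rfloor>"
          using \<open>x \<in> V f\<close> \<open>y \<in> V f\<close> that by (auto simp: V_def cell_def)
        then have "\<lfloor>?s\<rfloor> = \<lfloor>?t\<rfloor>"
          using range(1)[OF xy(1), of j] range(1)[OF xy(2), of j]
          by (metis eq_nat_nat_iff zero_le_floor)
        then have "\<bar>?s - ?t\<bar> \<le> 1" by linarith
        moreover have "?s - ?t = (x $ j - y $ j) * (N / (2 * r))"
          by (simp add: diff_divide_distrib[symmetric] algebra_simps)
        ultimately have "\<bar>x $ j - y $ j\<bar> * (N / (2 * r)) \<le> 1"
          using r by (simp add: abs_mult)
        then show ?thesis using N(2) r by (simp add: field_simps)
      qed
      have "norm (x - y) \<le> (\<Sum>j\<in>UNIV. \<bar>x $ j - y $ j\<bar>)"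
        using norm_le_l1_cart[of "x - y"] by simp
      also have "\<dots> = \<bar>x $ k - y $ k\<bar> + (\<Sum>j\<in>UNIV - {k}. \<bar>x $ j - y $ j\<bar>)"
        by (subst sum.remove[of _ k]) auto
      also have "\<dots> \<le> (L + 1) * (\<Sum>j\<in>UNIV - {k}. \<bar>x $ j - y $ j\<bar>)"
        using Lip[OF xy] by (simp add: algebra_simps)
      also have "\<dots> \<le> (L + 1) * (\<Sum>j\<in>UNIV - {k}. 2 * r / N)"
        using L by (intro mult_left_mono sum_mono coord) auto
      also have "\<dots> = c / N" by (simp add: m c_def)
      finally show ?thesis .
    qed
    moreover have "bounded (V f)" for f
    proof (cases "V f = {}")
      case False
      then obtain y where "y \<in> V f" by blast
      then have "V f \<subseteq> cball y (c / N)"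
        using close by (auto simp: dist_norm norm_minus_commute)
      then show ?thesis by (rule bounded_subset[OF bounded_cball])
    qed simp
    moreover have "diameter (V f) \<le> c / N" for f
      using close c by (intro diameter_le) auto
    moreover have "c / N \<le> \<delta>" using N \<delta> by (simp add: field_simps)
    moreover have "real (card I) * (c / N) ^ m \<le> c ^ m"
      using N by (simp add: I_def card_PiE m power_divide)
    moreover have "finite I" by (simp add: I_def finite_PiE)
    moreover have "0 \<le> c / N" using c by simp
    ultimately show ?thesis
      by (intro exI[of _ I] exI[of _ V] exI[of _ "c / N"]) blast
  qed
  then have "hausdorff_outer m A \<le> ennreal (unit_ball_vol (real m) * c ^ m)"
    by (rule hausdorff_outer_le_covers[OF m(1)])
  then show ?thesis unfolding m_def by (rule order.strict_trans1) simp
qed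

lemma interface_level_function:
  assumes "C2_interface c" "x \<in> Gam c"
  obtains U \<phi> g where "x \<in> U" "C2_level_function c U \<phi> g"
  using assms unfolding C2_interface_def by blast

lemma C2_level_function_gradient_continuous:
  assumes "C2_level_function c U \<phi> g" "x \<in> U"
  shows "isCont g x"
proof -
  obtain H :: "_ \<Rightarrow> _ \<Rightarrow>\<^sub>L _" where "\<forall>x\<in>U. (g has_derivative blinfun_apply (H x)) (at x)"
    using assms(1) unfolding C2_level_function_def by fast
  with assms(2) show ?thesis using has_derivative_continuous by fast
qed

text \<open>
  Near \<open>z\<close> some component \<open>k\<close> of the gradient stays away from zero. The level function vanishes at any two
  interface points, so by the mean value theorem their difference is orthogonal to an intermediate gradient, which
  bounds the difference of the \<open>k\<close>-th coordinates by those of the others. Thus the interface is a Lipschitz graph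
  near \<open>z\<close>, without recourse to the implicit function theorem.
\<close>

lemma interface_locally_finite:
  fixes c :: "'n::finite problem"
  assumes n: "CARD('n) \<ge> 2" and level: "C2_level_function c U \<phi> g" and z: "z \<in> U"
  shows "\<exists>e>0. emeasure surf (Gam c \<inter> ball z e) < \<infinity>"
proof -
  have U: "open U" "\<And>x. x \<in> U \<Longrightarrow> GDERIV \<phi> x :> g x" "g z \<noteq> 0"
    and zero: "\<And>x. x \<in> U \<Longrightarrow> x \<in> Gam c \<Longrightarrow> \<phi> x = 0"
    using level z by (auto simp: C2_level_function_def)
  obtain k where k: "g z $ k \<noteq> 0" using U(3) by (auto simp: vec_eq_iff)
  define a where "a = \<bar>g z $ k\<bar> / 2"
  define M where "M = norm (g z) + a"
  have a: "a > 0" "M > 0" using k by (auto simp: a_def M_def add_nonneg_pos)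
  have "isCont g z" using C2_level_function_gradient_continuous[OF level z] .
  then obtain d where d: "d > 0" "\<And>y. dist y z < d \<Longrightarrow> dist (g y) (g z) < a"
    using a(1) unfolding continuous_at_eps_delta by blast
  obtain e' where e': "e' > 0" "ball z e' \<subseteq> U" using U(1) z openE by blast
  define e where "e = min d e'"
  have e: "e > 0" "ball z e \<subseteq> U" using d e' by (auto simp: e_def)
  have ga: "\<bar>g y $ k\<bar> \<ge> a" and gM: "\<bar>g y $ j\<bar> \<le> M" if "y \<in> ball z e" for y j
  proof -
    have "dist (g y) (g z) < a" using d(2)[of y] that by (simp add: e_def dist_commute)
    then have *: "norm (g y - g z) < a" by (simp add: dist_norm)
    show "\<bar>g y $ k\<bar> \<ge> a"
      using * component_le_norm_cart[of "g y - g z" k] by (simp add: a_def)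
    show "\<bar>g y $ j\<bar> \<le> M"
      using * component_le_norm_cart[of "g y" j] norm_triangle_sub[of "g y" "g z"] by (simp add: M_def)
  qed
  have lip: "\<bar>x $ k - y $ k\<bar> \<le> (M / a) * (\<Sum>j\<in>UNIV - {k}. \<bar>x $ j - y $ j\<bar>)"
    if xy: "x \<in> Gam c \<inter> ball z e" "y \<in> Gam c \<inter> ball z e" for x y
  proof -
    have seg: "y + t *\<^sub>R (x - y) \<in> ball z e" if "0 \<le> t" "t \<le> 1" for t
    proof -
      have "(1 - t) *\<^sub>R y + t *\<^sub>R x \<in> ball z e"
        using xy that by (intro convexD[OF convex_ball]) auto
      then show ?thesis by (simp add: algebra_simps)
    qed
    have "\<exists>t\<in>{0<..<1}. \<phi> (y + 1 *\<^sub>R (x - y)) - \<phi> (y + 0 *\<^sub>R (x - y))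
        = ((1 - 0) *\<^sub>R (x - y)) \<bullet> g (y + t *\<^sub>R (x - y))"
    proof (rule mvt_simple)
      fix t :: real assume t: "0 \<le> t" "t \<le> 1"
      have "((\<lambda>t. y + t *\<^sub>R (x - y)) has_derivative (\<lambda>h. h *\<^sub>R (x - y))) (at t within {0..1})"
        by (auto intro!: derivative_eq_intros)
      from has_derivative_compose[OF this U(2)[unfolded gderiv_def]]
      show "((\<lambda>t. \<phi> (y + t *\<^sub>R (x - y))) has_derivative
          (\<lambda>h. (h *\<^sub>R (x - y)) \<bullet> g (y + t *\<^sub>R (x - y)))) (at t within {0..1})"
        using seg[OF t] e(2) by blast
    qed simp
    then obtain t where t: "t \<in> {0<..<1}"
      and eq: "\<phi> x - \<phi> y = (x - y) \<bullet> g (y + t *\<^sub>R (x - y))" by auto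
    define w where "w = g (y + t *\<^sub>R (x - y))"
    have w: "\<bar>w $ k\<bar> \<ge> a" "\<And>j. \<bar>w $ j\<bar> \<le> M"
      using ga gM seg[of t] t by (auto simp: w_def)
    have "\<phi> x = 0" "\<phi> y = 0" using zero xy e(2) by auto
    then have "(\<Sum>j\<in>UNIV. (x $ j - y $ j) * w $ j) = 0"
      using eq by (simp add: w_def inner_vec_def)
    then have "(x $ k - y $ k) * w $ k = - (\<Sum>j\<in>UNIV - {k}. (x $ j - y $ j) * w $ j)"
      by (subst (asm) sum.remove[of _ k]) auto
    then have "\<bar>x $ k - y $ k\<bar> * \<bar>w $ k\<bar> = \<bar>\<Sum>j\<in>UNIV - {k}. (x $ j - y $ j) * w $ j\<bar>"
      by (simp flip: abs_mult)
    also have "\<dots> \<le> (\<Sum>j\<in>UNIV - {k}. \<bar>x $ j - y $ j\<bar> * M)"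
      by (rule order_trans[OF sum_abs]) (auto intro!: sum_mono mult_left_mono w simp: abs_mult)
    finally have "\<bar>x $ k - y $ k\<bar> * \<bar>w $ k\<bar> \<le> M * (\<Sum>j\<in>UNIV - {k}. \<bar>x $ j - y $ j\<bar>)"
      by (simp add: sum_distrib_left mult.commute)
    moreover have "\<bar>x $ k - y $ k\<bar> * a \<le> \<bar>x $ k - y $ k\<bar> * \<bar>w $ k\<bar>"
      by (intro mult_left_mono w) auto
    ultimately show ?thesis using a by (simp add: field_simps)
  qed
  have bd: "\<bar>x $ j - z $ j\<bar> < e" if "x \<in> Gam c \<inter> ball z e" for x j
    using that component_le_norm_cart[of "x - z" j] by (auto simp: dist_norm norm_minus_commute)
  have "hausdorff_outer (CARD('n) - 1) (Gam c \<inter> ball z e) < \<infinity>"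
    using a by (intro hausdorff_outer_coordinate_graph_finite[OF n e(1) _ bd lip]) auto
  then show ?thesis
    using e(1) emeasure_surf_le[of "Gam c \<inter> ball z e"] by (metis order.strict_trans1)
qed

lemma closed_Gam: "closed (Gam c)"
  by (simp add: Gam_def)

lemma emeasure_interface_finite:
  fixes c :: "'n::finite problem"
  assumes n: "CARD('n) \<ge> 2" and c: "C2_interface c" and bounded: "bounded (Dom c)"
  shows "emeasure surf (Gam c) < \<infinity>"
proof -
  have "\<forall>z\<in>Gam c. \<exists>e>0. emeasure surf (Gam c \<inter> ball z e) < \<infinity>"
    using c interface_locally_finite[OF n] unfolding C2_interface_def by metis
  then obtain e where e: "\<And>z. z \<in> Gam c \<Longrightarrow> e z > 0"
    "\<And>z. z \<in> Gam c \<Longrightarrow> emeasure surf (Gam c \<inter> ball z (e z)) < \<infinity>" by metis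
  have "compact (Gam c)"
    using bounded c closed_Gam[of c] unfolding C2_interface_def
    by (metis Un_upper1 bounded_subset compact_eq_bounded_closed le_supE subset_refl)
  then obtain Z where Z: "Z \<subseteq> Gam c" "finite Z" "Gam c \<subseteq> (\<Union>z\<in>Z. ball z (e z))"
    by (rule compactE_image[of _ "Gam c" "\<lambda>z. ball z (e z)"]) (use e(1) in auto)
  have meas: "Gam c \<inter> ball z (e z) \<in> sets surf" for z
    using closed_Gam[of c] by (simp add: sets_surf)
  have "emeasure surf (Gam c) \<le> emeasure surf (\<Union>z\<in>Z. Gam c \<inter> ball z (e z))"
    using Z meas by (intro emeasure_mono sets.finite_UN) auto
  also have "\<dots> \<le> (\<Sum>z\<in>Z. emeasure surf (Gam c \<inter> ball z (e z)))"
    using Z meas by (intro emeasure_subadditive_finite) auto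
  also have "\<dots> < \<infinity>"
    using Z e(2) by (simp add: subset_eq)
  finally show ?thesis .
qed

section \<open>The unit normal\<close>

lemma GDERIV_directional:
  assumes "GDERIV \<phi> x :> D"
  shows "((\<lambda>t. \<phi> (x + t *\<^sub>R d)) has_real_derivative (d \<bullet> D)) (at 0)"
proof -
  have "((\<lambda>t. x + t *\<^sub>R d) has_derivative (\<lambda>h. h *\<^sub>R d)) (at 0)"
    by (auto intro!: derivative_eq_intros)
  moreover have "(\<phi> has_derivative (\<lambda>h. h \<bullet> D)) (at (x + 0 *\<^sub>R d))"
    using assms by (simp add: gderiv_def)
  ultimately have "((\<lambda>t. \<phi> (x + t *\<^sub>R d)) has_derivative (\<lambda>h. (h *\<^sub>R d) \<bullet> D)) (at 0)"
    by (rule has_derivative_compose)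
  then show ?thesis by (simp add: has_field_derivative_def mult.commute[of _ "d \<bullet> D"])
qed

text \<open>
  If the two unit normals $\mu$ and $\nu$ differed, moving from \<open>x\<close> in the direction $\nu - \mu$ would decrease the
  first level function and increase the second one, so nearby points in this direction would lie in both subdomains.
\<close>

lemma level_function_normal_unique:
  fixes c :: "'n::finite problem"
  assumes disj: "Sub c 1 \<inter> Sub c 2 = {}" and x: "x \<in> Gam c" "x \<in> U" "x \<in> V"
    and U: "C2_level_function c U \<phi> g" and V: "C2_level_function c V \<psi> f"
  shows "g x /\<^sub>R norm (g x) = f x /\<^sub>R norm (f x)"
proof (rule ccontr)
  assume ne: "g x /\<^sub>R norm (g x) \<noteq> f x /\<^sub>R norm (f x)"
  define \<mu> \<nu> where "\<mu> = g x /\<^sub>R norm (g x)" and "\<nu> = f x /\<^sub>R norm (f x)"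
  \<comment> \<open>This direction has a negative product with $\mu$ and a positive one with $\nu$.\<close>
  define d where "d = \<nu> - \<mu>"
  have nz: "g x \<noteq> 0" "f x \<noteq> 0"
    and der: "GDERIV \<phi> x :> g x" "GDERIV \<psi> x :> f x" and op: "open U" "open V"
    and S1: "\<And>y. y \<in> U \<Longrightarrow> \<phi> y < 0 \<Longrightarrow> y \<in> Sub c 1" and S2: "\<And>y. y \<in> V \<Longrightarrow> \<psi> y > 0 \<Longrightarrow> y \<in> Sub c 2"
    and zero: "\<phi> x = 0" "\<psi> x = 0"
    using U V x by (auto simp: C2_level_function_def)
  have unit: "\<mu> \<bullet> \<mu> = 1" "\<nu> \<bullet> \<nu> = 1"
    using nz by (simp_all add: \<mu>_def \<nu>_def dot_square_norm power2_eq_square)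
  have "\<nu> - \<mu> \<noteq> 0" using ne by (simp add: \<mu>_def \<nu>_def)
  then have "(\<nu> - \<mu>) \<bullet> (\<nu> - \<mu>) > 0" by (rule inner_gt_zero_iff[THEN iffD2])
  then have less: "\<mu> \<bullet> \<nu> < 1" by (simp add: inner_diff unit inner_commute)
  have "d \<bullet> g x = norm (g x) * (d \<bullet> \<mu>)" "d \<bullet> f x = norm (f x) * (d \<bullet> \<nu>)"
    using nz by (simp_all add: \<mu>_def \<nu>_def)
  moreover have "d \<bullet> \<mu> < 0" "d \<bullet> \<nu> > 0"
    using less by (simp_all add: d_def inner_diff_left unit inner_commute[of \<nu> \<mu>])
  ultimately have sgn: "d \<bullet> g x < 0" "d \<bullet> f x > 0"
    using nz by (simp_all add: mult_pos_neg)
  obtain t1 where t1: "t1 > 0" "\<And>t. 0 < t \<Longrightarrow> t < t1 \<Longrightarrow> \<phi> (x + t *\<^sub>R d) < 0"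
    using has_real_derivative_neg_dec_right[OF GDERIV_directional[OF der(1)] sgn(1)] zero by auto
  obtain t2 where t2: "t2 > 0" "\<And>t. 0 < t \<Longrightarrow> t < t2 \<Longrightarrow> \<psi> (x + t *\<^sub>R d) > 0"
    using has_real_derivative_pos_inc_right[OF GDERIV_directional[OF der(2)] sgn(2)] zero by auto
  obtain e where e: "e > 0" "ball x e \<subseteq> U \<inter> V" using op x by (metis IntI open_Int openE)
  have nd: "norm d + 1 > 0" by (simp add: add_nonneg_pos)
  then have "min (min t1 t2) (e / (norm d + 1)) > 0" using e t1(1) t2(1) by simp
  then obtain t where t: "0 < t" "t < t1" "t < t2" "t < e / (norm d + 1)"
    using dense by (metis min_less_iff_conj)
  have "t * norm d \<le> t * (norm d + 1)" using t by simp
  also have "\<dots> < e" using t(4) nd by (simp add: pos_less_divide_eq)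
  finally have "x + t *\<^sub>R d \<in> ball x e" using t by (simp add: dist_norm)
  then have "x + t *\<^sub>R d \<in> Sub c 1 \<inter> Sub c 2"
    using e t t1(2)[of t] t2(2)[of t] S1 S2 by blast
  with disj show False by blast
qed

lemma normal_eq:
  assumes disj: "Sub c 1 \<inter> Sub c 2 = {}" and x: "x \<in> Gam c" "x \<in> U" and U: "C2_level_function c U \<phi> g"
  shows "normal c i x = (if i = 1 then 1 else -1) *\<^sub>R (g x /\<^sub>R norm (g x))"
proof -
  have "(THE n. \<exists>U \<phi> g. x \<in> U \<and> C2_level_function c U \<phi> g \<and> n = g x /\<^sub>R norm (g x)) = g x /\<^sub>R norm (g x)"
    using level_function_normal_unique[OF disj x(1) _ x(2) _ U] x(2) U by (intro the_equality) blast+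
  then show ?thesis by (simp add: normal_def)
qed

lemma continuous_on_normal:
  assumes c: "C2_interface c"
  shows "continuous_on (Gam c) (normal c i)"
  unfolding continuous_on_eq_continuous_within
proof
  fix x assume x: "x \<in> Gam c"
  then obtain U \<phi> g where U: "x \<in> U" "C2_level_function c U \<phi> g"
    using interface_level_function[OF c] by blast
  have disj: "Sub c 1 \<inter> Sub c 2 = {}" using c by (simp add: C2_interface_def)
  have "open U" "g x \<noteq> 0" using U by (auto simp: C2_level_function_def)
  have "isCont (\<lambda>y. (if i = 1 then 1 else -1) *\<^sub>R (g y /\<^sub>R norm (g y))) x"
    using \<open>g x \<noteq> 0\<close> C2_level_function_gradient_continuous[OF U(2,1)]
    by (intro continuous_intros) auto
  then have "continuous (at x within Gam c) (\<lambda>y. (if i = 1 then 1 else -1) *\<^sub>R (g y /\<^sub>R norm (g y)))"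
    by (rule continuous_at_imp_continuous_at_within)
  then have "((\<lambda>y. (if i = 1 then 1 else -1) *\<^sub>R (g y /\<^sub>R norm (g y))) \<longlongrightarrow> normal c i x) (at x within Gam c)"
    unfolding continuous_within normal_eq[OF disj x U] .
  moreover have "\<forall>\<^sub>F y in at x within Gam c.
      (if i = 1 then 1 else -1) *\<^sub>R (g y /\<^sub>R norm (g y)) = normal c i y"
    unfolding eventually_at_topological
    using \<open>open U\<close> U(1) by (intro exI[of _ U]) (simp add: normal_eq[OF disj _ _ U(2)])
  ultimately have "(normal c i \<longlongrightarrow> normal c i x) (at x within Gam c)"
    by (rule Lim_transform_eventually)
  then show "continuous (at x within Gam c) (normal c i)"
    unfolding continuous_within .
qed

section \<open>Bounded measurable functions on a set of finite measure\<close>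

text \<open>
  A class of integrands that is closed under the pointwise operations occurring in the forms and contained in the
  integrable functions, so that integrability never has to be checked by hand.
\<close>

definition bounded_measurable_on :: "'a measure \<Rightarrow> 'a set \<Rightarrow> ('a \<Rightarrow> 'b::real_normed_vector) \<Rightarrow> bool" where
  "bounded_measurable_on M A f \<longleftrightarrow>
     A \<in> sets M \<and> emeasure M A < \<infinity> \<and> set_borel_measurable M A f \<and> (\<exists>C. \<forall>x\<in>A. norm (f x) \<le> C)"

lemma bounded_measurable_onI:
  assumes "A \<in> sets M" "emeasure M A < \<infinity>" "set_borel_measurable M A f" "\<And>x. x \<in> A \<Longrightarrow> norm (f x) \<le> C"
  shows "bounded_measurable_on M A f"
  using assms by (auto simp: bounded_measurable_on_def)

lemma bounded_measurable_onD:
  assumes "bounded_measurable_on M A f"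
  shows "A \<in> sets M" "emeasure M A < \<infinity>" "(\<lambda>x. indicator A x *\<^sub>R f x) \<in> borel_measurable M"
  using assms by (auto simp: bounded_measurable_on_def set_borel_measurable_def)

lemma bounded_measurable_on_integrable:
  fixes f :: "'a \<Rightarrow> 'b::{banach, second_countable_topology}"
  assumes "bounded_measurable_on M A f"
  shows "set_integrable M A f"
proof -
  obtain C where "\<And>x. x \<in> A \<Longrightarrow> norm (f x) \<le> C"
    using assms by (auto simp: bounded_measurable_on_def)
  then show ?thesis
    using assms unfolding set_integrable_def bounded_measurable_on_def set_borel_measurable_def
    by (intro integrableI_bounded_set[of A M _ C]) auto
qed

lemma bounded_measurable_on_cong:
  assumes "bounded_measurable_on M A f" "\<And>x. x \<in> A \<Longrightarrow> f x = g x"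
  shows "bounded_measurable_on M A g"
proof -
  have "(\<lambda>x. indicator A x *\<^sub>R f x) = (\<lambda>x. indicator A x *\<^sub>R g x)"
    using assms(2) by (auto simp: fun_eq_iff indicator_def)
  then show ?thesis
    using assms by (simp add: bounded_measurable_on_def set_borel_measurable_def)
qed

lemma bounded_measurable_on_subset:
  fixes f :: "'a \<Rightarrow> 'b::{real_normed_vector, second_countable_topology}"
  assumes f: "bounded_measurable_on M A f" and B: "B \<in> sets M" "B \<subseteq> A"
  shows "bounded_measurable_on M B f"
proof -
  have "emeasure M B \<le> emeasure M A"
    using assms by (intro emeasure_mono) (auto simp: bounded_measurable_on_def)
  moreover have "(\<lambda>x. indicator B x *\<^sub>R (indicator A x *\<^sub>R f x)) \<in> borel_measurable M"
    by (rule borel_measurable_scaleR[OF borel_measurable_indicator[OF B(1)] bounded_measurable_onD(3)[OF f]])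
  moreover have "(\<lambda>x. indicator B x *\<^sub>R (indicator A x *\<^sub>R f x)) = (\<lambda>x. indicator B x *\<^sub>R f x)"
    using B(2) by (auto simp: fun_eq_iff indicator_def)
  ultimately show ?thesis
    using f B by (auto simp: bounded_measurable_on_def set_borel_measurable_def intro: order.strict_trans1)
qed

lemma bounded_measurable_on_const:
  fixes k :: "'b::{real_normed_vector, second_countable_topology}"
  assumes "A \<in> sets M" "emeasure M A < \<infinity>"
  shows "bounded_measurable_on M A (\<lambda>x. k)"
proof (rule bounded_measurable_onI[OF assms, where C = "norm k"])
  show "set_borel_measurable M A (\<lambda>x. k)"
    unfolding set_borel_measurable_def
    by (rule borel_measurable_scaleR[OF borel_measurable_indicator[OF assms(1)] borel_measurable_const])
qed simp

lemma bounded_measurable_on_scaleR: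
  fixes f :: "'a \<Rightarrow> 'b::{real_normed_vector, second_countable_topology}"
  assumes "bounded_measurable_on M A s" "bounded_measurable_on M A f"
  shows "bounded_measurable_on M A (\<lambda>x. s x *\<^sub>R f x)"
proof -
  obtain C D where CD: "\<And>x. x \<in> A \<Longrightarrow> norm (s x) \<le> C" "\<And>x. x \<in> A \<Longrightarrow> norm (f x) \<le> D"
    using assms by (auto simp: bounded_measurable_on_def)
  have "(\<lambda>x. (indicator A x *\<^sub>R s x) *\<^sub>R (indicator A x *\<^sub>R f x)) \<in> borel_measurable M"
    by (rule borel_measurable_scaleR[OF assms[THEN bounded_measurable_onD(3)]])
  moreover have "(\<lambda>x. (indicator A x *\<^sub>R s x) *\<^sub>R (indicator A x *\<^sub>R f x)) = (\<lambda>x. indicator A x *\<^sub>R (s x *\<^sub>R f x))"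
    by (auto simp: indicator_def)
  moreover have "norm (s x *\<^sub>R f x) \<le> C * D" if "x \<in> A" for x
    using CD[OF that] by (simp add: mult_mono' )
  ultimately show ?thesis
    using assms by (intro bounded_measurable_onI[where C = "C * D"])
      (auto simp: bounded_measurable_on_def set_borel_measurable_def)
qed

lemma bounded_measurable_on_add:
  fixes f g :: "'a \<Rightarrow> 'b::{real_normed_vector, second_countable_topology}"
  assumes "bounded_measurable_on M A f" "bounded_measurable_on M A g"
  shows "bounded_measurable_on M A (\<lambda>x. f x + g x)"
proof -
  obtain C D where CD: "\<And>x. x \<in> A \<Longrightarrow> norm (f x) \<le> C" "\<And>x. x \<in> A \<Longrightarrow> norm (g x) \<le> D"
    using assms by (auto simp: bounded_measurable_on_def)
  have "norm (f x + g x) \<le> C + D" if "x \<in> A" for x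
    using CD[OF that] norm_triangle_ineq[of "f x" "g x"] by linarith
  then show ?thesis
    using assms by (intro bounded_measurable_onI[where C = "C + D"])
      (auto simp: bounded_measurable_on_def set_borel_measurable_def scaleR_add_right)
qed

lemma bounded_measurable_on_inner:
  fixes f g :: "'a \<Rightarrow> 'b::{real_inner, second_countable_topology}"
  assumes "bounded_measurable_on M A f" "bounded_measurable_on M A g"
  shows "bounded_measurable_on M A (\<lambda>x. f x \<bullet> g x)"
proof -
  obtain C D where CD: "\<And>x. x \<in> A \<Longrightarrow> norm (f x) \<le> C" "\<And>x. x \<in> A \<Longrightarrow> norm (g x) \<le> D"
    using assms by (auto simp: bounded_measurable_on_def)
  have "(\<lambda>x. (indicator A x *\<^sub>R f x) \<bullet> (indicator A x *\<^sub>R g x)) \<in> borel_measurable M"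
    by (rule borel_measurable_inner[OF assms[THEN bounded_measurable_onD(3)]])
  moreover have "(\<lambda>x. (indicator A x *\<^sub>R f x) \<bullet> (indicator A x *\<^sub>R g x)) = (\<lambda>x. indicator A x *\<^sub>R (f x \<bullet> g x))"
    by (auto simp: indicator_def)
  moreover have "norm (f x \<bullet> g x) \<le> C * D" if "x \<in> A" for x
    using CD[OF that] Cauchy_Schwarz_ineq2[of "f x" "g x"]
    by (metis mult_mono' norm_ge_zero order_trans real_norm_def)
  ultimately show ?thesis
    using assms by (intro bounded_measurable_onI[where C = "C * D"])
      (auto simp: bounded_measurable_on_def set_borel_measurable_def)
qed

lemma bounded_measurable_on_norm_sq:
  fixes f :: "'a \<Rightarrow> 'b::{real_inner, second_countable_topology}"
  assumes "bounded_measurable_on M A f"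
  shows "bounded_measurable_on M A (\<lambda>x. (norm (f x))\<^sup>2)"
  using bounded_measurable_on_inner[OF assms assms] by (simp add: dot_square_norm)

lemma bounded_measurable_on_if:
  fixes f :: "'a \<Rightarrow> 'b::{real_normed_vector, second_countable_topology}"
  assumes f: "bounded_measurable_on M A f" and P: "{x. P x} \<in> sets M"
  shows "bounded_measurable_on M A (\<lambda>x. if P x then f x else 0)"
proof -
  have A: "A \<in> sets M" "emeasure M A < \<infinity>" using f by (auto simp: bounded_measurable_on_def)
  have "bounded_measurable_on M A (indicator {x. P x} :: 'a \<Rightarrow> real)"
  proof (rule bounded_measurable_onI[OF A, where C = 1])
    show "set_borel_measurable M A (indicator {x. P x} :: 'a \<Rightarrow> real)"
      unfolding set_borel_measurable_def
      by (rule borel_measurable_scaleR[OF borel_measurable_indicator[OF A(1)] borel_measurable_indicator[OF P]])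
  qed (simp add: indicator_def)
  from bounded_measurable_on_scaleR[OF this f] show ?thesis
    by (rule bounded_measurable_on_cong) (auto simp: indicator_def)
qed

lemma bounded_measurable_on_continuous:
  fixes f :: "'a::topological_space \<Rightarrow> 'b::{real_normed_vector, second_countable_topology}"
  assumes M: "space M = UNIV" "sets borel \<subseteq> sets M" and A: "A \<in> sets M" "emeasure M A < \<infinity>"
    and C: "compact C" "C \<in> sets borel" "A \<subseteq> C" and f: "continuous_on C f"
  shows "bounded_measurable_on M A f"
proof -
  have "(\<lambda>x. indicator C x *\<^sub>R f x) \<in> borel_measurable borel"
    by (rule borel_measurable_continuous_on_indicator[OF C(2) f])
  then have "(\<lambda>x. indicator C x *\<^sub>R f x) \<in> borel_measurable M"
    using measurable_mono[of borel borel borel M] M by auto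
  then have "(\<lambda>x. indicator A x *\<^sub>R (indicator C x *\<^sub>R f x)) \<in> borel_measurable M"
    by (rule borel_measurable_scaleR[OF borel_measurable_indicator[OF A(1)]])
  moreover have "(\<lambda>x. indicator A x *\<^sub>R (indicator C x *\<^sub>R f x)) = (\<lambda>x. indicator A x *\<^sub>R f x)"
    using C(3) by (auto simp: fun_eq_iff indicator_def)
  moreover obtain B where "\<And>x. x \<in> C \<Longrightarrow> norm (f x) \<le> B"
    using compact_imp_bounded[OF compact_continuous_image[OF f C(1)]] by (auto simp: bounded_iff)
  ultimately show ?thesis
    using A C(3) by (intro bounded_measurable_onI[where C = B]) (auto simp: set_borel_measurable_def)
qed

lemma set_integral_lincomb:
  fixes f g :: "'a \<Rightarrow> real"
  assumes "bounded_measurable_on M A f" "bounded_measurable_on M A g"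
  shows "(LINT x:A|M. s * f x + t * g x) = s * (LINT x:A|M. f x) + t * (LINT x:A|M. g x)"
  using assms[THEN bounded_measurable_on_integrable]
  by (simp add: set_integral_add set_integrable_mult_right)

lemma set_integral_finite_sum:
  fixes f :: "'j \<Rightarrow> 'a \<Rightarrow> real"
  assumes "finite J" "A \<in> sets M" "emeasure M A < \<infinity>" "\<And>j. j \<in> J \<Longrightarrow> bounded_measurable_on M A (f j)"
  shows "bounded_measurable_on M A (\<lambda>x. \<Sum>j\<in>J. f j x) \<and>
    (LINT x:A|M. \<Sum>j\<in>J. f j x) = (\<Sum>j\<in>J. LINT x:A|M. f j x)"
  using assms(1,4)
proof (induction J)
  case empty
  then show ?case
    using bounded_measurable_on_const[OF assms(2,3), of "0::real"] by (simp add: set_lebesgue_integral_def)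
next
  case (insert j J)
  then show ?case
    using bounded_measurable_on_add[of M A "f j" "\<lambda>x. \<Sum>j\<in>J. f j x"]
      set_integral_lincomb[of M A "f j" "\<lambda>x. \<Sum>j\<in>J. f j x" 1 1] by simp
qed

text \<open>
  Expanding $\|\sqrt t f \mp g/\sqrt t\|^2 \ge 0$ pointwise for both signs; the signs produce the absolute value.
\<close>

lemma set_integral_inner_young:
  fixes f g :: "'a \<Rightarrow> 'b::euclidean_space"
  assumes f: "bounded_measurable_on M A f" and g: "bounded_measurable_on M A g" and t: "t > 0"
  shows "2 * \<bar>LINT x:A|M. f x \<bullet> g x\<bar> \<le> t * (LINT x:A|M. (norm (f x))\<^sup>2) + (LINT x:A|M. (norm (g x))\<^sup>2) / t"
proof -
  note bm = bounded_measurable_on_norm_sq[OF f] bounded_measurable_on_norm_sq[OF g]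
    bounded_measurable_on_inner[OF f g]
  have A: "A \<in> sets M" "emeasure M A < \<infinity>" using f by (auto simp: bounded_measurable_on_def)
  have pointwise: "2 * (\<epsilon> * (f x \<bullet> g x)) \<le> t * (norm (f x))\<^sup>2 + (1 / t) * (norm (g x))\<^sup>2"
    if "\<bar>\<epsilon>\<bar> = 1" for \<epsilon> :: real and x
  proof -
    have "0 \<le> (norm (sqrt t *\<^sub>R f x - (\<epsilon> / sqrt t) *\<^sub>R g x))\<^sup>2" by simp
    also have "\<dots> = t * (norm (f x))\<^sup>2 + (\<epsilon>\<^sup>2 / t) * (norm (g x))\<^sup>2 - 2 * (\<epsilon> * (f x \<bullet> g x))"
      using t unfolding power2_norm_eq_inner inner_diff
      by (simp add: inner_commute[of "g x" "f x"] power2_eq_square algebra_simps)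
    finally show ?thesis using that by (simp add: power2_abs[of \<epsilon>, symmetric])
  qed
  have "2 * (\<epsilon> * (LINT x:A|M. f x \<bullet> g x)) \<le> t * (LINT x:A|M. (norm (f x))\<^sup>2) + (1 / t) * (LINT x:A|M. (norm (g x))\<^sup>2)"
    if \<epsilon>: "\<bar>\<epsilon>\<bar> = 1" for \<epsilon> :: real
  proof -
    have "2 * (\<epsilon> * (LINT x:A|M. f x \<bullet> g x)) = (LINT x:A|M. 2 * (\<epsilon> * (f x \<bullet> g x)))"
      by simp
    also have "\<dots> \<le> (LINT x:A|M. t * (norm (f x))\<^sup>2 + (1 / t) * (norm (g x))\<^sup>2)"
      using bm[THEN bounded_measurable_on_integrable] pointwise[OF \<epsilon>]
      by (intro set_integral_mono set_integral_add set_integrable_mult_right) auto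
    also have "\<dots> = t * (LINT x:A|M. (norm (f x))\<^sup>2) + (1 / t) * (LINT x:A|M. (norm (g x))\<^sup>2)"
      by (rule set_integral_lincomb[OF bm(1,2)])
    finally show ?thesis .
  qed
  from this[of 1] this[of "-1"] show ?thesis by (simp add: abs_if)
qed

lemma set_integral_nonneg_real:
  fixes f :: "'a \<Rightarrow> real"
  assumes "\<And>x. x \<in> A \<Longrightarrow> 0 \<le> f x"
  shows "0 \<le> (LINT x:A|M. f x)"
  unfolding set_lebesgue_integral_def using assms by (intro Bochner_Integration.integral_nonneg) (auto simp: indicator_def)

lemma L2norm_sq: "(L2norm M S f)\<^sup>2 = (LINT x:S|M. (norm (f x))\<^sup>2)"
  unfolding L2norm_def by (intro real_sqrt_pow2 set_integral_nonneg_real) simp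

section \<open>One-sided traces\<close>

text \<open>
  A continuous extension of \<open>w\<close> from \<open>S\<close> computes the trace. Points that are not limit points have to be kept apart
  because a cell may touch the interface where it has no piece on one side.
\<close>

lemma side_trace_eq:
  fixes f :: "'a::t2_space \<Rightarrow> 'b::{t2_space,zero}"
  assumes cont: "continuous (at x within S) f" and eq: "\<And>y. y \<in> S \<Longrightarrow> w y = f y"
  shows "side_trace S w x = (if x islimpt S then f x else 0)"
proof (cases "x islimpt S")
  case True
  have "(f \<longlongrightarrow> f x) (at x within S)" using cont by (simp add: continuous_within)
  moreover have "\<forall>\<^sub>F y in at x within S. f y = w y"
    using eq by (auto simp: eventually_at_filter)
  ultimately have "(w \<longlongrightarrow> f x) (at x within S)"
    by (rule Lim_transform_eventually)
  then show ?thesis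
    using True by (auto simp: side_trace_def trivial_limit_within intro!: tendsto_Lim)
qed (simp add: side_trace_def)

section \<open>Riesz representation on a finite-dimensional space of functions\<close>

text \<open>
  Riesz representation for an anisotropic symmetric bilinear form, by induction over the generators in the manner of
  Gram--Schmidt: the new generator is replaced by its component \<open>u\<close> orthogonal to the earlier ones, and a multiple
  of \<open>u\<close> corrects the representer. A generator that depends linearly on the earlier ones gives $u = 0$ and needs
  no correction.
\<close>

lemma riesz_finite_span:
  fixes e :: "'i \<Rightarrow> 'a \<Rightarrow> 'b::real_vector" and ip :: "('a \<Rightarrow> 'b) \<Rightarrow> ('a \<Rightarrow> 'b) \<Rightarrow> real"
  assumes fin: "finite I" and e: "\<And>i. i \<in> I \<Longrightarrow> e i \<in> V"
    and zero: "(\<lambda>x. 0) \<in> V"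
    and V: "\<And>u v s t. u \<in> V \<Longrightarrow> v \<in> V \<Longrightarrow> (\<lambda>x. s *\<^sub>R u x + t *\<^sub>R v x) \<in> V"
    and ip_linear: "\<And>u v w s t. u \<in> V \<Longrightarrow> v \<in> V \<Longrightarrow> w \<in> V \<Longrightarrow>
        ip (\<lambda>x. s *\<^sub>R u x + t *\<^sub>R v x) w = s * ip u w + t * ip v w"
    and ip_sym: "\<And>u v. u \<in> V \<Longrightarrow> v \<in> V \<Longrightarrow> ip u v = ip v u"
    and ip_definite: "\<And>w. w \<in> V \<Longrightarrow> ip w w = 0 \<Longrightarrow> w = (\<lambda>x. 0)"
    and L: "\<And>u v s t. u \<in> V \<Longrightarrow> v \<in> V \<Longrightarrow> L (\<lambda>x. s *\<^sub>R u x + t *\<^sub>R v x) = s * L u + t * L v"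
  shows "\<exists>a. \<forall>b. (\<lambda>x. \<Sum>i\<in>I. a i *\<^sub>R e i x) \<in> V \<and>
    ip (\<lambda>x. \<Sum>i\<in>I. a i *\<^sub>R e i x) (\<lambda>x. \<Sum>i\<in>I. b i *\<^sub>R e i x) = L (\<lambda>x. \<Sum>i\<in>I. b i *\<^sub>R e i x)"
proof -
  define comb where "comb I a = (\<lambda>x. \<Sum>i\<in>I. a i *\<^sub>R e i x)" for I a
  have ip_linear': "ip w (\<lambda>x. s *\<^sub>R u x + t *\<^sub>R v x) = s * ip w u + t * ip w v"
    if "u \<in> V" "v \<in> V" "w \<in> V" for u v w s t
    using ip_linear[OF that, of s t] ip_sym[OF V[OF that(1,2), of s t] that(3)]
      ip_sym[OF that(1,3)] ip_sym[OF that(2,3)] by simp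
  have L0: "L (\<lambda>x. 0) = 0" if "\<And>u v s t. u \<in> V \<Longrightarrow> v \<in> V \<Longrightarrow> L (\<lambda>x. s *\<^sub>R u x + t *\<^sub>R v x) = s * L u + t * L v" for L
    using that[OF zero zero, of 0 0] by simp
  have comb_in_V: "comb J a \<in> V" if "finite J" "\<And>i. i \<in> J \<Longrightarrow> e i \<in> V" for J a
    using that
  proof (induction J)
    case empty
    then show ?case using zero by (simp add: comb_def)
  next
    case (insert i J)
    then have "(\<lambda>x. a i *\<^sub>R e i x + 1 *\<^sub>R comb J a x) \<in> V" by (intro V) auto
    then show ?case using insert.hyps by (simp add: comb_def)
  qed
  have "\<exists>a. \<forall>b. ip (comb I a) (comb I b) = L (comb I b)"
    using fin e L
  proof (induction I arbitrary: L)
    case empty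
    have "ip (\<lambda>x. 0) (\<lambda>x. 0) = 0" using ip_linear[OF zero zero zero, of 0 0] by simp
    then show ?case using L0[of L] empty by (simp add: comb_def)
  next
    case (insert k I)
    have eI: "\<And>i. i \<in> I \<Longrightarrow> e i \<in> V" using insert.prems(1) by simp
    note combV = comb_in_V[OF insert.hyps(1) eI]
    have ek: "e k \<in> V" using insert.prems(1) by simp
    have "\<exists>a. \<forall>b. ip (comb I a) (comb I b) = L (comb I b)"
      by (rule insert.IH[of L]) (fact eI, fact insert.prems(2))
    then obtain a0 where a0: "\<And>b. ip (comb I a0) (comb I b) = L (comb I b)" by blast
    have "\<exists>a. \<forall>b. ip (comb I a) (comb I b) = ip (comb I b) (e k)"
      by (rule insert.IH[of "\<lambda>w. ip w (e k)"]) (fact eI, rule ip_linear[OF _ _ ek])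
    then obtain d where d: "\<And>b. ip (comb I d) (comb I b) = ip (comb I b) (e k)" by blast
    define u where "u = (\<lambda>x. 1 *\<^sub>R e k x + (-1) *\<^sub>R comb I d x)"
    have uV: "u \<in> V" unfolding u_def by (rule V[OF ek combV])
    have u_orth: "ip u (comb I b) = 0" for b
      unfolding u_def using ip_linear[OF ek combV combV, where s = 1 and t = "-1"] d ip_sym[OF ek combV]
      by simp
    \<comment> \<open>The old generators together with \<open>u\<close> span the same functions as with \<open>e k\<close>.\<close>
    have split: "comb (insert k I) b = (\<lambda>x. b k *\<^sub>R u x + 1 *\<^sub>R comb I (\<lambda>i. b k * d i + b i) x)" for b
    proof
      fix x
      have "comb I (\<lambda>i. b k * d i + b i) x = b k *\<^sub>R comb I d x + comb I b x"
        by (simp add: comb_def scaleR_add_left sum.distrib scaleR_sum_right)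
      moreover have "comb (insert k I) b x = b k *\<^sub>R e k x + comb I b x"
        using insert.hyps by (simp add: comb_def)
      ultimately show "comb (insert k I) b x = b k *\<^sub>R u x + 1 *\<^sub>R comb I (\<lambda>i. b k * d i + b i) x"
        by (simp add: u_def algebra_simps)
    qed
    have upd: "comb I (a(k := s)) = comb I a" for a s
      unfolding comb_def using insert.hyps by (intro ext sum.cong) auto
    have L_split: "L (comb (insert k I) b) = b k * L u + L (comb I (\<lambda>i. b k * d i + b i))" for b
      unfolding split using insert.prems(2)[OF uV combV, of "b k" 1] by simp
    \<comment> \<open>If \<open>u\<close> is the zero function, both \<open>L u\<close> and \<open>ip u u\<close> vanish and any factor would do.\<close>
    define t where "t = (if ip u u = 0 then 0 else L u / ip u u)"
    have t: "t * ip u u = L u"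
    proof (cases "ip u u = 0")
      case True
      then have "u = (\<lambda>x. 0)" by (rule ip_definite[OF uV])
      then show ?thesis using True L0[of L] insert.prems(2) by (simp add: t_def)
    qed (simp add: t_def)
    define a where "a = (\<lambda>i. a0 i - t * d i)(k := t)"
    define r where "r = (\<lambda>x. t *\<^sub>R u x + 1 *\<^sub>R comb I a0 x)"
    have r: "comb (insert k I) a = r"
    proof -
      have "comb I (\<lambda>i. a k * d i + a i) = comb I a0"
        unfolding comb_def using insert.hyps by (intro ext sum.cong) (auto simp: a_def)
      then show ?thesis unfolding split r_def by (simp add: a_def)
    qed
    have "ip (comb (insert k I) a) (comb (insert k I) b) = L (comb (insert k I) b)" for b
    proof -
      let ?w = "comb I (\<lambda>i. b k * d i + b i)"
      have rV: "r \<in> V" unfolding r_def by (rule V[OF uV combV])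
      have ru: "ip r u = L u"
        unfolding r_def using ip_linear[OF uV combV uV, where s = t and t = 1] u_orth ip_sym[OF uV combV] t
        by simp
      have rw: "ip r ?w = L ?w"
        unfolding r_def using ip_linear[OF uV combV combV, where s = t and t = 1] u_orth a0 by simp
      have "ip r (comb (insert k I) b) = b k * ip r u + 1 * ip r ?w"
        unfolding split[of b] by (rule ip_linear'[OF uV combV rV])
      then show ?thesis by (simp add: r L_split ru rw)
    qed
    then show ?case by blast
  qed
  moreover have "comb I a \<in> V" for a
    by (rule comb_in_V[OF fin e])
  ultimately show ?thesis by (simp add: comb_def)
qed

section \<open>A single interface problem\<close>

lemma grad_eq:
  assumes "open S" "x \<in> S" "\<And>y. y \<in> S \<Longrightarrow> v y = q y" "GDERIV q x :> D"
  shows "grad v x = D"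
proof -
  have D: "GDERIV v x :> D"
    using has_derivative_transform_within_open[OF assms(4)[unfolded gderiv_def] assms(1,2)] assms(3)
    by (simp add: gderiv_def)
  moreover have "D' = D" if "GDERIV v x :> D'" for D'
  proof -
    have "(\<lambda>h. h \<bullet> D') = (\<lambda>h. h \<bullet> D)"
      using has_derivative_unique D that unfolding gderiv_def by blast
    then have "(D' - D) \<bullet> (D' - D) = 0" by (metis inner_diff_right right_minus_eq)
    then show ?thesis by simp
  qed
  ultimately show ?thesis unfolding grad_def by (rule the_equality)
qed

text \<open>
  The constants are parameters, so that the bounds derived for a single problem are visibly uniform over a family.
\<close>

locale interface_problem =
  fixes c :: "'n::finite problem" and \<alpha>min \<alpha>max \<sigma> :: real
  assumes dim_ge_2: "CARD('n) \<ge> 2"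
    and bounded_Dom: "bounded (Dom c)"
    and interface: "C2_interface c"
    and coefficient: "coefficient c \<alpha>min \<alpha>max"
    and \<alpha>min_pos: "0 < \<alpha>min"
    and mesh: "conforming_mesh (Dom c) (Mesh c)"
    and shape: "shape_regular \<sigma> (Mesh c)"
begin

lemma Sub_open: "i \<in> {1,2} \<Longrightarrow> open (Sub c i)"
  and Sub_subset_Dom: "i \<in> {1,2} \<Longrightarrow> Sub c i \<subseteq> Dom c"
  and Sub_disjoint: "Sub c 1 \<inter> Sub c 2 = {}"
  and Gam_subset_Dom: "Gam c \<subseteq> Dom c"
  and Dom_eq: "Dom c = Sub c 1 \<union> Gam c \<union> Sub c 2"
  using interface by (auto simp: C2_interface_def)

lemma finite_Mesh: "finite (Mesh c)"
  using mesh by (simp add: conforming_mesh_def)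

lemma Union_Mesh: "\<Union>(Mesh c) = closure (Dom c)"
  using mesh by (simp add: conforming_mesh_def)

lemma mesh_cells: "K \<in> Mesh c \<Longrightarrow> mesh_cell K"
  using mesh by (auto simp: conforming_mesh_def mesh_cell_def)

lemma cut_cells_subset: "cut_cells c \<subseteq> Mesh c"
  by (auto simp: cut_cells_def)

lemma cell_compact_convex:
  assumes "K \<in> Mesh c"
  shows "compact K" "convex K"
proof -
  have "compact K \<and> convex K"
    using mesh_cells[OF assms] unfolding mesh_cell_def
  proof
    assume "is_simplex K"
    then show ?thesis by (auto simp: is_simplex_def compact_simplex convex_simplex)
  next
    assume "\<exists>A b. cube_image A b K"
    then obtain A b where "cube_image A b K" by blast
    then have K: "K = (\<lambda>x. b + A *v x) ` cbox 0 1"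
      unfolding cube_image_def by (rule conjunct2)
    have "compact K"
      unfolding K
      by (intro compact_continuous_image continuous_intros compact_cbox linear_continuous_on)
        (auto simp: matrix_vector_mul_bounded_linear)
    moreover have "K = (+) b ` ((*v) A ` cbox 0 1)" unfolding K by (simp add: image_image)
    then have "convex K" by (simp add: convex_translation convex_linear_image)
    ultimately show ?thesis by blast
  qed
  then show "compact K" "convex K" by auto
qed

lemma cell_diameter_pos:
  assumes "K \<in> Mesh c"
  shows "diameter K > 0"
proof -
  obtain x r where xr: "0 < r" "ball x r \<subseteq> K"
    using shape assms by (auto simp: shape_regular_def)
  have "diameter (ball x r) \<le> diameter K"
    using xr cell_compact_convex(1)[OF assms] by (intro diameter_subset compact_imp_bounded)
  moreover have "diameter (ball x r) = 2 * r" using xr by (simp add: diameter_ball)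
  ultimately show ?thesis using xr by linarith
qed

text \<open>
  The intersection of two cells is a face of both and a proper face of at least one of them; a proper face misses
  the interior.
\<close>

lemma cell_interiors_disjoint:
  assumes "K \<in> Mesh c" "K' \<in> Mesh c" "K \<noteq> K'"
  shows "interior K \<inter> interior K' = {}"
proof -
  have face: "(K \<inter> K') face_of K" "(K' \<inter> K) face_of K'"
    using mesh assms by (auto simp: conforming_mesh_def)
  have "K \<inter> K' \<noteq> K \<or> K' \<inter> K \<noteq> K'" using assms(3) by blast
  then show ?thesis
    using face_of_disjoint_interior[OF face(1)] face_of_disjoint_interior[OF face(2)]
      interior_subset[of K] interior_subset[of K'] by blast
qed

lemma cell_lmeasurable: "K \<in> Mesh c \<Longrightarrow> K \<in> lmeasurable"
  using cell_compact_convex(1) by (rule lmeasurable_compact)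

lemma piece_open: "i \<in> {1,2} \<Longrightarrow> open (piece c K i)"
  unfolding piece_def using Sub_open by (intro open_Int) auto

lemma piece_subset: "piece c K i \<subseteq> K" "piece c K i \<subseteq> Sub c i"
  using interior_subset by (auto simp: piece_def)

lemma piece_disjoint: "piece c K 1 \<inter> piece c K' 2 = {}"
  using Sub_disjoint piece_subset(2) by blast

lemma piece_sets: "i \<in> {1,2} \<Longrightarrow> piece c K i \<in> sets lebesgue"
  using piece_open[of i K] by auto

lemma emeasure_cell_finite: "K \<in> Mesh c \<Longrightarrow> emeasure lebesgue K < \<infinity>"
  using fmeasurableD2[OF cell_lmeasurable] by (metis infinity_ennreal_def less_top)

lemma emeasure_piece_finite:
  assumes "K \<in> Mesh c" "i \<in> {1,2}"
  shows "emeasure lebesgue (piece c K i) < \<infinity>"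
  using emeasure_mono[OF piece_subset(1), of K lebesgue i] cell_lmeasurable[OF assms(1)]
    emeasure_cell_finite[OF assms(1)] by (auto intro: order.strict_trans1)

lemma kappa_range:
  assumes "K \<in> Mesh c" "i \<in> {1,2}"
  shows "0 \<le> kappa c0 c K i" "kappa c0 c K i \<le> 1"
proof -
  have "measure lebesgue (piece c K i) \<le> measure lebesgue K"
    using cell_lmeasurable[OF assms(1)] piece_sets[OF assms(2)] piece_subset(1)
    by (intro measure_mono_fmeasurable) auto
  then have "measure lebesgue (piece c K i) / measure lebesgue K \<le> 1"
    by (simp add: divide_le_eq_1 measure_nonneg less_le)
  moreover have "0 \<le> measure lebesgue (piece c K i) / measure lebesgue K"
    by (simp add: measure_nonneg)
  ultimately show "0 \<le> kappa c0 c K i" "kappa c0 c K i \<le> 1"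
    by (simp_all add: kappa_def Let_def)
qed

lemma coef_bounds: "x \<in> Dom c \<Longrightarrow> \<alpha>min \<le> coef c x" "x \<in> Dom c \<Longrightarrow> coef c x \<le> \<alpha>max"
  using coefficient by (auto simp: coefficient_def)

lemma coef_tr_bounds:
  assumes "i \<in> {1,2}" "x \<in> Gam c"
  shows "0 \<le> coef_tr c i x" "coef_tr c i x \<le> \<alpha>max"
  using coefficient assms \<alpha>min_pos by (force simp: coefficient_def)+

lemma Dom_sets: "Dom c \<in> sets borel"
  unfolding Dom_eq using Sub_open closed_Gam[of c] by auto

text \<open>
  The coefficient is measurable and bounded on the domain only, whence the indicator.
\<close>

lemma bounded_measurable_coef:
  assumes "A \<in> sets lebesgue" "emeasure lebesgue A < \<infinity>"
  shows "bounded_measurable_on lebesgue A (\<lambda>x. indicator (Dom c) x * coef c x)"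
proof (rule bounded_measurable_onI[OF assms, where C = \<alpha>max])
  have "coef c \<in> borel_measurable (lebesgue_on (Dom c))"
    using coefficient by (simp add: coefficient_def)
  then have "(\<lambda>x. indicator (Dom c) x *\<^sub>R coef c x) \<in> borel_measurable lebesgue"
    using Dom_sets by (subst (asm) borel_measurable_restrict_space_iff) auto
  then show "set_borel_measurable lebesgue A (\<lambda>x. indicator (Dom c) x * coef c x)"
    unfolding set_borel_measurable_def real_scaleR_def[symmetric]
    by (rule borel_measurable_scaleR[OF borel_measurable_indicator[OF assms(1)]])
  have "0 \<le> \<alpha>max"
  proof -
    obtain x where "x \<in> Sub c 1" using interface by (auto simp: C2_interface_def)
    then show ?thesis using coef_bounds[of x] Sub_subset_Dom[of 1] \<alpha>min_pos by fastforce
  qed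
  then show "norm (indicator (Dom c) x * coef c x) \<le> \<alpha>max" for x
    using coef_bounds[of x] \<alpha>min_pos by (auto simp: indicator_def)
qed

lemma bounded_measurable_continuous_lebesgue:
  fixes f :: "real^'n \<Rightarrow> 'b::{real_normed_vector, second_countable_topology}"
  assumes K: "K \<in> Mesh c" and A: "A \<in> sets lebesgue" "A \<subseteq> K" and f: "continuous_on UNIV f"
  shows "bounded_measurable_on lebesgue A f"
proof (rule bounded_measurable_on_continuous[where C = K])
  show "emeasure lebesgue A < \<infinity>"
    using emeasure_mono[OF A(2), of lebesgue] cell_lmeasurable[OF K] emeasure_cell_finite[OF K]
    by (auto intro: order.strict_trans1)
  show "compact K" by (rule cell_compact_convex[OF K])
  then show "K \<in> sets borel" by (simp add: borel_compact)
  show "continuous_on K f" using f by (rule continuous_on_subset) simp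
  show "sets borel \<subseteq> sets lebesgue" by (auto intro: sets_completionI_sets)
qed (use A in auto)

section \<open>Surface integrals over the part of the interface inside a cell\<close>

abbreviation cut :: "(real^'n) set \<Rightarrow> (real^'n) set" where
  "cut K \<equiv> K \<inter> Gam c"

lemma cut_sets: "K \<in> Mesh c \<Longrightarrow> cut K \<in> sets surf"
  using cell_compact_convex(1)[of K] closed_Gam[of c] by (auto simp: sets_surf compact_imp_closed)

lemma emeasure_cut_finite:
  assumes "K \<in> Mesh c"
  shows "emeasure surf (cut K) < \<infinity>"
proof -
  have "emeasure surf (cut K) \<le> emeasure surf (Gam c)"
    using closed_Gam[of c] by (intro emeasure_mono) (auto simp: sets_surf)
  then show ?thesis
    using emeasure_interface_finite[OF dim_ge_2 interface bounded_Dom] by (rule order.strict_trans1)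
qed

lemma bounded_measurable_continuous_surf:
  fixes f :: "real^'n \<Rightarrow> 'b::{real_normed_vector, second_countable_topology}"
  assumes K: "K \<in> Mesh c" and f: "continuous_on (cut K) f"
  shows "bounded_measurable_on surf (cut K) f"
proof (rule bounded_measurable_on_continuous[where C = "cut K"])
  show "compact (cut K)"
    using cell_compact_convex(1)[OF K] closed_Gam[of c] by (simp add: compact_Int_closed)
qed (use cut_sets[OF K] emeasure_cut_finite[OF K] f in \<open>auto simp: sets_surf space_surf\<close>)

lemma bounded_measurable_normal: "K \<in> Mesh c \<Longrightarrow> bounded_measurable_on surf (cut K) (normal c i)"
  by (intro bounded_measurable_continuous_surf continuous_on_subset[OF continuous_on_normal[OF interface]]) auto

lemma limpt_sets: "{x::real^'n. x islimpt S} \<in> sets surf"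
  using closed_limpts[of S] by (simp add: sets_surf)

lemma bounded_measurable_coef_tr:
  assumes K: "K \<in> Mesh c" and i: "i \<in> {1,2}"
  shows "bounded_measurable_on surf (cut K) (coef_tr c i)"
proof (rule bounded_measurable_onI[OF cut_sets[OF K] emeasure_cut_finite[OF K], where C = \<alpha>max])
  have "coef_tr c i \<in> borel_measurable (restrict_space borel (Gam c))"
    using coefficient i by (auto simp: coefficient_def)
  then have "(\<lambda>x. indicator (Gam c) x *\<^sub>R coef_tr c i x) \<in> borel_measurable borel"
    using closed_Gam[of c] by (subst (asm) borel_measurable_restrict_space_iff) auto
  then have "(\<lambda>x. indicator (Gam c) x *\<^sub>R coef_tr c i x) \<in> borel_measurable surf"
    by (simp add: measurable_cong_sets[OF sets_surf refl])
  from borel_measurable_scaleR[OF borel_measurable_indicator[OF cut_sets[OF K]] this]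
  show "set_borel_measurable surf (cut K) (coef_tr c i)"
    unfolding set_borel_measurable_def
    by (rule back_subst[of "\<lambda>f. f \<in> borel_measurable surf"]) (auto simp: fun_eq_iff indicator_def)
  show "norm (coef_tr c i x) \<le> \<alpha>max" if "x \<in> cut K" for x
    using coef_tr_bounds[OF i, of x] that by simp
qed

text \<open>
  On each subdomain \<open>v\<close> agrees with a continuous finite element function, whose values on the interface are the
  traces.
\<close>

lemma bounded_measurable_jump:
  assumes K: "K \<in> Mesh c" and v: "v \<in> VhGam p c"
  shows "bounded_measurable_on surf (cut K) (jump c v)"
proof -
  obtain v1 v2 where v12: "v1 \<in> Vh p c" "v2 \<in> Vh p c"
    and v_eq: "v = (\<lambda>x. indicator (Sub c 1) x * v1 x + indicator (Sub c 2) x * v2 x)"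
    using v by (auto simp: VhGam_def)
  define u where "u i = (if i = 1 then v1 else v2)" for i :: nat
  have cont: "continuous_on (closure (Dom c)) (u i)" for i
    using v12 by (simp add: u_def Vh_def)
  have trace: "side_trace (Sub c i) v x = (if x islimpt Sub c i then u i x else 0)"
    if "i \<in> {1,2}" "x \<in> Gam c" for i x
  proof (rule side_trace_eq)
    have "continuous (at x within closure (Dom c)) (u i)"
      using cont[of i] that Gam_subset_Dom closure_subset by (auto simp: continuous_on_eq_continuous_within)
    then show "continuous (at x within Sub c i) (u i)"
      by (rule continuous_within_subset) (use Sub_subset_Dom[OF that(1)] closure_subset in blast)
    show "v y = u i y" if "y \<in> Sub c i" for y
      using that \<open>i \<in> {1,2}\<close> Sub_disjoint by (auto simp: v_eq u_def indicator_def)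
  qed
  have "bounded_measurable_on surf (cut K) (\<lambda>x. (if x islimpt Sub c i then u i x else 0) *\<^sub>R normal c i x)" for i
  proof -
    have "continuous_on (cut K) (u i)"
      using cont[of i] by (rule continuous_on_subset) (use Gam_subset_Dom closure_subset in blast)
    then show ?thesis
      by (intro bounded_measurable_on_scaleR[OF _ bounded_measurable_normal[OF K]]
          bounded_measurable_on_if[OF bounded_measurable_continuous_surf[OF K] limpt_sets])
  qed
  from bounded_measurable_on_add[OF this[of 1] this[of 2]] show ?thesis
    by (rule bounded_measurable_on_cong) (simp add: jump_def trace)
qed

section \<open>Functions with continuous extensions from both pieces of a cell\<close>

text \<open>
  What is needed of a vector field on a cut cell in order to compute its average: gradients of finite element functions
  and elements of $W_K$ both satisfy this, and two fields with the same extensions have the same average.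
\<close>

definition piece_extension :: "(real^'n) set \<Rightarrow> (nat \<Rightarrow> real^'n \<Rightarrow> real^'n) \<Rightarrow> (real^'n \<Rightarrow> real^'n) \<Rightarrow> bool" where
  "piece_extension K f w \<longleftrightarrow>
     (\<forall>i\<in>{1,2}. continuous_on UNIV (f i) \<and> (\<forall>x\<in>piece c K i. w x = f i x))"

lemma piece_extension_lincomb:
  assumes "piece_extension K f w" "piece_extension K g u"
  shows "piece_extension K (\<lambda>i x. s *\<^sub>R f i x + t *\<^sub>R g i x) (\<lambda>x. s *\<^sub>R w x + t *\<^sub>R u x)"
  using assms by (auto simp: piece_extension_def intro!: continuous_intros)

lemma avg_eq:
  assumes "piece_extension K f w"
  shows "avg c0 c K w x = (\<Sum>i\<in>{1,2}. (kappa c0 c K i * coef_tr c i x) *\<^sub>R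
    (if x islimpt piece c K i then f i x else 0))"
proof -
  have "side_trace (piece c K i) w x = (if x islimpt piece c K i then f i x else 0)" if "i \<in> {1,2}" for i
  proof (rule side_trace_eq)
    show "continuous (at x within piece c K i) (f i)"
      using assms that by (auto simp: piece_extension_def continuous_on_eq_continuous_at continuous_at_imp_continuous_at_within)
  qed (use assms that in \<open>auto simp: piece_extension_def\<close>)
  then show ?thesis by (simp add: avg_def)
qed

lemma avg_lincomb:
  assumes "piece_extension K f w" "piece_extension K g u"
  shows "avg c0 c K (\<lambda>x. s *\<^sub>R w x + t *\<^sub>R u x) x = s *\<^sub>R avg c0 c K w x + t *\<^sub>R avg c0 c K u x"
  unfolding avg_eq[OF assms(1)] avg_eq[OF assms(2)] avg_eq[OF piece_extension_lincomb[OF assms]]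
  by (simp add: algebra_simps)

lemma bounded_measurable_avg:
  assumes K: "K \<in> Mesh c" and w: "piece_extension K f w"
  shows "bounded_measurable_on surf (cut K) (avg c0 c K w)"
proof -
  have "bounded_measurable_on surf (cut K)
      (\<lambda>x. (kappa c0 c K i *\<^sub>R coef_tr c i x) *\<^sub>R (if x islimpt piece c K i then f i x else 0))"
    if i: "i \<in> {1,2}" for i
  proof -
    have "continuous_on (cut K) (f i)"
      by (rule continuous_on_subset[of UNIV]) (use w i in \<open>auto simp: piece_extension_def\<close>)
    then show ?thesis
      by (intro bounded_measurable_on_scaleR[OF bounded_measurable_on_scaleR[OF
            bounded_measurable_on_const[OF cut_sets[OF K] emeasure_cut_finite[OF K]]
            bounded_measurable_coef_tr[OF K i]]]
          bounded_measurable_on_if[OF bounded_measurable_continuous_surf[OF K] limpt_sets])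
  qed
  from bounded_measurable_on_add[OF this[of 1] this[of 2]] show ?thesis
    unfolding avg_eq[OF w, abs_def] by (simp del: One_nat_def)
qed

section \<open>The broken gradient\<close>

text \<open>
  On each open piece \<open>v\<close> is a polynomial of the local space, so the gradient, a notion depending on a neighbourhood
  only, is the gradient of that polynomial.
\<close>

lemma gradient_on_pieces:
  assumes K: "K \<in> Mesh c" and v: "v \<in> VhGam p c"
  shows "\<exists>G. \<forall>i\<in>{1,2}. (\<forall>j. (\<lambda>x. G i x $ j) \<in> local_space p K) \<and> (\<forall>x\<in>piece c K i. grad v x = G i x)"
proof -
  obtain v1 v2 where v12: "v1 \<in> Vh p c" "v2 \<in> Vh p c"
    and v_eq: "v = (\<lambda>x. indicator (Sub c 1) x * v1 x + indicator (Sub c 2) x * v2 x)"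
    using v by (auto simp: VhGam_def)
  have "\<exists>G. (\<forall>j. (\<lambda>x. G x $ j) \<in> local_space p K) \<and> (\<forall>x\<in>piece c K i. grad v x = G x)"
    if i: "i \<in> {1,2}" for i
  proof -
    define u where "u = (if i = 1 then v1 else v2)"
    have "u \<in> Vh p c" using v12 by (simp add: u_def)
    then obtain q where q: "q \<in> local_space p K" "\<And>x. x \<in> K \<Longrightarrow> u x = q x"
      using K by (auto simp: Vh_def)
    obtain G where G: "\<And>x. GDERIV q x :> G x" "\<And>j. (\<lambda>x. G x $ j) \<in> local_space p K"
      using local_space_gradient[OF mesh_cells[OF K] q(1)] by blast
    have "v y = q y" if "y \<in> piece c K i" for y
    proof -
      have "y \<in> Sub c i" "y \<in> K" using that piece_subset by blast+
      then show ?thesis using i q(2) Sub_disjoint by (auto simp: v_eq u_def indicator_def)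
    qed
    then have "grad v x = G x" if "x \<in> piece c K i" for x
      using grad_eq[OF piece_open[OF i] that _ G(1)] by blast
    with G(2) show ?thesis by blast
  qed
  then have "\<forall>i\<in>{1,2}. \<exists>G. (\<forall>j. (\<lambda>x. G x $ j) \<in> local_space p K) \<and> (\<forall>x\<in>piece c K i. grad v x = G x)"
    by blast
  then show ?thesis by (rule bchoice)
qed

lemma continuous_on_local_components:
  assumes "K \<in> Mesh c" "\<And>j. (\<lambda>x. f x $ j) \<in> local_space p K"
  shows "continuous_on X f"
proof -
  have "f = (\<lambda>x. \<chi> j. f x $ j)" by simp
  then show ?thesis
    using continuous_on_vec_lambda[of X "\<lambda>j x. f x $ j"] continuous_on_local_space[OF mesh_cells] assms by metis
qed

lemma piece_extensionI:
  assumes "K \<in> Mesh c" "\<forall>i\<in>{1,2}. (\<forall>j. (\<lambda>x. f i x $ j) \<in> local_space p K) \<and> (\<forall>x\<in>piece c K i. w x = f i x)"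
  shows "piece_extension K f w"
  unfolding piece_extension_def
proof
  fix i assume i: "i \<in> {1,2::nat}"
  then have "continuous_on UNIV (f i)"
    using assms(2) by (intro continuous_on_local_components[OF assms(1), of _ p]) blast
  then show "continuous_on UNIV (f i) \<and> (\<forall>x\<in>piece c K i. w x = f i x)"
    using assms(2) i by blast
qed

lemma avg_cong:
  assumes "piece_extension K f w" "piece_extension K f u"
  shows "avg c0 c K w x = avg c0 c K u x"
  by (simp add: avg_eq[OF assms(1)] avg_eq[OF assms(2)])

section \<open>The broken polynomial space of a cut cell\<close>

text \<open>
  The componentwise description of $W_K$ repackaged as one polynomial vector field per piece, which is the form in which
  traces and gradients appear.
\<close>

lemma WK_iff:
  "w \<in> WK p c K \<longleftrightarrow> (\<exists>f. \<forall>i\<in>{1,2}. (\<forall>j. (\<lambda>x. f i x $ j) \<in> local_space p K) \<and> (\<forall>x\<in>piece c K i. w x = f i x)) \<and>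
    (\<forall>x. x \<notin> piece c K 1 \<union> piece c K 2 \<longrightarrow> w x = 0)"
    (is "_ \<longleftrightarrow> ?ext \<and> ?zero")
proof
  assume w: "w \<in> WK p c K"
  then have "\<forall>i\<in>{1,2}. \<forall>j. \<exists>q. q \<in> local_space p K \<and> (\<forall>x\<in>piece c K i. w x $ j = q x)"
    unfolding WK_def by blast
  then obtain q where q: "\<And>i j. i \<in> {1,2} \<Longrightarrow> q i j \<in> local_space p K"
    "\<And>i j x. i \<in> {1,2} \<Longrightarrow> x \<in> piece c K i \<Longrightarrow> w x $ j = q i j x"
    by metis
  have ?ext
    by (rule exI[of _ "\<lambda>i x. \<chi> j. q i j x"]) (use q in \<open>auto simp: vec_eq_iff\<close>)
  then show "?ext \<and> ?zero" using w by (simp add: WK_def)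
next
  assume "?ext \<and> ?zero"
  then have z: ?zero
    and "\<exists>f. \<forall>i\<in>{1,2}. (\<forall>j. (\<lambda>x. f i x $ j) \<in> local_space p K) \<and> (\<forall>x\<in>piece c K i. w x = f i x)"
    by (rule conjunct2, rule conjunct1)
  then obtain f where "\<forall>i\<in>{1,2}. (\<forall>j. (\<lambda>x. f i x $ j) \<in> local_space p K) \<and> (\<forall>x\<in>piece c K i. w x = f i x)"
    by (elim exE)
  then have f: "\<And>i j. i \<in> {1,2} \<Longrightarrow> (\<lambda>x. f i x $ j) \<in> local_space p K"
    "\<And>i x. i \<in> {1,2} \<Longrightarrow> x \<in> piece c K i \<Longrightarrow> w x = f i x" by blast+
  have "\<exists>q\<in>local_space p K. \<forall>x\<in>piece c K i. w x $ j = q x" if "i \<in> {1,2}" for i j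
    by (rule bexI[of _ "\<lambda>x. f i x $ j"]) (use f that in auto)
  then show "w \<in> WK p c K" using z by (simp add: WK_def)
qed

lemma WK_lincomb:
  assumes K: "K \<in> Mesh c" and "u \<in> WK p c K" "w \<in> WK p c K"
  shows "(\<lambda>x. s *\<^sub>R u x + t *\<^sub>R w x) \<in> WK p c K"
proof -
  obtain f where f: "\<forall>i\<in>{1,2}. (\<forall>j. (\<lambda>x. f i x $ j) \<in> local_space p K) \<and> (\<forall>x\<in>piece c K i. u x = f i x)"
    using WK_iff[THEN iffD1, THEN conjunct1, OF assms(2)] by (elim exE)
  obtain g where g: "\<forall>i\<in>{1,2}. (\<forall>j. (\<lambda>x. g i x $ j) \<in> local_space p K) \<and> (\<forall>x\<in>piece c K i. w x = g i x)"
    using WK_iff[THEN iffD1, THEN conjunct1, OF assms(3)] by (elim exE)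
  have "\<forall>i\<in>{1,2}. (\<forall>j. (\<lambda>x. (s *\<^sub>R f i x + t *\<^sub>R g i x) $ j) \<in> local_space p K) \<and>
      (\<forall>x\<in>piece c K i. s *\<^sub>R u x + t *\<^sub>R w x = s *\<^sub>R f i x + t *\<^sub>R g i x)"
    using f g local_space_lincomb[OF mesh_cells[OF K]] by simp
  moreover have "\<forall>x. x \<notin> piece c K 1 \<union> piece c K 2 \<longrightarrow> s *\<^sub>R u x + t *\<^sub>R w x = 0"
    using assms(2,3) unfolding WK_iff by simp
  ultimately show ?thesis
    unfolding WK_iff by (intro conjI exI[of _ "\<lambda>i x. s *\<^sub>R f i x + t *\<^sub>R g i x"])
qed

lemma WK_glue:
  assumes "\<And>i j. i \<in> {1,2} \<Longrightarrow> (\<lambda>x. f i x $ j) \<in> local_space p K"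
  shows "(\<lambda>x. \<Sum>i\<in>{1,2}. indicator (piece c K i) x *\<^sub>R f i x) \<in> WK p c K"
  unfolding WK_iff
proof (intro conjI exI[of _ f] ballI allI impI)
  fix i x assume "i \<in> {1,2::nat}" "x \<in> piece c K i"
  then show "(\<Sum>i\<in>{1,2}. indicator (piece c K i) x *\<^sub>R f i x) = f i x"
    using piece_disjoint[of K K] by (auto simp: indicator_def)
next
  fix x assume "x \<notin> piece c K 1 \<union> piece c K 2"
  then show "(\<Sum>i\<in>{1,2}. indicator (piece c K i) x *\<^sub>R f i x) = 0"
    by (intro sum.neutral) auto
qed (rule assms)

lemma WK_zero: "K \<in> Mesh c \<Longrightarrow> (\<lambda>x. 0) \<in> WK p c K"
  using WK_glue[of "\<lambda>i x. 0" p K] local_space_zero[OF mesh_cells] by simp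

lemma WK_piece_extension:
  assumes "K \<in> Mesh c" "w \<in> WK p c K"
  shows "\<exists>f. piece_extension K f w"
  using WK_iff[THEN iffD1, THEN conjunct1, OF assms(2)] piece_extensionI[OF assms(1)] by blast

lemma WK_outside:
  assumes "w \<in> WK p c K" "x \<notin> piece c K 1 \<union> piece c K 2"
  shows "w x = 0"
  using assms unfolding WK_iff by blast

lemma WK_bounded_measurable:
  assumes K: "K \<in> Mesh c" and w: "w \<in> WK p c K"
  shows "bounded_measurable_on lebesgue K w"
proof -
  obtain f where f: "piece_extension K f w" using WK_piece_extension[OF assms] by blast
  have "bounded_measurable_on lebesgue K (\<lambda>x. if x \<in> piece c K i then f i x else 0)" if i: "i \<in> {1,2}" for i
    using f i cell_lmeasurable[OF K] piece_sets[OF i, of K]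
    by (intro bounded_measurable_on_if bounded_measurable_continuous_lebesgue[OF K])
      (auto simp: piece_extension_def)
  from bounded_measurable_on_add[OF this[of 1] this[of 2]]
  have "bounded_measurable_on lebesgue K
      (\<lambda>x. (if x \<in> piece c K 1 then f 1 x else 0) + (if x \<in> piece c K 2 then f 2 x else 0))"
    by simp
  then show ?thesis
  proof (rule bounded_measurable_on_cong)
    fix x
    show "(if x \<in> piece c K 1 then f 1 x else 0) + (if x \<in> piece c K 2 then f 2 x else 0) = w x"
      using f WK_outside[OF w, of x] piece_disjoint[of K K] by (auto simp: piece_extension_def)
  qed
qed

lemma WK_weighted:
  assumes "w \<in> WK p c K"
  shows "(indicator (Dom c) x * coef c x) *\<^sub>R w x = coef c x *\<^sub>R w x"
proof (cases "x \<in> Dom c")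
  case False
  then have "x \<notin> piece c K 1 \<union> piece c K 2" using piece_subset(2) Sub_subset_Dom by blast
  then show ?thesis using WK_outside[OF assms] by simp
qed simp

lemma WK_weighted_bounded_measurable:
  assumes K: "K \<in> Mesh c" and w: "w \<in> WK p c K"
  shows "bounded_measurable_on lebesgue K (\<lambda>x. coef c x *\<^sub>R w x)"
  using bounded_measurable_on_scaleR[OF bounded_measurable_coef[OF _ emeasure_cell_finite[OF K]]
      WK_bounded_measurable[OF K w]] cell_lmeasurable[OF K]
  by (simp add: WK_weighted[OF w])

text \<open>
  A spanning family is obtained by combining the two pieces, the coordinate directions and a spanning family of the local
  space.
\<close>

lemma WK_finite_span:
  assumes K: "K \<in> Mesh c"
  shows "\<exists>(I :: (nat \<times> 'n \<times> ('n \<Rightarrow> nat)) set) e. finite I \<and> (\<forall>i\<in>I. e i \<in> WK p c K) \<and>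
    (\<forall>w\<in>WK p c K. \<exists>b. w = (\<lambda>x. \<Sum>i\<in>I. b i *\<^sub>R e i x))"
proof -
  obtain S :: "('n \<Rightarrow> nat) set" and m where S: "finite S"
    and span: "local_space p K = {q. \<exists>a. q = (\<lambda>x. \<Sum>s\<in>S. a s * m s x)}"
    using local_space_finite_span[OF mesh_cells[OF K], of p] by blast
  have m: "m s \<in> local_space p K" if "s \<in> S" for s
  proof -
    have "m s = (\<lambda>x. \<Sum>s'\<in>S. (if s' = s then 1 else 0) * m s' x)"
      using S that by (simp add: if_distrib[of "\<lambda>z. z * _"] sum.delta cong: if_cong)
    then show ?thesis
      unfolding span by (intro CollectI exI[of _ "\<lambda>s'. if s' = s then 1 else 0"])
  qed
  define I where "I = {1,2::nat} \<times> (UNIV :: 'n set) \<times> S"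
  define e where "e = (\<lambda>(i, j, s) x. (indicator (piece c K i) x * m s x) *\<^sub>R (axis j 1 :: real^'n))"
  have "finite I" using S by (simp add: I_def)
  moreover have "e \<iota> \<in> WK p c K" if \<iota>: "\<iota> \<in> I" for \<iota>
  proof -
    obtain i j s where ijs: "\<iota> = (i, j, s)" "i \<in> {1,2}" "s \<in> S" using \<iota> by (auto simp: I_def)
    define f where "f i' x = (if i' = i then m s x else 0) *\<^sub>R (axis j 1 :: real^'n)" for i' :: nat and x
    have "(\<lambda>x. f i' x $ l) \<in> local_space p K" for i' l
      using m[OF ijs(3)] local_space_zero[OF mesh_cells[OF K], of p]
      by (cases "i' = i"; cases "l = j") (simp_all add: f_def axis_def)
    from WK_glue[of f p K, OF this]
    show ?thesis
      by (rule back_subst[of "\<lambda>u. u \<in> WK p c K"]) (use ijs in \<open>auto simp: fun_eq_iff e_def f_def\<close>)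
  qed
  moreover have "\<exists>b. w = (\<lambda>x. \<Sum>i\<in>I. b i *\<^sub>R e i x)" if w: "w \<in> WK p c K" for w
  proof -
    obtain f where "\<forall>i\<in>{1,2}. (\<forall>j. (\<lambda>x. f i x $ j) \<in> local_space p K) \<and> (\<forall>x\<in>piece c K i. w x = f i x)"
      using WK_iff[THEN iffD1, THEN conjunct1, OF w] by (elim exE)
    then have f: "\<And>i j. i \<in> {1,2} \<Longrightarrow> (\<lambda>x. f i x $ j) \<in> local_space p K"
      "\<And>i x. i \<in> {1,2} \<Longrightarrow> x \<in> piece c K i \<Longrightarrow> w x = f i x" by blast+
    have "\<forall>i\<in>{1,2}. \<forall>j. \<exists>a. (\<lambda>x. f i x $ j) = (\<lambda>x. \<Sum>s\<in>S. a s * m s x)"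
      using f(1) unfolding span by blast
    then obtain a where a: "\<And>i j. i \<in> {1,2} \<Longrightarrow> (\<lambda>x. f i x $ j) = (\<lambda>x. \<Sum>s\<in>S. a i j s * m s x)"
      by metis
    define b where "b = (\<lambda>(i, j, s). a i j s)"
    have "w x = (\<Sum>\<iota>\<in>I. b \<iota> *\<^sub>R e \<iota> x)" for x
    proof -
      have w_eq: "w x = (\<Sum>i\<in>{1,2}. indicator (piece c K i) x *\<^sub>R f i x)"
        using f(2) WK_outside[OF w, of x] piece_disjoint[of K K] by (auto simp: indicator_def)
      have f_eq: "f i x = (\<Sum>j\<in>UNIV. \<Sum>s\<in>S. (a i j s * m s x) *\<^sub>R axis j 1)" if "i \<in> {1,2}" for i
        using basis_expansion[of "f i x"] fun_cong[OF a[OF that]]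
        by (simp add: scaleR_sum_left scalar_mult_eq_scaleR)
      have "(\<Sum>\<iota>\<in>I. b \<iota> *\<^sub>R e \<iota> x)
          = (\<Sum>i\<in>{1,2}. \<Sum>j\<in>UNIV. \<Sum>s\<in>S. (a i j s * (indicator (piece c K i) x * m s x)) *\<^sub>R axis j 1)"
      proof -
        have "(\<Sum>\<iota>\<in>I. b \<iota> *\<^sub>R e \<iota> x)
            = (\<Sum>(i, j, s)\<in>I. (a i j s * (indicator (piece c K i) x * m s x)) *\<^sub>R axis j 1)"
          by (rule sum.cong) (auto simp: b_def e_def)
        then show ?thesis unfolding I_def by (simp only: sum.cartesian_product)
      qed
      also have "\<dots> = (\<Sum>i\<in>{1,2}. indicator (piece c K i) x *\<^sub>R f i x)"
        by (intro sum.cong refl) (simp add: f_eq scaleR_sum_right mult_ac)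
      finally show ?thesis unfolding w_eq by simp
    qed
    then show ?thesis by (intro exI[of _ b] ext)
  qed
  ultimately show ?thesis by (intro exI[of _ I] exI[of _ e]) blast
qed

section \<open>The lifting operator\<close>

definition weighted_ip :: "(real^'n) set \<Rightarrow> (real^'n \<Rightarrow> real^'n) \<Rightarrow> (real^'n \<Rightarrow> real^'n) \<Rightarrow> real" where
  "weighted_ip K r w = (LINT x:K|lebesgue. r x \<bullet> (coef c x *\<^sub>R w x))"

lemma weighted_ip_sym: "weighted_ip K u w = weighted_ip K w u"
  by (simp add: weighted_ip_def inner_commute)

context
  fixes K :: "(real^'n) set" and p :: nat
  assumes K: "K \<in> Mesh c"
begin

lemma weighted_ip_linear:
  assumes "u \<in> WK p c K" "v \<in> WK p c K" "w \<in> WK p c K"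
  shows "weighted_ip K (\<lambda>x. s *\<^sub>R u x + t *\<^sub>R v x) w = s * weighted_ip K u w + t * weighted_ip K v w"
  unfolding weighted_ip_def inner_add_left inner_scaleR_left
  by (intro set_integral_lincomb
      bounded_measurable_on_inner[OF WK_bounded_measurable[OF K assms(1)] WK_weighted_bounded_measurable[OF K assms(3)]]
      bounded_measurable_on_inner[OF WK_bounded_measurable[OF K assms(2)] WK_weighted_bounded_measurable[OF K assms(3)]])

text \<open>
  If the weighted square integral vanishes, then \<open>w\<close> vanishes almost everywhere on \<open>K\<close>. On a piece, \<open>w\<close> is continuous and the
  set where it is nonzero is open, and an open null set is empty. This is where the choice of representatives
  vanishing off the open pieces matters.
\<close>

lemma weighted_ip_definite:
  assumes w: "w \<in> WK p c K" and zero: "weighted_ip K w w = 0"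
  shows "w = (\<lambda>x. 0)"
proof -
  have int: "integrable lebesgue (\<lambda>x. indicator K x *\<^sub>R (w x \<bullet> (coef c x *\<^sub>R w x)))"
    using bounded_measurable_on_integrable[OF bounded_measurable_on_inner[OF WK_bounded_measurable[OF K w]
        WK_weighted_bounded_measurable[OF K w]]] by (simp add: set_integrable_def)
  have nonneg: "0 \<le> indicator K x *\<^sub>R (w x \<bullet> (coef c x *\<^sub>R w x))" for x
  proof (cases "x \<in> Dom c")
    case True
    then show ?thesis using coef_bounds(1)[OF True] \<alpha>min_pos by (simp add: indicator_def)
  next
    case False
    then have "coef c x *\<^sub>R w x = 0" using WK_weighted[OF w, of x] by simp
    then show ?thesis by (simp only: inner_zero_right scaleR_zero_right)
  qed
  have "AE x in lebesgue. indicator K x *\<^sub>R (w x \<bullet> (coef c x *\<^sub>R w x)) = 0"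
    using zero integral_nonneg_eq_0_iff_AE[OF int] nonneg
    by (simp add: weighted_ip_def set_lebesgue_integral_def)
  then obtain N where N: "negligible N" "{x. indicator K x *\<^sub>R (w x \<bullet> (coef c x *\<^sub>R w x)) \<noteq> 0} \<subseteq> N"
    unfolding eventually_ae_filter negligible_iff_null_sets by auto
  obtain f where f: "piece_extension K f w" using WK_piece_extension[OF K w] by blast
  have on_piece: "w x = 0" if i: "i \<in> {1,2}" and x: "x \<in> piece c K i" for i x
  proof (rule ccontr)
    assume "w x \<noteq> 0"
    let ?A = "{y \<in> piece c K i. f i y \<noteq> 0}"
    have "?A = piece c K i \<inter> f i -` (- {0})" by auto
    moreover have "open (piece c K i \<inter> f i -` (- {0}))"
      using f i piece_open[OF i, of K] by (intro continuous_open_preimage)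
        (auto simp: piece_extension_def intro: continuous_on_subset)
    moreover have "?A \<subseteq> N"
    proof
      fix y assume "y \<in> ?A"
      then have y: "y \<in> piece c K i" "w y \<noteq> 0" using f i by (auto simp: piece_extension_def)
      then have "y \<in> K" "y \<in> Dom c" using piece_subset Sub_subset_Dom[OF i] by blast+
      then have "coef c y > 0" using coef_bounds(1) \<alpha>min_pos by fastforce
      then show "y \<in> N" using N(2) y \<open>y \<in> K\<close> by (auto simp: indicator_def)
    qed
    moreover have "x \<in> ?A" using x \<open>w x \<noteq> 0\<close> f i by (auto simp: piece_extension_def)
    ultimately show False
      using open_not_negligible[of ?A] negligible_subset[OF N(1)] by auto
  qed
  show ?thesis
  proof
    show "w x = 0" for x using on_piece[of 1 x] on_piece[of 2 x] WK_outside[OF w, of x] by auto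
  qed
qed

text \<open>
  The right-hand side is a linear functional of \<open>w\<close> because averages are linear on fields with continuous extensions, so
  the Riesz argument applies to it; definiteness of the product gives uniqueness.
\<close>

lemma lifting_exists_unique:
  assumes q: "bounded_measurable_on surf (cut K) q"
  shows "\<exists>!r. r \<in> WK p c K \<and> (\<forall>w\<in>WK p c K. weighted_ip K r w = - (LINT x:cut K|surf. q x \<bullet> avg c0 c K w x))"
proof -
  define L where "L w = - (LINT x:cut K|surf. q x \<bullet> avg c0 c K w x)" for w
  have L_linear: "L (\<lambda>x. s *\<^sub>R u x + t *\<^sub>R w x) = s * L u + t * L w"
    if uw: "u \<in> WK p c K" "w \<in> WK p c K" for u w s t
  proof -
    obtain f g where fg: "piece_extension K f u" "piece_extension K g w"
      using WK_piece_extension[OF K] uw by blast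
    show ?thesis
      unfolding L_def avg_lincomb[OF fg] inner_add_right inner_scaleR_right
      using set_integral_lincomb[OF bounded_measurable_on_inner[OF q bounded_measurable_avg[OF K fg(1)]]
          bounded_measurable_on_inner[OF q bounded_measurable_avg[OF K fg(2)]]] by simp
  qed
  obtain I :: "(nat \<times> 'n \<times> ('n \<Rightarrow> nat)) set" and e where I: "finite I" "\<And>i. i \<in> I \<Longrightarrow> e i \<in> WK p c K"
    "\<And>w. w \<in> WK p c K \<Longrightarrow> \<exists>b. w = (\<lambda>x. \<Sum>i\<in>I. b i *\<^sub>R e i x)"
    using WK_finite_span[OF K, of p] by blast
  have "\<exists>a. \<forall>b. (\<lambda>x. \<Sum>i\<in>I. a i *\<^sub>R e i x) \<in> WK p c K \<and>
      weighted_ip K (\<lambda>x. \<Sum>i\<in>I. a i *\<^sub>R e i x) (\<lambda>x. \<Sum>i\<in>I. b i *\<^sub>R e i x) = L (\<lambda>x. \<Sum>i\<in>I. b i *\<^sub>R e i x)"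
    by (rule riesz_finite_span[OF I(1,2) WK_zero[OF K] WK_lincomb[OF K] weighted_ip_linear
        weighted_ip_sym weighted_ip_definite L_linear])
  then obtain a where a: "(\<lambda>x. \<Sum>i\<in>I. a i *\<^sub>R e i x) \<in> WK p c K"
    "\<And>b. weighted_ip K (\<lambda>x. \<Sum>i\<in>I. a i *\<^sub>R e i x) (\<lambda>x. \<Sum>i\<in>I. b i *\<^sub>R e i x) = L (\<lambda>x. \<Sum>i\<in>I. b i *\<^sub>R e i x)"
    by blast
  define r' where "r' = (\<lambda>x. \<Sum>i\<in>I. a i *\<^sub>R e i x)"
  have r': "r' \<in> WK p c K" using a(1) by (simp add: r'_def)
  have r'_eq: "weighted_ip K r' w = L w" if w: "w \<in> WK p c K" for w
  proof -
    obtain b where "w = (\<lambda>x. \<Sum>i\<in>I. b i *\<^sub>R e i x)" using I(3)[OF w] by blast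
    then show ?thesis using a(2)[of b] by (simp add: r'_def)
  qed
  show ?thesis
    unfolding L_def[symmetric]
  proof (rule ex1I[of _ r'])
    show "r' \<in> WK p c K \<and> (\<forall>w\<in>WK p c K. weighted_ip K r' w = L w)"
      using r' r'_eq by blast
    fix r assume r: "r \<in> WK p c K \<and> (\<forall>w\<in>WK p c K. weighted_ip K r w = L w)"
    define d where "d = (\<lambda>x. 1 *\<^sub>R r x + (-1) *\<^sub>R r' x)"
    have d: "d \<in> WK p c K" unfolding d_def using r r' by (intro WK_lincomb[OF K]) auto
    have "weighted_ip K (\<lambda>x. 1 *\<^sub>R r x + (-1) *\<^sub>R r' x) d = 1 * weighted_ip K r d + (-1) * weighted_ip K r' d"
      using r r' d by (intro weighted_ip_linear) auto
    then have "weighted_ip K d d = 0"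
      unfolding d_def[symmetric] using r r'_eq d by simp
    then have "d = (\<lambda>x. 0)" by (rule weighted_ip_definite[OF d])
    then show "r = r'" by (simp add: d_def fun_eq_iff)
  qed
qed

lemma lifting_properties:
  assumes q: "bounded_measurable_on surf (cut K) q"
  shows "lifting c0 p c K q \<in> WK p c K"
    "w \<in> WK p c K \<Longrightarrow> weighted_ip K (lifting c0 p c K q) w = - (LINT x:cut K|surf. q x \<bullet> avg c0 c K w x)"
  using theI'[OF lifting_exists_unique[OF q, of c0]]
  unfolding lifting_def weighted_ip_def by auto

end

section \<open>The energy of the pieces\<close>

definition piece_energy :: "(real^'n \<Rightarrow> real) \<Rightarrow> (real^'n) set \<Rightarrow> real" where
  "piece_energy v K = (\<Sum>i\<in>{1,2}. LINT x:piece c K i|lebesgue. coef c x * (norm (grad v x))\<^sup>2)"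

lemma bounded_measurable_energy_density:
  assumes K: "K \<in> Mesh c" and i: "i \<in> {1,2}" and v: "v \<in> VhGam p c"
  shows "bounded_measurable_on lebesgue (piece c K i) (\<lambda>x. coef c x * (norm (grad v x))\<^sup>2)"
proof -
  obtain G where G: "\<forall>i\<in>{1,2}. (\<forall>j. (\<lambda>x. G i x $ j) \<in> local_space p K) \<and> (\<forall>x\<in>piece c K i. grad v x = G i x)"
    using gradient_on_pieces[OF K v] by (elim exE)
  then have "continuous_on UNIV (G i)"
    using i by (intro continuous_on_local_components[OF K, of _ p]) blast
  from bounded_measurable_continuous_lebesgue[OF K piece_sets[OF i] piece_subset(1) this]
  have "bounded_measurable_on lebesgue (piece c K i) (\<lambda>x. (indicator (Dom c) x * coef c x) *\<^sub>R (norm (G i x))\<^sup>2)"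
    by (intro bounded_measurable_on_scaleR bounded_measurable_on_norm_sq
        bounded_measurable_coef[OF piece_sets[OF i] emeasure_piece_finite[OF K i]])
  then show ?thesis
  proof (rule bounded_measurable_on_cong)
    fix x assume x: "x \<in> piece c K i"
    then have "x \<in> Dom c" using piece_subset(2) Sub_subset_Dom[OF i] by blast
    then show "(indicator (Dom c) x * coef c x) *\<^sub>R (norm (G i x))\<^sup>2 = coef c x * (norm (grad v x))\<^sup>2"
      using bspec[OF G i] x by simp
  qed
qed

lemma energy_density_nonneg:
  assumes "i \<in> {1,2}" "x \<in> Sub c i"
  shows "0 \<le> coef c x * (norm (grad v x))\<^sup>2"
  using assms coef_bounds(1)[of x] \<alpha>min_pos Sub_subset_Dom[OF assms(1)] by (force intro!: mult_nonneg_nonneg)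

lemma piece_energy_nonneg: "0 \<le> piece_energy v K"
  unfolding piece_energy_def
proof (intro sum_nonneg set_integral_nonneg_real)
  fix i x assume "i \<in> {1,2::nat}" "x \<in> piece c K i"
  then show "0 \<le> coef c x * (norm (grad v x))\<^sup>2"
    using piece_subset(2) by (intro energy_density_nonneg[of i]) auto
qed

text \<open>
  The open pieces exhaust the two subdomains up to the boundaries of the cells, which are null sets because cells are convex.
  On these null sets nothing is known about the gradient, but there any function is integrable with integral zero.
\<close>

lemma energy_eq_sum_pieces:
  assumes v: "v \<in> VhGam p c"
  shows "energy_sq c v = (\<Sum>K\<in>Mesh c. piece_energy v K)"
proof -
  define I where "I = Mesh c \<times> {1,2::nat}"
  define P where "P = (\<lambda>(K, i). piece c K i)"
  define N where "N = (Sub c 1 \<union> Sub c 2) - (\<Union>k\<in>I. P k)"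
  let ?f = "\<lambda>x. coef c x * (norm (grad v x))\<^sup>2"
  have I: "finite I" using finite_Mesh by (simp add: I_def)
  have P_sets: "P k \<in> sets lebesgue" if "k \<in> I" for k
    using that piece_sets by (auto simp: I_def P_def)
  have P_int: "set_integrable lebesgue (P k) ?f" if "k \<in> I" for k
    using that bounded_measurable_energy_density[OF _ _ v]
    by (intro bounded_measurable_on_integrable) (auto simp: I_def P_def)
  have disj: "disjoint_family_on P I"
  proof (unfold disjoint_family_on_def, intro ballI impI)
    fix k l assume kl: "k \<in> I" "l \<in> I" "k \<noteq> l"
    obtain K i K' i' where eq: "k = (K, i)" "l = (K', i')" by (metis surj_pair)
    have mem: "K \<in> Mesh c" "K' \<in> Mesh c" "i \<in> {1,2}" "i' \<in> {1,2}" using kl by (auto simp: I_def eq)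
    show "P k \<inter> P l = {}"
    proof (cases "K = K'")
      case True
      then have "i \<noteq> i'" using kl by (simp add: eq)
      then show ?thesis
        using mem piece_disjoint[of K K'] piece_disjoint[of K' K] by (auto simp: P_def eq)
    next
      case False
      then show ?thesis
        using cell_interiors_disjoint[OF mem(1,2)] by (auto simp: P_def eq piece_def)
    qed
  qed
  have negl: "negligible N"
  proof (rule negligible_subset)
    show "negligible (\<Union>K\<in>Mesh c. frontier K)"
      using finite_Mesh cell_compact_convex(2)
      by (intro negligible_Union) (auto intro: negligible_convex_frontier)
    show "N \<subseteq> (\<Union>K\<in>Mesh c. frontier K)"
    proof
      fix x assume x: "x \<in> N"
      then obtain i where i: "i \<in> {1,2}" "x \<in> Sub c i" by (auto simp: N_def)
      then have "x \<in> \<Union>(Mesh c)"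
        using Sub_subset_Dom[OF i(1)] closure_subset by (auto simp: Union_Mesh)
      then obtain K where K: "K \<in> Mesh c" "x \<in> K" by blast
      moreover have "x \<notin> interior K"
        using x i K by (force simp: N_def I_def P_def piece_def)
      ultimately show "x \<in> (\<Union>K\<in>Mesh c. frontier K)"
        using closure_subset by (auto simp: frontier_def)
    qed
  qed
  have N_int: "set_integrable lebesgue N ?f" by (rule absolutely_integrable_negligible[OF negl])
  have "Sub c 1 \<union> Sub c 2 = (\<Union>k\<in>I. P k) \<union> N"
    using piece_subset(2) by (force simp: N_def I_def P_def)
  then have "energy_sq c v = (LINT x:(\<Union>k\<in>I. P k) \<union> N|lebesgue. ?f x)"
    by (simp add: energy_sq_def)
  also have "\<dots> = (LINT x:(\<Union>k\<in>I. P k)|lebesgue. ?f x) + (LINT x:N|lebesgue. ?f x)"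
    by (intro set_integral_Un set_integrable_UN I P_int P_sets N_int) (auto simp: N_def)
  also have "(LINT x:N|lebesgue. ?f x) = 0"
    by (simp add: set_lebesgue_integral_eq_integral(2)[OF N_int] integral_negligible[OF negl])
  also have "(LINT x:(\<Union>k\<in>I. P k)|lebesgue. ?f x) = (\<Sum>k\<in>I. LINT x:P k|lebesgue. ?f x)"
    by (rule set_integral_finite_Union[OF I disj P_int P_sets])
  also have "\<dots> = (\<Sum>K\<in>Mesh c. piece_energy v K)"
    unfolding I_def P_def piece_energy_def sum.cartesian_product by (simp add: case_prod_beta')
  finally show ?thesis by simp
qed

lemma sum_cut_energy_le:
  assumes v: "v \<in> VhGam p c"
  shows "(\<Sum>K\<in>cut_cells c. piece_energy v K) \<le> energy_sq c v"
  unfolding energy_eq_sum_pieces[OF v]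
  by (rule sum_mono2[OF finite_Mesh cut_cells_subset piece_energy_nonneg])

section \<open>The flux average is controlled by the energy\<close>

text \<open>
  The trace inequality carries the weight $\kappa_i^{1/2}$ while the average carries $\kappa_i$; since
  $0 \le \kappa_i \le 1$, one power of $\kappa_i$ can be dropped from the square of the average. The inequality is then
  applied to each component of the gradient on each piece.
\<close>

lemma avg_gradient_trace_bound:
  assumes K: "K \<in> Mesh c" and v: "v \<in> VhGam p c"
    and trace: "\<And>i q. i \<in> {1,2} \<Longrightarrow> q \<in> poly_total (CARD('n) * p) \<Longrightarrow>
      L2norm surf (cut K) (\<lambda>x. sqrt (kappa c0 c K i) * q x)
        \<le> C / sqrt (diameter K) * L2norm lebesgue (piece c K i) q"
  shows "diameter K * (L2norm surf (cut K) (avg c0 c K (grad v)))\<^sup>2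
    \<le> (2 * \<alpha>max\<^sup>2 * C\<^sup>2 / \<alpha>min) * piece_energy v K"
proof -
  let ?h = "diameter K"
  have h: "?h > 0" by (rule cell_diameter_pos[OF K])
  obtain G where G: "\<forall>i\<in>{1,2}. (\<forall>j. (\<lambda>x. G i x $ j) \<in> local_space p K) \<and> (\<forall>x\<in>piece c K i. grad v x = G i x)"
    using gradient_on_pieces[OF K v] by (elim exE)
  have ext: "piece_extension K G (grad v)" by (rule piece_extensionI[OF K G])
  have comp: "(\<lambda>x. G i x $ j) \<in> local_space p K" if "i \<in> {1,2}" for i j using G that by blast
  have comp_cont: "continuous_on X (\<lambda>x. G i x $ j)" if "i \<in> {1,2}" for i j X
    by (rule continuous_on_local_space[OF mesh_cells[OF K] comp[OF that]])
  define F where "F i j x = (norm (sqrt (kappa c0 c K i) * G i x $ j))\<^sup>2" for i j x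
  have bmF: "bounded_measurable_on surf (cut K) (F i j)" if "i \<in> {1,2}" for i j
    unfolding F_def
    by (intro bounded_measurable_on_norm_sq bounded_measurable_continuous_surf[OF K]
        continuous_intros comp_cont[OF that])
  have norm_sq: "(norm y)\<^sup>2 = (\<Sum>j\<in>UNIV. (y $ j)\<^sup>2)" for y :: "real^'n"
    unfolding power2_norm_eq_inner by (simp add: inner_vec_def power2_eq_square)
  have pointwise: "(norm (avg c0 c K (grad v) x))\<^sup>2 \<le> (\<Sum>i\<in>{1,2}. \<Sum>j\<in>UNIV. 2 * \<alpha>max\<^sup>2 * F i j x)"
    if x: "x \<in> cut K" for x
  proof -
    define a where "a i = (kappa c0 c K i * coef_tr c i x) *\<^sub>R (if x islimpt piece c K i then G i x else 0)" for i
    have a_le: "(norm (a i))\<^sup>2 \<le> (\<Sum>j\<in>UNIV. \<alpha>max\<^sup>2 * F i j x)" if i: "i \<in> {1,2}" for i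
    proof -
      note \<kappa> = kappa_range[OF K i, of c0]
      have tr: "0 \<le> coef_tr c i x" "coef_tr c i x \<le> \<alpha>max" using coef_tr_bounds[OF i] x by auto
      have "(kappa c0 c K i * coef_tr c i x)\<^sup>2 \<le> kappa c0 c K i * \<alpha>max\<^sup>2"
        unfolding power_mult_distrib
        using \<kappa> tr by (intro mult_mono power_mono) (auto simp: power2_eq_square mult_left_le)
      then have "(norm (a i))\<^sup>2 \<le> (kappa c0 c K i * \<alpha>max\<^sup>2) * (norm (G i x))\<^sup>2"
        using \<kappa> by (auto simp: a_def power_mult_distrib intro!: mult_right_mono mult_nonneg_nonneg)
      also have "\<dots> = (\<Sum>j\<in>UNIV. \<alpha>max\<^sup>2 * F i j x)"
        using \<kappa> by (simp add: norm_sq F_def sum_distrib_left power_mult_distrib mult_ac)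
      finally show ?thesis .
    qed
    have "avg c0 c K (grad v) x = a 1 + a 2" unfolding avg_eq[OF ext] a_def by simp
    moreover have "(norm (a 1 + a 2))\<^sup>2 \<le> 2 * (norm (a 1))\<^sup>2 + 2 * (norm (a 2))\<^sup>2"
    proof -
      have "0 \<le> (norm (a 1 - a 2))\<^sup>2" by simp
      then show ?thesis
        by (simp add: power2_norm_eq_inner inner_add inner_diff inner_commute)
    qed
    moreover have "(\<Sum>i\<in>{1,2}. \<Sum>j\<in>UNIV. 2 * \<alpha>max\<^sup>2 * F i j x)
        = 2 * (\<Sum>j\<in>UNIV. \<alpha>max\<^sup>2 * F 1 j x) + 2 * (\<Sum>j\<in>UNIV. \<alpha>max\<^sup>2 * F 2 j x)"
      by (simp add: sum_distrib_left mult.assoc del: One_nat_def)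
    ultimately show ?thesis
      using a_le[of 1] a_le[of 2] by simp
  qed
  have piece_bound: "(\<Sum>j\<in>UNIV. LINT x:cut K|surf. F i j x) \<le>
      C\<^sup>2 / (?h * \<alpha>min) * (LINT x:piece c K i|lebesgue. coef c x * (norm (grad v x))\<^sup>2)"
    if i: "i \<in> {1,2}" for i
  proof -
    have Q: "bounded_measurable_on lebesgue (piece c K i) (\<lambda>x. (norm (G i x $ j))\<^sup>2)" for j
      by (intro bounded_measurable_on_norm_sq comp_cont[OF i]
          bounded_measurable_continuous_lebesgue[OF K piece_sets[OF i] piece_subset(1)])
    have Q_sum: "bounded_measurable_on lebesgue (piece c K i) (\<lambda>x. \<Sum>j\<in>UNIV. (norm (G i x $ j))\<^sup>2) \<and>
        (LINT x:piece c K i|lebesgue. \<Sum>j\<in>UNIV. (norm (G i x $ j))\<^sup>2)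
          = (\<Sum>j\<in>UNIV. LINT x:piece c K i|lebesgue. (norm (G i x $ j))\<^sup>2)"
      by (rule set_integral_finite_sum[OF _ piece_sets[OF i] emeasure_piece_finite[OF K i] Q]) simp
    have each: "(LINT x:cut K|surf. F i j x) \<le> C\<^sup>2 / ?h * (LINT x:piece c K i|lebesgue. (norm (G i x $ j))\<^sup>2)" for j
    proof -
      have "L2norm surf (cut K) (\<lambda>x. sqrt (kappa c0 c K i) * G i x $ j)
          \<le> C / sqrt ?h * L2norm lebesgue (piece c K i) (\<lambda>x. G i x $ j)"
        using comp[OF i] local_space_subset_poly_total[OF mesh_cells[OF K]] by (intro trace[OF i]) blast
      moreover have "0 \<le> L2norm surf (cut K) (\<lambda>x. sqrt (kappa c0 c K i) * G i x $ j)"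
        unfolding L2norm_def by (intro real_sqrt_ge_zero set_integral_nonneg_real) simp
      ultimately have "(L2norm surf (cut K) (\<lambda>x. sqrt (kappa c0 c K i) * G i x $ j))\<^sup>2
          \<le> (C / sqrt ?h * L2norm lebesgue (piece c K i) (\<lambda>x. G i x $ j))\<^sup>2"
        by (rule power_mono)
      then show ?thesis
        using h unfolding power_mult_distrib power_divide L2norm_sq by (simp add: F_def)
    qed
    have "(\<Sum>j\<in>UNIV. LINT x:piece c K i|lebesgue. (norm (G i x $ j))\<^sup>2)
        = (LINT x:piece c K i|lebesgue. \<Sum>j\<in>UNIV. (norm (G i x $ j))\<^sup>2)"
      using Q_sum by simp
    also have "\<dots> \<le> (LINT x:piece c K i|lebesgue. (1 / \<alpha>min) * (coef c x * (norm (grad v x))\<^sup>2))"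
    proof (rule set_integral_mono)
      show "set_integrable lebesgue (piece c K i) (\<lambda>x. \<Sum>j\<in>UNIV. (norm (G i x $ j))\<^sup>2)"
        using Q_sum by (intro bounded_measurable_on_integrable) blast
      show "set_integrable lebesgue (piece c K i) (\<lambda>x. (1 / \<alpha>min) * (coef c x * (norm (grad v x))\<^sup>2))"
        using bounded_measurable_energy_density[OF K i v]
        by (intro set_integrable_mult_right bounded_measurable_on_integrable) auto
      fix x assume x: "x \<in> piece c K i"
      then have "x \<in> Dom c" using piece_subset(2) Sub_subset_Dom[OF i] by blast
      then have "(norm (grad v x))\<^sup>2 \<le> (1 / \<alpha>min) * (coef c x * (norm (grad v x))\<^sup>2)"
        using coef_bounds(1) \<alpha>min_pos by (simp add: field_simps mult_right_mono)
      then show "(\<Sum>j\<in>UNIV. (norm (G i x $ j))\<^sup>2) \<le> (1 / \<alpha>min) * (coef c x * (norm (grad v x))\<^sup>2)"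
        using bspec[OF G i] x by (simp add: norm_sq)
    qed
    finally have energy: "(\<Sum>j\<in>UNIV. LINT x:piece c K i|lebesgue. (norm (G i x $ j))\<^sup>2)
        \<le> (LINT x:piece c K i|lebesgue. (1 / \<alpha>min) * (coef c x * (norm (grad v x))\<^sup>2))" .
    have "(\<Sum>j\<in>UNIV. LINT x:cut K|surf. F i j x)
        \<le> C\<^sup>2 / ?h * (\<Sum>j\<in>UNIV. LINT x:piece c K i|lebesgue. (norm (G i x $ j))\<^sup>2)"
      unfolding sum_distrib_left by (intro sum_mono each)
    also have "\<dots> \<le> C\<^sup>2 / ?h * (LINT x:piece c K i|lebesgue. (1 / \<alpha>min) * (coef c x * (norm (grad v x))\<^sup>2))"
      using h by (intro mult_left_mono energy) auto
    also have "\<dots> = C\<^sup>2 / (?h * \<alpha>min) * (LINT x:piece c K i|lebesgue. coef c x * (norm (grad v x))\<^sup>2)"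
      by simp
    finally show ?thesis .
  qed
  have F_sum: "bounded_measurable_on surf (cut K) (\<lambda>x. \<Sum>j\<in>UNIV. 2 * \<alpha>max\<^sup>2 * F i j x)"
    "(LINT x:cut K|surf. \<Sum>j\<in>UNIV. 2 * \<alpha>max\<^sup>2 * F i j x) = 2 * \<alpha>max\<^sup>2 * (\<Sum>j\<in>UNIV. LINT x:cut K|surf. F i j x)"
    if i: "i \<in> {1,2}" for i
  proof -
    have "bounded_measurable_on surf (cut K) (\<lambda>x. (2 * \<alpha>max\<^sup>2) *\<^sub>R F i j x)" for j
      by (intro bounded_measurable_on_scaleR bounded_measurable_on_const cut_sets[OF K]
          emeasure_cut_finite[OF K] bmF i)
    then have bm: "bounded_measurable_on surf (cut K) (\<lambda>x. 2 * \<alpha>max\<^sup>2 * F i j x)" for j by simp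
    have "bounded_measurable_on surf (cut K) (\<lambda>x. \<Sum>j\<in>UNIV. 2 * \<alpha>max\<^sup>2 * F i j x) \<and>
        (LINT x:cut K|surf. \<Sum>j\<in>UNIV. 2 * \<alpha>max\<^sup>2 * F i j x) = (\<Sum>j\<in>UNIV. LINT x:cut K|surf. 2 * \<alpha>max\<^sup>2 * F i j x)"
      by (rule set_integral_finite_sum[OF _ cut_sets[OF K] emeasure_cut_finite[OF K] bm]) simp
    then show "bounded_measurable_on surf (cut K) (\<lambda>x. \<Sum>j\<in>UNIV. 2 * \<alpha>max\<^sup>2 * F i j x)"
      "(LINT x:cut K|surf. \<Sum>j\<in>UNIV. 2 * \<alpha>max\<^sup>2 * F i j x) = 2 * \<alpha>max\<^sup>2 * (\<Sum>j\<in>UNIV. LINT x:cut K|surf. F i j x)"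
      by (simp_all add: sum_distrib_left)
  qed
  have total: "bounded_measurable_on surf (cut K) (\<lambda>x. \<Sum>i\<in>{1,2}. \<Sum>j\<in>UNIV. 2 * \<alpha>max\<^sup>2 * F i j x) \<and>
      (LINT x:cut K|surf. \<Sum>i\<in>{1,2}. \<Sum>j\<in>UNIV. 2 * \<alpha>max\<^sup>2 * F i j x)
        = (\<Sum>i\<in>{1,2}. LINT x:cut K|surf. \<Sum>j\<in>UNIV. 2 * \<alpha>max\<^sup>2 * F i j x)"
    by (rule set_integral_finite_sum[OF _ cut_sets[OF K] emeasure_cut_finite[OF K] F_sum(1)]) auto
  have "(L2norm surf (cut K) (avg c0 c K (grad v)))\<^sup>2
      \<le> (LINT x:cut K|surf. \<Sum>i\<in>{1,2}. \<Sum>j\<in>UNIV. 2 * \<alpha>max\<^sup>2 * F i j x)"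
    unfolding L2norm_sq
    by (intro set_integral_mono bounded_measurable_on_integrable pointwise conjunct1[OF total]
        bounded_measurable_on_norm_sq[OF bounded_measurable_avg[OF K ext]])
  also have "\<dots> = (\<Sum>i\<in>{1,2}. 2 * \<alpha>max\<^sup>2 * (\<Sum>j\<in>UNIV. LINT x:cut K|surf. F i j x))"
    unfolding conjunct2[OF total] by (intro sum.cong refl F_sum(2))
  also have "\<dots> \<le> (\<Sum>i\<in>{1,2}. 2 * \<alpha>max\<^sup>2 *
      (C\<^sup>2 / (?h * \<alpha>min) * (LINT x:piece c K i|lebesgue. coef c x * (norm (grad v x))\<^sup>2)))"
    by (intro sum_mono mult_left_mono piece_bound) auto
  also have "\<dots> = (2 * \<alpha>max\<^sup>2 * C\<^sup>2 / \<alpha>min) * piece_energy v K / ?h"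
    unfolding piece_energy_def by (simp add: add_divide_distrib distrib_left mult_ac)
  finally have "(L2norm surf (cut K) (avg c0 c K (grad v)))\<^sup>2 * ?h
      \<le> (2 * \<alpha>max\<^sup>2 * C\<^sup>2 / \<alpha>min) * piece_energy v K"
    unfolding pos_le_divide_eq[OF h] .
  then show ?thesis by (subst mult.commute)
qed

section \<open>Coercivity of the interior penalty form\<close>

lemma gradient_piece_extension:
  assumes "K \<in> Mesh c" "v \<in> VhGam p c"
  shows "\<exists>G. piece_extension K G (grad v)"
  using gradient_on_pieces[OF assms] piece_extensionI[OF assms(1)] by blast

definition flux_jump :: "real \<Rightarrow> (real^'n \<Rightarrow> real) \<Rightarrow> (real^'n) set \<Rightarrow> real" where
  "flux_jump c0 v K = (LINT x:cut K|surf. avg c0 c K (grad v) x \<bullet> jump c v x)"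

lemma B1_diagonal:
  "B1 c0 c \<beta> \<eta>\<beta> v v = energy_sq c v - (1 + \<beta>) * (\<Sum>K\<in>cut_cells c. flux_jump c0 v K) + jump_sq c \<eta>\<beta> v"
  by (simp add: B1_def energy_sq_def jump_sq_def flux_jump_def L2norm_sq dot_square_norm
      inner_commute[of "jump c v _"] distrib_right)

lemma jump_sq_nonneg:
  assumes "0 \<le> \<eta>"
  shows "0 \<le> jump_sq c \<eta> v"
  unfolding jump_sq_def
  using assms cut_cells_subset cell_diameter_pos
  by (intro sum_nonneg mult_nonneg_nonneg divide_nonneg_nonneg) (auto intro: less_imp_le)

text \<open>
  With $A$ the third term of the norm, Young's inequality bounds $|1+\beta|\,|S|$ by
  $\frac{(1+\beta)^2}{2} A$ plus half of the penalty $J$. The assumption on the traces gives $\eta A \le M E$ with $E$ the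
  energy (or $A = 0$, should $M$ be negative), so the lower bounds on $\eta$ ensure that $A \le E$ and
  $\frac{(1+\beta)^2}{2} A \le E/4$. What is left dominates a quarter of $E + J + A$.
\<close>

lemma B1_coercive:
  assumes v: "v \<in> VhGam p c" and \<eta>: "\<eta> > 0" "M \<le> \<eta>" "2 * (1 + \<beta>)\<^sup>2 * M \<le> \<eta>"
    and trace: "\<And>K. K \<in> cut_cells c \<Longrightarrow>
      diameter K * (L2norm surf (cut K) (avg c0 c K (grad v)))\<^sup>2 \<le> M * piece_energy v K"
  shows "B1 c0 c \<beta> \<eta> v v \<ge> 1/4 * (norm_B1 c0 c \<eta> v)\<^sup>2"
proof -
  define E where "E = energy_sq c v"
  define J where "J = jump_sq c \<eta> v"
  define A where "A = (\<Sum>K\<in>cut_cells c. diameter K / \<eta> * (L2norm surf (cut K) (avg c0 c K (grad v)))\<^sup>2)"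
  define b where "b = \<bar>1 + \<beta>\<bar>"
  have E: "0 \<le> E" using sum_cut_energy_le[OF v] sum_nonneg[of "cut_cells c" "piece_energy v"] piece_energy_nonneg
    unfolding E_def by (meson order_trans)
  have J: "0 \<le> J" unfolding J_def using \<eta>(1) by (intro jump_sq_nonneg) simp
  have A: "0 \<le> A"
    unfolding A_def using \<eta>(1) cut_cells_subset cell_diameter_pos
    by (intro sum_nonneg mult_nonneg_nonneg divide_nonneg_nonneg) (auto intro: less_imp_le)
  have AE: "\<eta> * A \<le> M * E \<or> A \<le> 0"
  proof (cases "M \<ge> 0")
    case True
    have "\<eta> * A = (\<Sum>K\<in>cut_cells c. diameter K * (L2norm surf (cut K) (avg c0 c K (grad v)))\<^sup>2)"
      unfolding A_def sum_distrib_left using \<eta>(1) by simp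
    also have "\<dots> \<le> (\<Sum>K\<in>cut_cells c. M * piece_energy v K)"
      by (intro sum_mono trace)
    also have "\<dots> \<le> M * E"
      unfolding E_def sum_distrib_left[symmetric] using True by (intro mult_left_mono sum_cut_energy_le[OF v])
    finally show ?thesis ..
  next
    case False
    have "diameter K / \<eta> * (L2norm surf (cut K) (avg c0 c K (grad v)))\<^sup>2 \<le> 0" if "K \<in> cut_cells c" for K
    proof -
      have "diameter K * (L2norm surf (cut K) (avg c0 c K (grad v)))\<^sup>2 \<le> 0"
        using trace[OF that] False piece_energy_nonneg[of v K] by (auto intro: order_trans simp: mult_nonpos_nonneg)
      then show ?thesis using \<eta>(1) by (simp add: divide_nonpos_pos)
    qed
    then show ?thesis unfolding A_def by (simp add: sum_nonpos)
  qed
  have cross: "b * \<bar>flux_jump c0 v K\<bar> \<le>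
      b\<^sup>2 / 2 * (diameter K / \<eta> * (L2norm surf (cut K) (avg c0 c K (grad v)))\<^sup>2)
      + 1 / 2 * (\<eta> / diameter K * (L2norm surf (cut K) (jump c v))\<^sup>2)" if K: "K \<in> cut_cells c" for K
  proof (cases "b = 0")
    case True
    then show ?thesis using \<eta>(1) cell_diameter_pos[of K] K cut_cells_subset by auto
  next
    case False
    have KM: "K \<in> Mesh c" using K cut_cells_subset by blast
    note h = cell_diameter_pos[OF KM]
    have b: "b > 0" using False by (simp add: b_def)
    obtain G where G: "piece_extension K G (grad v)" using gradient_piece_extension[OF KM v] by blast
    \<comment> \<open>Young parameter chosen such that exactly half of the penalty is used.\<close>
    have "2 * \<bar>flux_jump c0 v K\<bar> \<le> (b * diameter K / \<eta>) * (L2norm surf (cut K) (avg c0 c K (grad v)))\<^sup>2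
        + (L2norm surf (cut K) (jump c v))\<^sup>2 / (b * diameter K / \<eta>)"
      unfolding flux_jump_def L2norm_sq using b h \<eta>(1)
      by (intro set_integral_inner_young bounded_measurable_avg[OF KM G] bounded_measurable_jump[OF KM v]) simp
    then have "b / 2 * (2 * \<bar>flux_jump c0 v K\<bar>) \<le> b / 2 * ((b * diameter K / \<eta>) * (L2norm surf (cut K) (avg c0 c K (grad v)))\<^sup>2
        + (L2norm surf (cut K) (jump c v))\<^sup>2 / (b * diameter K / \<eta>))"
      using b by (intro mult_left_mono) auto
    moreover have "b / 2 * ((b * diameter K / \<eta>) * X + Y / (b * diameter K / \<eta>))
        = b\<^sup>2 / 2 * (diameter K / \<eta> * X) + 1 / 2 * (\<eta> / diameter K * Y)" for X Y
      using b h \<eta>(1) by (simp add: field_simps power2_eq_square)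
    ultimately show ?thesis by simp
  qed
  have "\<bar>(1 + \<beta>) * (\<Sum>K\<in>cut_cells c. flux_jump c0 v K)\<bar> \<le> (\<Sum>K\<in>cut_cells c. b * \<bar>flux_jump c0 v K\<bar>)"
    unfolding abs_mult b_def sum_distrib_left[symmetric] by (intro mult_left_mono sum_abs) auto
  also have "\<dots> \<le> b\<^sup>2 / 2 * A + 1 / 2 * J"
    unfolding A_def J_def jump_sq_def sum_distrib_left sum.distrib[symmetric] by (intro sum_mono cross)
  finally have B: "B1 c0 c \<beta> \<eta> v v \<ge> E + 1/2 * J - b\<^sup>2 / 2 * A"
    unfolding B1_diagonal E_def[symmetric] J_def[symmetric] by linarith
  have "A \<le> E \<and> b\<^sup>2 / 2 * A \<le> 1/4 * E"
  proof (cases "A \<le> 0")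
    case True
    then show ?thesis using E A by simp
  next
    case False
    then have ME: "\<eta> * A \<le> M * E" using AE by simp
    also have "\<dots> \<le> \<eta> * E" using \<eta>(2) E by (rule mult_right_mono)
    finally have "A \<le> E" using \<eta>(1) by simp
    moreover have "\<eta> * (b\<^sup>2 / 2 * A) \<le> \<eta> * (1/4 * E)"
    proof -
      have "\<eta> * (b\<^sup>2 / 2 * A) = b\<^sup>2 / 2 * (\<eta> * A)" by simp
      also have "\<dots> \<le> b\<^sup>2 / 2 * (M * E)" using ME by (intro mult_left_mono) auto
      also have "\<dots> = 1/4 * ((2 * (1 + \<beta>)\<^sup>2 * M) * E)" by (simp add: b_def)
      also have "\<dots> \<le> 1/4 * (\<eta> * E)" using \<eta>(3) E by (intro mult_left_mono mult_right_mono) auto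
      finally show ?thesis by simp
    qed
    ultimately show ?thesis using \<eta>(1) by simp
  qed
  moreover have "(norm_B1 c0 c \<eta> v)\<^sup>2 = E + J + A"
    unfolding norm_B1_def E_def[symmetric] J_def[symmetric] A_def[symmetric] using E J A by simp
  ultimately show ?thesis using B E J by (simp del: distrib_left_numeral) argo
qed

section \<open>Coercivity of the form stabilised by the lifting\<close>

lemma weighted_ip_nonneg:
  assumes "w \<in> WK p c K"
  shows "0 \<le> weighted_ip K w w"
  unfolding weighted_ip_def
proof (rule set_integral_nonneg_real)
  fix x
  show "0 \<le> w x \<bullet> (coef c x *\<^sub>R w x)"
  proof (cases "x \<in> Dom c")
    case True
    then show ?thesis using coef_bounds(1)[OF True] \<alpha>min_pos by simp
  next
    case False
    then have "coef c x *\<^sub>R w x = 0" using WK_weighted[OF assms, of x] by simp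
    then show ?thesis by (simp only: inner_zero_right)
  qed
qed

text \<open>
  Young's inequality obtained from $\langle u \mp t w, u \mp t w\rangle \ge 0$, that is, from bilinearity and positivity
  of the product alone.
\<close>

lemma weighted_ip_young:
  assumes K: "K \<in> Mesh c" and u: "u \<in> WK p c K" and w: "w \<in> WK p c K" and t: "t > 0"
  shows "2 * \<bar>weighted_ip K u w\<bar> \<le> t * weighted_ip K w w + weighted_ip K u u / t"
proof -
  have "2 * (\<epsilon> * weighted_ip K u w) \<le> t * weighted_ip K w w + weighted_ip K u u / t" if \<epsilon>: "\<epsilon>\<^sup>2 = 1" for \<epsilon>
  proof -
    define d where "d = (\<lambda>x. 1 *\<^sub>R u x + (- \<epsilon> * t) *\<^sub>R w x)"
    have d: "d \<in> WK p c K" unfolding d_def by (rule WK_lincomb[OF K u w])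
    have expand: "weighted_ip K d z = weighted_ip K u z - \<epsilon> * t * weighted_ip K w z" if "z \<in> WK p c K" for z
      unfolding d_def using weighted_ip_linear[OF K u w that, of 1 "- \<epsilon> * t"] by simp
    have "0 \<le> weighted_ip K d d" by (rule weighted_ip_nonneg[OF d])
    also have "\<dots> = weighted_ip K d u - \<epsilon> * t * weighted_ip K d w"
      using expand[OF d] weighted_ip_sym[of K u d] weighted_ip_sym[of K w d] by simp
    also have "\<dots> = weighted_ip K u u - 2 * \<epsilon> * t * weighted_ip K u w + \<epsilon>\<^sup>2 * t\<^sup>2 * weighted_ip K w w"
      unfolding expand[OF u] expand[OF w] weighted_ip_sym[of K w u]
      by (simp add: algebra_simps power2_eq_square)
    finally have "0 \<le> weighted_ip K u u - 2 * \<epsilon> * t * weighted_ip K u w + 1 * t\<^sup>2 * weighted_ip K w w"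
      unfolding \<epsilon> .
    then have "t * (2 * (\<epsilon> * weighted_ip K u w)) \<le> t * (t * weighted_ip K w w + weighted_ip K u u / t)"
      using t by (simp add: algebra_simps power2_eq_square)
    then show ?thesis using t by simp
  qed
  from this[of 1] this[of "-1"] show ?thesis by (simp add: abs_if)
qed

lemma set_integral_eq_pieces:
  fixes f :: "real^'n \<Rightarrow> real"
  assumes "piece c K 1 \<union> piece c K 2 \<subseteq> A" "\<And>x. x \<notin> piece c K 1 \<union> piece c K 2 \<Longrightarrow> f x = 0"
  shows "(LINT x:A|lebesgue. f x) = (LINT x:piece c K 1 \<union> piece c K 2|lebesgue. f x)"
proof -
  have "(\<lambda>x. indicator A x *\<^sub>R f x) = (\<lambda>x. indicator (piece c K 1 \<union> piece c K 2) x *\<^sub>R f x)"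
    using assms by (fastforce simp: indicator_def)
  then show ?thesis by (simp only: set_lebesgue_integral_def)
qed

lemma weighted_ip_self:
  assumes w: "w \<in> WK p c K"
  shows "(LINT x:Dom c|lebesgue. coef c x * (w x \<bullet> w x)) = weighted_ip K w w"
    "(L2norm lebesgue K (\<lambda>x. sqrt (coef c x) *\<^sub>R w x))\<^sup>2 = weighted_ip K w w"
proof -
  have "piece c K 1 \<union> piece c K 2 \<subseteq> Dom c" using piece_subset(2) Sub_subset_Dom by blast
  then have "(LINT x:Dom c|lebesgue. coef c x * (w x \<bullet> w x))
      = (LINT x:piece c K 1 \<union> piece c K 2|lebesgue. coef c x * (w x \<bullet> w x))"
    using WK_outside[OF w] by (intro set_integral_eq_pieces) auto
  also have "\<dots> = (LINT x:K|lebesgue. coef c x * (w x \<bullet> w x))"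
    using WK_outside[OF w] piece_subset(1) by (intro set_integral_eq_pieces[symmetric]) auto
  finally show "(LINT x:Dom c|lebesgue. coef c x * (w x \<bullet> w x)) = weighted_ip K w w"
    by (simp add: weighted_ip_def)
  have "(norm (sqrt (coef c x) *\<^sub>R w x))\<^sup>2 = w x \<bullet> (coef c x *\<^sub>R w x)" for x
  proof (cases "x \<in> Dom c")
    case True
    then have "coef c x \<ge> 0" using coef_bounds(1)[OF True] \<alpha>min_pos by simp
    then show ?thesis by (simp add: power_mult_distrib dot_square_norm)
  next
    case False
    then have "x \<notin> piece c K 1 \<union> piece c K 2" using piece_subset(2) Sub_subset_Dom by blast
    then show ?thesis using WK_outside[OF w] by simp
  qed
  then show "(L2norm lebesgue K (\<lambda>x. sqrt (coef c x) *\<^sub>R w x))\<^sup>2 = weighted_ip K w w"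
    by (simp only: L2norm_sq weighted_ip_def)
qed

text \<open>
  The gradient of \<open>v\<close>, cut off outside the two pieces, is an admissible test function for the lifting; its weighted
  square is the energy of \<open>v\<close> in the cell.
\<close>

lemma gradient_in_WK:
  assumes K: "K \<in> Mesh c" and v: "v \<in> VhGam p c"
  shows "\<exists>w\<in>WK p c K. weighted_ip K w w = piece_energy v K \<and>
    (\<forall>c0 x. avg c0 c K (grad v) x = avg c0 c K w x)"
proof -
  obtain G where G: "\<forall>i\<in>{1,2}. (\<forall>j. (\<lambda>x. G i x $ j) \<in> local_space p K) \<and> (\<forall>x\<in>piece c K i. grad v x = G i x)"
    using gradient_on_pieces[OF K v] by (elim exE)
  \<comment> \<open>The pieces are disjoint, so at most one summand is nonzero.\<close>
  define w where "w = (\<lambda>x. \<Sum>i\<in>{1,2}. indicator (piece c K i) x *\<^sub>R G i x)"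
  have w: "w \<in> WK p c K" unfolding w_def using G by (intro WK_glue) blast
  have w_eq: "w x = G i x" if "i \<in> {1,2}" "x \<in> piece c K i" for i x
    using that piece_disjoint[of K K] by (auto simp: w_def indicator_def)
  have ext: "piece_extension K G (grad v)" by (rule piece_extensionI[OF K G])
  then have "piece_extension K G w" using w_eq by (simp add: piece_extension_def del: One_nat_def)
  then have "\<forall>c0 x. avg c0 c K (grad v) x = avg c0 c K w x" using avg_cong[OF ext] by blast
  moreover have "weighted_ip K w w = piece_energy v K"
  proof -
    let ?f = "\<lambda>x. w x \<bullet> (coef c x *\<^sub>R w x)"
    have bm: "bounded_measurable_on lebesgue K ?f"
      by (intro bounded_measurable_on_inner WK_bounded_measurable[OF K w] WK_weighted_bounded_measurable[OF K w])
    have "weighted_ip K w w = (LINT x:piece c K 1 \<union> piece c K 2|lebesgue. ?f x)"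
      unfolding weighted_ip_def using WK_outside[OF w] piece_subset(1) by (intro set_integral_eq_pieces) auto
    also have "\<dots> = (LINT x:piece c K 1|lebesgue. ?f x) + (LINT x:piece c K 2|lebesgue. ?f x)"
      by (intro set_integral_Un piece_disjoint bounded_measurable_on_integrable
          bounded_measurable_on_subset[OF bm] piece_sets piece_subset(1)) auto
    also have "\<dots> = (\<Sum>i\<in>{1,2}. LINT x:piece c K i|lebesgue. ?f x)" by simp
    also have "\<dots> = piece_energy v K"
      unfolding piece_energy_def
    proof (intro sum.cong refl set_lebesgue_integral_cong allI impI)
      fix i x assume i: "i \<in> {1,2::nat}" and x: "x \<in> piece c K i"
      show "?f x = coef c x * (norm (grad v x))\<^sup>2"
        using bspec[OF G i] x w_eq[OF i x] by (simp add: dot_square_norm)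
    qed (rule piece_sets)
    finally show ?thesis .
  qed
  ultimately show ?thesis using w by blast
qed

text \<open>
  Testing the definition of the lifting with the gradient turns each surface integral into a weighted product of the lifting
  and the gradient. Young's inequality with parameter $2/3$ charges $2/3$ of the energy and $3/2$ of the lifting
  term $R$; since $2R \le \eta R$, one quarter of $\eta R$ is left.
\<close>

lemma B2_coercive:
  assumes v: "v \<in> VhGam p c" and \<eta>: "\<eta>1 \<ge> 1" "\<eta> \<ge> 2"
  shows "B2 c0 p c \<eta>1 \<eta> v v \<ge> 1/4 * (norm_B2 c0 p c \<eta>1 \<eta> v)\<^sup>2"
proof -
  define r where "r K = lifting c0 p c K (jump c v)" for K
  define E where "E = energy_sq c v"
  define J where "J = jump_sq c \<eta>1 v"
  define R where "R = (\<Sum>K\<in>cut_cells c. weighted_ip K (r K) (r K))"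
  define S where "S = (\<Sum>K\<in>cut_cells c. flux_jump c0 v K)"
  have KM: "K \<in> Mesh c" if "K \<in> cut_cells c" for K using that cut_cells_subset by blast
  have rW: "r K \<in> WK p c K" if "K \<in> cut_cells c" for K
    unfolding r_def by (rule lifting_properties(1)[OF KM[OF that] bounded_measurable_jump[OF KM[OF that] v]])
  have J: "0 \<le> J" unfolding J_def using \<eta>(1) by (intro jump_sq_nonneg) simp
  have R: "0 \<le> R" unfolding R_def using rW by (intro sum_nonneg weighted_ip_nonneg) blast
  have E: "0 \<le> E" using sum_cut_energy_le[OF v] sum_nonneg[of "cut_cells c" "piece_energy v"] piece_energy_nonneg
    unfolding E_def by (meson order_trans)
  have lift: "lift_sq c0 p c \<eta> v = \<eta> * R"
    unfolding lift_sq_def R_def sum_distrib_left r_def[symmetric]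
    by (intro sum.cong refl) (simp add: weighted_ip_self(2)[OF rW])
  have stab: "(\<Sum>K\<in>cut_cells c. LINT x:Dom c|lebesgue. \<eta> * coef c x * (r K x \<bullet> r K x)) = \<eta> * R"
    unfolding R_def sum_distrib_left
    by (intro sum.cong refl) (simp add: weighted_ip_self(1)[OF rW, symmetric] mult.assoc)
  have cross: "2 * \<bar>flux_jump c0 v K\<bar> \<le> 2/3 * piece_energy v K + 3/2 * weighted_ip K (r K) (r K)"
    if K: "K \<in> cut_cells c" for K
  proof -
    obtain w where w: "w \<in> WK p c K" "weighted_ip K w w = piece_energy v K"
      "\<And>x. avg c0 c K (grad v) x = avg c0 c K w x"
      using gradient_in_WK[OF KM[OF K] v] by blast
    have "flux_jump c0 v K = - weighted_ip K (r K) w"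
      unfolding r_def lifting_properties(2)[OF KM[OF K] bounded_measurable_jump[OF KM[OF K] v] w(1)]
      by (simp add: flux_jump_def w(3) inner_commute)
    then show ?thesis
      using weighted_ip_young[OF KM[OF K] rW[OF K] w(1), of "2/3"] w(2) by simp
  qed
  have "2 * \<bar>S\<bar> \<le> (\<Sum>K\<in>cut_cells c. 2 * \<bar>flux_jump c0 v K\<bar>)"
    unfolding S_def sum_distrib_left[symmetric] by (intro mult_left_mono sum_abs) auto
  also have "\<dots> \<le> (\<Sum>K\<in>cut_cells c. 2/3 * piece_energy v K + 3/2 * weighted_ip K (r K) (r K))"
    by (intro sum_mono cross)
  also have "\<dots> = 2/3 * (\<Sum>K\<in>cut_cells c. piece_energy v K) + 3/2 * R"
    by (simp add: R_def sum.distrib sum_distrib_left)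
  also have "\<dots> \<le> 2/3 * E + 3/2 * R"
    using sum_cut_energy_le[OF v] by (simp add: E_def)
  finally have S: "2 * \<bar>S\<bar> \<le> 2/3 * E + 3/2 * R" .
  have B: "B2 c0 p c \<eta>1 \<eta> v v = E - 2 * S + J + \<eta> * R"
    unfolding B2_def B1_diagonal r_def[symmetric] stab E_def J_def S_def by simp
  have N: "(norm_B2 c0 p c \<eta>1 \<eta> v)\<^sup>2 = E + J + \<eta> * R"
    unfolding norm_B2_def lift E_def[symmetric] J_def[symmetric] using E J R \<eta>(2) by simp
  define X where "X = \<eta> * R"
  have "2 * R \<le> X" unfolding X_def using \<eta>(2) R by (rule mult_right_mono)
  moreover have "2 * S \<le> 2/3 * E + 3/2 * R" using S abs_ge_self[of S] by linarith
  ultimately show ?thesis unfolding B N X_def[symmetric] using E J by (simp add: field_simps)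
qed

end

theorem lemma4p2:
  assumes dim: "CARD('n::finite) = 2 \<or> CARD('n) = 3"
  shows "\<exists>(Cs1 :: real \<Rightarrow> real) (Cs2 :: real \<Rightarrow> real \<Rightarrow> real).
    (\<forall>\<eta>\<beta>>0. Cs1 \<eta>\<beta> > 0) \<and> (\<forall>\<eta>1\<ge>1. \<forall>\<eta>\<ge>2. Cs2 \<eta>1 \<eta> > 0) \<and>
    (\<forall>(\<Omega> :: (real^'n) set) k (F :: 'n problem set) (p :: nat).
       admissible_family \<Omega> k F \<and> 1 \<le> p \<longrightarrow>
         (\<forall>h0 \<beta>. trace_threshold (kappa_const k) F h0 \<longrightarrow>
            (\<exists>\<eta>min>0. \<forall>\<eta>\<beta>\<ge>\<eta>min. \<forall>c\<in>F. mesh_size c \<le> h0 \<longrightarrow>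
               (\<forall>v\<in>VhGam p c.
                  B1 (kappa_const k) c \<beta> \<eta>\<beta> v v \<ge> Cs1 \<eta>\<beta> * (norm_B1 (kappa_const k) c \<eta>\<beta> v)\<^sup>2))) \<and>
         (\<forall>\<eta>1\<ge>1. \<forall>\<eta>\<ge>2. \<forall>c\<in>F. \<forall>v\<in>VhGam p c.
            B2 (kappa_const k) p c \<eta>1 \<eta> v v \<ge> Cs2 \<eta>1 \<eta> * (norm_B2 (kappa_const k) p c \<eta>1 \<eta> v)\<^sup>2))"
proof -
  have problem: "interface_problem c (alpha_min k) (alpha_max k) (reg_const k)"
    if F: "admissible_family \<Omega> k F" and c: "c \<in> F"
    for \<Omega> :: "(real^'n) set" and k F and c :: "'n problem"
  proof -
    have "admissible \<Omega> k c" "polytopal_domain \<Omega>" "0 < alpha_min k"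
      using F c by (auto simp: admissible_family_def)
    then show ?thesis
      using dim by unfold_locales (auto simp: admissible_def polytopal_domain_def)
  qed
  have part1: "\<exists>\<eta>min>0. \<forall>\<eta>\<beta>\<ge>\<eta>min. \<forall>c\<in>F. mesh_size c \<le> h0 \<longrightarrow>
      (\<forall>v\<in>VhGam p c. B1 (kappa_const k) c \<beta> \<eta>\<beta> v v \<ge> 1/4 * (norm_B1 (kappa_const k) c \<eta>\<beta> v)\<^sup>2)"
    if F: "admissible_family \<Omega> k F" and h0: "trace_threshold (kappa_const k) F h0"
    for \<Omega> :: "(real^'n) set" and k and F :: "'n problem set" and p h0 \<beta>
  proof -
    obtain C where C: "\<And>c K i l q. c \<in> F \<Longrightarrow> mesh_size c \<le> h0 \<Longrightarrow> K \<in> cut_cells c \<Longrightarrow> i \<in> {1,2} \<Longrightarrow>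
        q \<in> poly_total l \<Longrightarrow> L2norm surf (K \<inter> Gam c) (\<lambda>x. sqrt (kappa (kappa_const k) c K i) * q x)
             \<le> C l / sqrt (diameter K) * L2norm lebesgue (piece c K i) q"
      using h0 unfolding trace_threshold_def by metis
    define M where "M = 2 * (alpha_max k)\<^sup>2 * (C (CARD('n) * p))\<^sup>2 / alpha_min k"
    \<comment> \<open>The trace constant is fixed before the member \<open>c\<close> of the family is chosen, so the threshold is uniform.\<close>
    define \<eta>min where "\<eta>min = max 1 (max M (2 * (1 + \<beta>)\<^sup>2 * M))"
    have "B1 (kappa_const k) c \<beta> \<eta> v v \<ge> 1/4 * (norm_B1 (kappa_const k) c \<eta> v)\<^sup>2"
      if \<eta>: "\<eta> \<ge> \<eta>min" and c: "c \<in> F" "mesh_size c \<le> h0" and v: "v \<in> VhGam p c" for \<eta> c v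
    proof -
      interpret interface_problem c "alpha_min k" "alpha_max k" "reg_const k"
        by (rule problem[OF F c(1)])
      show ?thesis
      proof (rule B1_coercive[OF v, where M = M])
        show "\<eta> > 0" "M \<le> \<eta>" "2 * (1 + \<beta>)\<^sup>2 * M \<le> \<eta>" using \<eta> by (auto simp: \<eta>min_def)
        fix K assume K: "K \<in> cut_cells c"
        show "diameter K * (L2norm surf (K \<inter> Gam c) (avg (kappa_const k) c K (grad v)))\<^sup>2 \<le> M * piece_energy v K"
          unfolding M_def using K cut_cells_subset
          by (intro avg_gradient_trace_bound[OF _ v] C[OF c K]) auto
      qed
    qed
    moreover have "\<eta>min > 0" by (simp add: \<eta>min_def)
    ultimately show ?thesis by blast
  qed
  have part2: "B2 (kappa_const k) p c \<eta>1 \<eta> v v \<ge> 1/4 * (norm_B2 (kappa_const k) p c \<eta>1 \<eta> v)\<^sup>2"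
    if "admissible_family \<Omega> k F" "c \<in> F" "v \<in> VhGam p c" "\<eta>1 \<ge> 1" "\<eta> \<ge> 2"
    for \<Omega> :: "(real^'n) set" and k and F :: "'n problem set" and p c v \<eta>1 \<eta>
    by (rule interface_problem.B2_coercive[OF problem[OF that(1,2)] that(3-5)])
  show ?thesis
  proof (rule exI[of _ "\<lambda>_. 1/4"], rule exI[of _ "\<lambda>_ _. 1/4"], intro conjI allI impI ballI)
    fix \<Omega> :: "(real^'n) set" and k and F :: "'n problem set" and p :: nat and h0 \<beta> :: real
    assume "admissible_family \<Omega> k F \<and> 1 \<le> p" "trace_threshold (kappa_const k) F h0"
    then show "\<exists>\<eta>min>0. \<forall>\<eta>\<beta>\<ge>\<eta>min. \<forall>c\<in>F. mesh_size c \<le> h0 \<longrightarrow>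
        (\<forall>v\<in>VhGam p c. B1 (kappa_const k) c \<beta> \<eta>\<beta> v v \<ge> 1/4 * (norm_B1 (kappa_const k) c \<eta>\<beta> v)\<^sup>2)"
      by (intro part1) auto
  next
    fix \<Omega> :: "(real^'n) set" and k and F :: "'n problem set" and p :: nat
      and \<eta>1 \<eta> :: real and c :: "'n problem" and v :: "real^'n \<Rightarrow> real"
    assume "admissible_family \<Omega> k F \<and> 1 \<le> p" "1 \<le> \<eta>1" "2 \<le> \<eta>" "c \<in> F" "v \<in> VhGam p c"
    then show "B2 (kappa_const k) p c \<eta>1 \<eta> v v \<ge> 1/4 * (norm_B2 (kappa_const k) p c \<eta>1 \<eta> v)\<^sup>2"
      by (intro part2) auto
  qed auto
qed

end
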